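(* Let $\Phi\colon L^\infty\to\mathbb{R}$ be a map. Then $\Phi$ is a monotone additive statistic if and only if there exists a Borel probability measure $\mu$ on $\overline{\mathbb{R}}$ such that for every $X\in L^\infty$ $$\Phi(X)=\int_{\overline{\mathbb{R}}}K_a(X)\,\mathrm{d}\mu(a).$$ Moreover, in this case the measure $\mu$ is unique.
   Context: $L^\infty$ is the set of bounded real random variables on a fixed nonatomic probability space $(\Omega,\mathcal{F},\mathbb{P})$; each $c\in\mathbb{R}$ is identified with the constant random variable $c$. $\overline{\mathbb{R}}=\mathbb{R}\cup\{-\infty,\infty\}$. $X\ge_1 Y$ denotes first-order stochastic dominance: $\mathbb{P}[X\le t]\le\mathbb{P}[Y\le t]$ for all $t\in\mathbb{R}$. A map $\Phi\colon L^\infty\to\mathbb{R}$ is a statistic if (i) $\Phi(X)=\Phi(Y)$ whenever $X,Y$ have the same distribution and (ii) $\Phi(c)=c$ for every $c\in\mathbb{R}$. It is additive if $\Phi(X+Y)=\Phi(X)+\Phi(Y)$ whenever $X$ and $Y$ are independent. It is monotone if $X\ge_1 Y$ implies $\Phi(X)\ge\Phi(Y)$. A monotone additive statistic is a statistic that is monotone and additive. For $a\in\mathbb{R}\setminus\{0\}$, $K_a(X)=\frac1a\log\mathbb{E}[e^{aX}]$; $K_0(X)=\mathbb{E}[X]$; $K_\infty(X)$ and $K_{-\infty}(X)$ are the essential maximum and essential minimum of $X$. *)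

theory Defs
  imports "HOL-Probability.Probability"
begin

definition nonatomic :: "'a measure \<Rightarrow> bool" where
  "nonatomic M \<longleftrightarrow>
     (\<forall>A\<in>sets M. 0 < measure M A \<longrightarrow>
        (\<exists>B\<in>sets M. B \<subseteq> A \<and> 0 < measure M B \<and> measure M B < measure M A))"

text \<open>Random variables are actual functions here, not classes modulo almost sure equality.
  A law-invariant functional does not distinguish almost surely equal ones.\<close>

definition Linfty :: "'a measure \<Rightarrow> ('a \<Rightarrow> real) set" where
  "Linfty M = {X \<in> borel_measurable M. bounded (X ` space M)}"

definition first_order_dominates ::
    "'a measure \<Rightarrow> ('a \<Rightarrow> real) \<Rightarrow> ('a \<Rightarrow> real) \<Rightarrow> bool" where
  "first_order_dominates M X Y \<longleftrightarrow>
     (\<forall>t. measure M {\<omega> \<in> space M. X \<omega> \<le> t} \<le> measure M {\<omega> \<in> space M. Y \<omega> \<le> t})"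

text \<open>A map defined on \<open>Linfty M\<close> is modelled by a total function \<open>\<Phi>\<close> whose values outside
  \<open>Linfty M\<close> are never referred to.\<close>

definition statistic :: "'a measure \<Rightarrow> (('a \<Rightarrow> real) \<Rightarrow> real) \<Rightarrow> bool" where
  "statistic M \<Phi> \<longleftrightarrow>
     (\<forall>X\<in>Linfty M. \<forall>Y\<in>Linfty M. distr M borel X = distr M borel Y \<longrightarrow> \<Phi> X = \<Phi> Y) \<and>
     (\<forall>c. \<Phi> (\<lambda>_. c) = c)"

definition additive_stat :: "'a measure \<Rightarrow> (('a \<Rightarrow> real) \<Rightarrow> real) \<Rightarrow> bool" where
  "additive_stat M \<Phi> \<longleftrightarrow>
     (\<forall>X\<in>Linfty M. \<forall>Y\<in>Linfty M. prob_space.indep_var M borel X borel Y \<longrightarrow>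
        \<Phi> (\<lambda>\<omega>. X \<omega> + Y \<omega>) = \<Phi> X + \<Phi> Y)"

definition monotone_stat :: "'a measure \<Rightarrow> (('a \<Rightarrow> real) \<Rightarrow> real) \<Rightarrow> bool" where
  "monotone_stat M \<Phi> \<longleftrightarrow>
     (\<forall>X\<in>Linfty M. \<forall>Y\<in>Linfty M. first_order_dominates M X Y \<longrightarrow> \<Phi> Y \<le> \<Phi> X)"

definition monotone_additive_statistic ::
    "'a measure \<Rightarrow> (('a \<Rightarrow> real) \<Rightarrow> real) \<Rightarrow> bool" where
  "monotone_additive_statistic M \<Phi> \<longleftrightarrow>
     statistic M \<Phi> \<and> monotone_stat M \<Phi> \<and> additive_stat M \<Phi>"

definition ess_max :: "'a measure \<Rightarrow> ('a \<Rightarrow> real) \<Rightarrow> real" where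
  "ess_max M X = real_of_ereal (esssup M (\<lambda>\<omega>. ereal (X \<omega>)))"

definition ess_min :: "'a measure \<Rightarrow> ('a \<Rightarrow> real) \<Rightarrow> real" where
  "ess_min M X = - ess_max M (\<lambda>\<omega>. - X \<omega>)"

definition K_stat :: "'a measure \<Rightarrow> ereal \<Rightarrow> ('a \<Rightarrow> real) \<Rightarrow> real" where
  "K_stat M a X =
     (case a of
        ereal r \<Rightarrow>
          if r = 0 then (\<integral>\<omega>. X \<omega> \<partial>M)
          else 1 / r * ln (\<integral>\<omega>. exp (r * X \<omega>) \<partial>M)
      | PInfty \<Rightarrow> ess_max M X
      | MInfty \<Rightarrow> ess_min M X)"

definition borel_prob_measure :: "ereal measure \<Rightarrow> bool" where
  "borel_prob_measure \<mu> \<longleftrightarrow> sets \<mu> = sets borel \<and> prob_space \<mu>"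

definition represents ::
    "'a measure \<Rightarrow> ereal measure \<Rightarrow> (('a \<Rightarrow> real) \<Rightarrow> real) \<Rightarrow> bool" where
  "represents M \<mu> \<Phi> \<longleftrightarrow>
     (\<forall>X\<in>Linfty M. has_bochner_integral \<mu> (\<lambda>a. K_stat M a X) (\<Phi> X))"

end

theory Submission
  imports Defs "HOL-Real_Asymp.Real_Asymp"
begin

text \<open>Each \<open>K_a\<close> is itself a monotone additive statistic, which gives one implication.

  Conversely, \<open>\<Phi>\<close> is monotone in the family of all \<open>K_a\<close>, not just in first-order dominance.
  Suppose \<open>X\<close>, \<open>Y\<close> take values in a grid and \<open>K_a X > K_a Y\<close> for all \<open>a\<close>. Then the polynomial
  \<open>(E t^X - E t^Y) / (t - 1)\<close> is positive for \<open>t > 0\<close>, so by Polya's theorem its product with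
  some \<open>(1 + t)^n\<close> has nonnegative coefficients. This says that \<open>X + Z\<close> dominates \<open>Y + Z\<close> for an
  independent binomial \<open>Z\<close>, and additivity cancels \<open>\<Phi> Z\<close>.

  Hence \<open>\<Phi>\<close> induces a positive linear functional on the uniform closure of the span of the
  functions \<open>a \<mapsto> K_a X\<close>. Values \<open>t n\<close> taken with probability \<open>exp (- n)\<close> show that this closure
  contains the ramps \<open>a \<mapsto> max 0 (t - 1 / a)\<close> on \<open>a > 0\<close> and their mirror images. Tent functions built
  from ramps yield quadrature measures that approximate the functional, and a weak limit of these
  represents it. Difference quotients of ramps converge to indicators of half lines, so the
  representing measure is unique.\<close>

section \<open>Cumulant functionals of essentially bounded variables\<close>

text \<open>Polya's theorem requires strict positivity, also of the lowest and of the leading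
  coefficient, whereas comparing all \<open>K_a\<close> of two laws gives weak inequalities only.
  Rounding the larger law up and the smaller one down on a fine grid supplies the strictness at a
  cost that tends to 0. Division by \<open>t - 1\<close> removes the sign change at
  \<open>t = 1\<close> and turns differences of point masses into differences of distribution
  functions, so that nonnegative coefficients mean first-order dominance.

  The probability \<open>exp (- n)\<close> is matched to the value \<open>t n\<close>: for
  \<open>a > 0\<close> the exponential moment is about \<open>1 + exp (n (a t - 1))\<close>. Its two
  terms change places at \<open>a = 1 / t\<close>, which is the kink of the ramp, and
  \<open>1 / (a n)\<close> times the logarithm tends to \<open>max 0 (t - 1 / a)\<close>.

  The tents form a partition of unity; by positivity their values under the functional are the
  nonnegative weights of a quadrature. Since \<open>K_a X\<close> is continuous in \<open>a\<close>
  up to both infinite endpoints, the errors are uniformly small and the integrals survive the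
  passage to a weak limit on a compact interval.\<close>

definition ess_bounded :: "'a measure \<Rightarrow> ('a \<Rightarrow> real) \<Rightarrow> bool" where
  "ess_bounded M X \<longleftrightarrow> X \<in> borel_measurable M \<and> (\<exists>B. AE x in M. \<bar>X x\<bar> \<le> B)"

lemma ess_boundedE:
  assumes "ess_bounded M X"
  obtains B where "B \<ge> 0" "AE x in M. \<bar>X x\<bar> \<le> B"
proof -
  obtain B where "AE x in M. \<bar>X x\<bar> \<le> B" using assms by (auto simp: ess_bounded_def)
  then have "AE x in M. \<bar>X x\<bar> \<le> max B 0" by eventually_elim auto
  then show thesis using that[of "max B 0"] by simp
qed

lemma ess_boundedI: "X \<in> borel_measurable M \<Longrightarrow> (AE x in M. \<bar>X x\<bar> \<le> B) \<Longrightarrow> ess_bounded M X"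
  by (auto simp: ess_bounded_def)

lemma Linfty_ess_bounded: "X \<in> Linfty M \<Longrightarrow> ess_bounded M X"
  by (fastforce simp: Linfty_def ess_bounded_def bounded_iff)

text \<open>Boundedness at every point is not a property of the law. This essential version is,
  which allows variables to be moved to other probability spaces.\<close>

lemma ess_bounded_distr_iff:
  assumes [measurable]: "X \<in> borel_measurable M"
  shows "ess_bounded M X \<longleftrightarrow> (\<exists>B. AE x in distr M borel X. \<bar>x\<bar> \<le> B)"
  using AE_distr_iff[of X M borel "\<lambda>x. \<bar>x\<bar> \<le> B" for B] by (simp add: ess_bounded_def)

lemma ess_bounded_add:
  assumes "ess_bounded M X" "ess_bounded M Y"
  shows "ess_bounded M (\<lambda>x. X x + Y x)"
proof -
  obtain B where B: "AE x in M. \<bar>X x\<bar> \<le> B" using assms by (auto simp: ess_bounded_def)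
  obtain C where C: "AE x in M. \<bar>Y x\<bar> \<le> C" using assms by (auto simp: ess_bounded_def)
  have "AE x in M. \<bar>X x + Y x\<bar> \<le> B + C"
    using B C by eventually_elim (simp add: abs_le_iff)
  with assms show ?thesis by (intro ess_boundedI) (auto simp: ess_bounded_def)
qed

lemma ess_bounded_const: "ess_bounded M (\<lambda>_. c)"
  by (rule ess_boundedI[where B="\<bar>c\<bar>"]) auto

lemma ess_bounded_uminus: "ess_bounded M X \<Longrightarrow> ess_bounded M (\<lambda>x. - X x)"
  by (auto simp: ess_bounded_def)

section \<open>The essential maximum and the elementary properties of \<open>K_a\<close>\<close>

context prob_space
begin

text \<open>Essential boundedness keeps \<open>esssup\<close> finite, so
  \<open>real_of_ereal\<close> loses nothing; the lower bound uses that a probability space is not a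
  null set. Later facts about \<open>ess_max\<close> rest on this equivalence.\<close>

lemma ess_max_le_iff:
  assumes X: "ess_bounded M X"
  shows "ess_max M X \<le> c \<longleftrightarrow> (AE x in M. X x \<le> c)"
proof -
  have m [measurable]: "X \<in> borel_measurable M" using X by (simp add: ess_bounded_def)
  obtain B where B: "AE x in M. \<bar>X x\<bar> \<le> B" using X by (auto simp: ess_bounded_def)
  let ?s = "esssup M (\<lambda>x. ereal (X x))"
  have "?s \<le> ereal B"
    by (rule esssup_I) (use B in \<open>auto elim!: eventually_mono\<close>)
  moreover have "ereal (- B) \<le> ?s"
  proof -
    have "AE x in M. ereal (- B) \<le> ?s"
      using B esssup_AE[of "\<lambda>x. ereal (X x)" M]
    proof eventually_elim
      case (elim x)
      then have "ereal (-B) \<le> ereal (X x)" by simp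
      with elim show ?case by (meson order_trans)
    qed
    then show ?thesis by simp
  qed
  ultimately obtain r where r: "?s = ereal r"
    by (cases ?s) auto
  have "(AE x in M. X x \<le> c) \<longleftrightarrow> ?s \<le> ereal c"
  proof
    assume "AE x in M. X x \<le> c"
    then show "?s \<le> ereal c" by (intro esssup_I) auto
  next
    assume c: "?s \<le> ereal c"
    show "AE x in M. X x \<le> c"
      using esssup_AE[of "\<lambda>x. ereal (X x)" M]
    proof eventually_elim
      case (elim x)
      then have "ereal (X x) \<le> ereal c" using c by (rule order_trans)
      then show ?case by simp
    qed
  qed
  then show ?thesis by (simp add: ess_max_def r)
qed

lemma AE_le_ess_max: "ess_bounded M X \<Longrightarrow> AE x in M. X x \<le> ess_max M X"
  using ess_max_le_iff by blast

lemma integrable_ess_bounded: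
  assumes "ess_bounded M X" shows "integrable M X"
proof -
  obtain B where "AE x in M. \<bar>X x\<bar> \<le> B" using assms by (auto simp: ess_bounded_def)
  then show ?thesis
    by (intro integrable_const_bound[where B=B]) (use assms in \<open>auto simp: ess_bounded_def\<close>)
qed

lemma integrable_exp_ess_bounded:
  assumes X: "ess_bounded M X" shows "integrable M (\<lambda>x. exp (r * X x))"
proof -
  obtain B where "AE x in M. \<bar>X x\<bar> \<le> B" using assms by (auto simp: ess_bounded_def)
  then have "AE x in M. norm (exp (r * X x)) \<le> exp (\<bar>r\<bar> * B)"
  proof eventually_elim
    case (elim x)
    have "r * X x \<le> \<bar>r\<bar> * \<bar>X x\<bar>" by (metis abs_ge_self abs_mult)
    also have "\<dots> \<le> \<bar>r\<bar> * B" using elim by (intro mult_left_mono) auto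
    finally show ?case by simp
  qed
  then show ?thesis
    by (intro integrable_const_bound[where B="exp (\<bar>r\<bar> * B)"]) (use X in \<open>auto simp: ess_bounded_def\<close>)
qed

lemma integral_exp_pos:
  assumes X: "ess_bounded M X" shows "(\<integral>x. exp (r * X x) \<partial>M) > 0"
  using integral_less_AE_space[of "\<lambda>_. 0" "\<lambda>x. exp (r * X x)"] integrable_exp_ess_bounded[OF X]
  by (simp add: emeasure_space_1)

lemma K_stat_mono_AE:
  assumes X: "ess_bounded M X" and Y: "ess_bounded M Y" and le: "AE x in M. X x \<le> Y x"
  shows "K_stat M a X \<le> K_stat M a Y"
proof (cases a)
  case (real r)
  note ie = integrable_exp_ess_bounded[OF X, of r] integrable_exp_ess_bounded[OF Y, of r]
  consider "r = 0" | "r > 0" | "r < 0" by linarith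
  then show ?thesis
  proof cases
    case 1
    then show ?thesis
      using real integral_mono_AE[OF integrable_ess_bounded[OF X] integrable_ess_bounded[OF Y] le]
      by (simp add: K_stat_def)
  next
    case 2
    have "(\<integral>x. exp (r * X x) \<partial>M) \<le> (\<integral>x. exp (r * Y x) \<partial>M)"
      using le 2 by (intro integral_mono_AE ie) (auto elim!: eventually_mono)
    then show ?thesis
      using 2 real integral_exp_pos[OF X, of r]
      by (simp add: K_stat_def divide_right_mono)
  next
    case 3
    have "(\<integral>x. exp (r * Y x) \<partial>M) \<le> (\<integral>x. exp (r * X x) \<partial>M)"
      using le 3 by (intro integral_mono_AE ie) (auto elim!: eventually_mono)
    then show ?thesis
      using 3 real integral_exp_pos[OF Y, of r]
      by (simp add: K_stat_def divide_right_mono_neg)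
  qed
next
  case PInf
  have "AE x in M. X x \<le> ess_max M Y"
    using le AE_le_ess_max[OF Y] by eventually_elim simp
  then show ?thesis using PInf by (simp add: K_stat_def ess_max_le_iff[OF X])
next
  case MInf
  have "AE x in M. - Y x \<le> ess_max M (\<lambda>x. - X x)"
    using le AE_le_ess_max[OF ess_bounded_uminus[OF X]] by eventually_elim simp
  then show ?thesis
    using MInf by (simp add: K_stat_def ess_min_def ess_max_le_iff[OF ess_bounded_uminus[OF Y]])
qed

lemma ess_max_unique:
  assumes "ess_bounded M X" "\<And>c. (AE x in M. X x \<le> c) \<longleftrightarrow> m \<le> c"
  shows "ess_max M X = m"
  using assms ess_max_le_iff[OF assms(1)] by (metis order_antisym order_refl)

lemma K_stat_const: "K_stat M a (\<lambda>_. c) = c"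
proof -
  have "ess_max M (\<lambda>_. d) = d" for d
    by (rule ess_max_unique) (auto simp: ess_bounded_const)
  then show ?thesis
    by (cases a) (auto simp: K_stat_def prob_space ess_min_def)
qed

lemma K_stat_shift:
  assumes X: "ess_bounded M X"
  shows "K_stat M a (\<lambda>x. X x + c) = K_stat M a X + c"
proof -
  have 1: "ess_max M (\<lambda>x. Y x + d) = ess_max M Y + d" if Y: "ess_bounded M Y" for Y d
  proof (rule ess_max_unique)
    show "ess_bounded M (\<lambda>x. Y x + d)" by (intro ess_bounded_add ess_bounded_const Y)
    show "(AE x in M. Y x + d \<le> e) \<longleftrightarrow> ess_max M Y + d \<le> e" for e
      using ess_max_le_iff[OF Y, of "e - d"] by (simp add: le_diff_eq)
  qed
  show ?thesis
  proof (cases a)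
    case (real r)
    have "ln (\<integral>x. exp (r * (X x + c)) \<partial>M) = ln (\<integral>x. exp (r * X x) \<partial>M) + r * c"
      using integral_exp_pos[OF X, of r] by (simp add: distrib_left exp_add ln_mult)
    then show ?thesis
      using real integrable_ess_bounded[OF X] by (simp add: K_stat_def prob_space field_simps)
  next
    case PInf then show ?thesis by (simp add: K_stat_def 1[OF X])
  next
    case MInf then show ?thesis
      using 1[OF ess_bounded_uminus[OF X], of "-c"] by (simp add: K_stat_def ess_min_def)
  qed
qed

text \<open>This reflection reduces the negative half of the parameter range to the positive
  half.\<close>

lemma K_stat_uminus: "K_stat M a (\<lambda>x. - X x) = - K_stat M (- a) X"
  by (cases a) (auto simp: K_stat_def ess_min_def)

text \<open>Monotonicity and translation equivariance alone give Lipschitz constant 1 for the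
  essential supremum norm, uniformly in \<open>a\<close>.\<close>

lemma K_stat_diff_le:
  assumes X: "ess_bounded M X" and Y: "ess_bounded M Y" and le: "AE x in M. \<bar>X x - Y x\<bar> \<le> e"
  shows "\<bar>K_stat M a X - K_stat M a Y\<bar> \<le> e"
proof -
  have "K_stat M a X \<le> K_stat M a (\<lambda>x. Y x + e)"
    using le by (intro K_stat_mono_AE X ess_bounded_add Y ess_bounded_const) (auto elim!: eventually_mono)
  moreover have "K_stat M a Y \<le> K_stat M a (\<lambda>x. X x + e)"
    using le by (intro K_stat_mono_AE X ess_bounded_add Y ess_bounded_const) (auto elim!: eventually_mono)
  ultimately show ?thesis using K_stat_shift[OF X] K_stat_shift[OF Y] by (simp add: abs_le_iff)
qed

lemma K_stat_abs_le:
  assumes "X \<in> borel_measurable M" "AE x in M. \<bar>X x\<bar> \<le> B"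
  shows "\<bar>K_stat M a X\<bar> \<le> B"
  using K_stat_diff_le[OF ess_boundedI[OF assms] ess_bounded_const[of M 0], of B a] assms(2)
  by (simp add: K_stat_const)

lemma indep_var_prob_Int:
  fixes X Y :: "'a \<Rightarrow> real"
  assumes "indep_var borel X borel Y" "A \<in> sets borel" "B \<in> sets borel"
  shows "prob {x \<in> space M. X x \<in> A \<and> Y x \<in> B} = prob {x \<in> space M. X x \<in> A} * prob {x \<in> space M. Y x \<in> B}"
proof -
  have "prob ((\<lambda>x. (X x, Y x)) -` (A \<times> B) \<inter> space M) = prob (X -` A \<inter> space M) * prob (Y -` B \<inter> space M)"
    by (rule indep_varD[OF assms])
  moreover have "(\<lambda>x. (X x, Y x)) -` (A \<times> B) \<inter> space M = {x \<in> space M. X x \<in> A \<and> Y x \<in> B}"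
      "X -` A \<inter> space M = {x \<in> space M. X x \<in> A}" "Y -` B \<inter> space M = {x \<in> space M. Y x \<in> B}"
    by auto
  ultimately show ?thesis by simp
qed

text \<open>Independence serves one inequality: with positive probability both variables lie within
  \<open>e\<close> of their essential maxima at the same time.\<close>

lemma ess_max_add:
  assumes X: "ess_bounded M X" and Y: "ess_bounded M Y" and ind: "indep_var borel X borel Y"
  shows "ess_max M (\<lambda>x. X x + Y x) = ess_max M X + ess_max M Y"
proof (rule ess_max_unique)
  have [measurable]: "X \<in> borel_measurable M" "Y \<in> borel_measurable M"
    using X Y by (auto simp: ess_bounded_def)
  show "ess_bounded M (\<lambda>x. X x + Y x)" by (intro ess_bounded_add X Y)
  show "(AE x in M. X x + Y x \<le> c) \<longleftrightarrow> ess_max M X + ess_max M Y \<le> c" for c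
  proof
    assume "ess_max M X + ess_max M Y \<le> c"
    then show "AE x in M. X x + Y x \<le> c"
      using AE_le_ess_max[OF X] AE_le_ess_max[OF Y] by (auto elim: eventually_elim2)
  next
    assume c: "AE x in M. X x + Y x \<le> c"
    show "ess_max M X + ess_max M Y \<le> c"
    proof (rule ccontr)
      assume "\<not> ?thesis"
      then have e: "ess_max M X + ess_max M Y - c > 0" by simp
      \<comment> \<open>Half of the gap, so that exceeding both thresholds forces the sum above
        \<open>c\<close>.\<close>
      define e where "e = (ess_max M X + ess_max M Y - c) / 2"
      have e: "e > 0" using e by (simp add: e_def)
      have pos: "prob {x \<in> space M. Z x \<in> {ess_max M Z - e <..}} > 0" if Z: "ess_bounded M Z" for Z
      proof -
        have [measurable]: "Z \<in> borel_measurable M" using Z by (simp add: ess_bounded_def)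
        have "\<not> (AE x in M. Z x \<le> ess_max M Z - e)"
          using ess_max_le_iff[OF Z, of "ess_max M Z - e"] e by simp
        then have "prob {x \<in> space M. \<not> Z x \<le> ess_max M Z - e} \<noteq> 0"
          by (subst (asm) AE_iff_measurable[OF _ refl]) (auto simp: emeasure_eq_measure)
        then show ?thesis by (simp add: not_le zero_less_measure_iff)
      qed
      have "prob {x \<in> space M. X x \<in> {ess_max M X - e <..} \<and> Y x \<in> {ess_max M Y - e <..}} > 0"
        by (subst indep_var_prob_Int[OF ind]) (use pos[OF X] pos[OF Y] in auto)
      moreover have "prob {x \<in> space M. X x \<in> {ess_max M X - e <..} \<and> Y x \<in> {ess_max M Y - e <..}} = 0"
      proof (rule prob_eq_0_AE)
        show "AE x in M. \<not> (X x \<in> {ess_max M X - e <..} \<and> Y x \<in> {ess_max M Y - e <..})"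
          using c
        proof eventually_elim
          case (elim x)
          then show ?case by (auto simp: e_def field_simps)
        qed
      qed
      ultimately show False by simp
    qed
  qed
qed

lemma K_stat_add:
  assumes X: "ess_bounded M X" and Y: "ess_bounded M Y" and ind: "indep_var borel X borel Y"
  shows "K_stat M a (\<lambda>x. X x + Y x) = K_stat M a X + K_stat M a Y"
proof (cases a)
  case (real r)
  have "indep_var borel ((\<lambda>x. exp (r * x)) \<circ> X) borel ((\<lambda>x. exp (r * x)) \<circ> Y)"
    by (rule indep_var_compose[OF ind]) auto
  then have "(\<integral>x. exp (r * X x) * exp (r * Y x) \<partial>M) = (\<integral>x. exp (r * X x) \<partial>M) * (\<integral>x. exp (r * Y x) \<partial>M)"
    using indep_var_lebesgue_integral[of "\<lambda>x. exp (r * X x)" "\<lambda>x. exp (r * Y x)"]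
      integrable_exp_ess_bounded[OF X] integrable_exp_ess_bounded[OF Y] by (simp add: o_def)
  then have "ln (\<integral>x. exp (r * (X x + Y x)) \<partial>M) = ln (\<integral>x. exp (r * X x) \<partial>M) + ln (\<integral>x. exp (r * Y x) \<partial>M)"
    using integral_exp_pos[OF X, of r] integral_exp_pos[OF Y, of r]
    by (simp add: distrib_left exp_add ln_mult)
  then show ?thesis
    using real integrable_ess_bounded[OF X] integrable_ess_bounded[OF Y]
    by (simp add: K_stat_def add_divide_distrib)
next
  case PInf then show ?thesis by (simp add: K_stat_def ess_max_add[OF X Y ind])
next
  case MInf
  have "indep_var borel (uminus \<circ> X) borel (uminus \<circ> Y)"
    by (rule indep_var_compose[OF ind]) auto
  then have "ess_max M (\<lambda>x. - X x + - Y x) = ess_max M (\<lambda>x. - X x) + ess_max M (\<lambda>x. - Y x)"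
    by (intro ess_max_add ess_bounded_uminus X Y) (simp add: o_def)
  then show ?thesis using MInf by (simp add: K_stat_def ess_min_def)
qed

end

section \<open>Dependence on the law and monotonicity in first-order dominance\<close>

lemma K_stat_law:
  assumes "prob_space M" "prob_space N" and X: "ess_bounded M X"
    and mY [measurable]: "Y \<in> borel_measurable N"
    and law: "distr M borel X = distr N borel Y"
  shows "K_stat M a X = K_stat N a Y"
proof -
  interpret M: prob_space M by fact
  interpret N: prob_space N by fact
  have mX [measurable]: "X \<in> borel_measurable M" using X by (simp add: ess_bounded_def)
  have Y: "ess_bounded N Y"
    using X unfolding ess_bounded_distr_iff[OF mX] ess_bounded_distr_iff[OF mY] law .
  have int: "(\<integral>x. f (X x) \<partial>M) = (\<integral>x. f (Y x) \<partial>N)" if [measurable]: "f \<in> borel_measurable borel"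
    for f :: "real \<Rightarrow> real"
    using integral_distr[of X M borel f] integral_distr[of Y N borel f] law by simp
  have AE: "(AE x in M. X x \<in> A) \<longleftrightarrow> (AE x in N. Y x \<in> A)" if [measurable]: "A \<in> sets borel" for A
    using AE_distr_iff[of X M borel "\<lambda>x. x \<in> A"] AE_distr_iff[of Y N borel "\<lambda>x. x \<in> A"]
    unfolding law by simp
  have mx: "ess_max M X = ess_max N Y"
    using AE[of "{..c}" for c] by (intro M.ess_max_unique X) (simp add: N.ess_max_le_iff[OF Y])
  have mn: "ess_max M (\<lambda>x. - X x) = ess_max N (\<lambda>x. - Y x)"
    using AE[of "{- c..}" for c] by (intro M.ess_max_unique ess_bounded_uminus X)
      (simp add: N.ess_max_le_iff[OF ess_bounded_uminus[OF Y]] minus_le_iff)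
  show ?thesis
    using int[of "\<lambda>x. x"] int[of "\<lambda>x. exp (r * x)" for r]
    by (cases a) (auto simp: K_stat_def ess_min_def mx mn)
qed

text \<open>Quantile coupling: on the unit interval with Lebesgue measure the pseudoinverses of the
  distribution functions have the given laws, and dominance becomes a pointwise inequality between
  them.\<close>

lemma K_stat_first_order_mono:
  assumes "prob_space M" and X: "ess_bounded M X" and Y: "ess_bounded M Y"
    and dom: "first_order_dominates M X Y"
  shows "K_stat M a Y \<le> K_stat M a X"
proof -
  interpret M: prob_space M by fact
  have mX [measurable]: "X \<in> borel_measurable M" using X by (simp add: ess_bounded_def)
  have mY [measurable]: "Y \<in> borel_measurable M" using Y by (simp add: ess_bounded_def)
  interpret DX: cdf_distribution "distr M borel X"
    by (simp add: cdf_distribution_def)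
  interpret DY: cdf_distribution "distr M borel Y"
    by (simp add: cdf_distribution_def)
  let ?N = "restrict_space lborel {0<..<1::real}"
  interpret N: prob_space ?N
    by (auto simp: space_restrict_space emeasure_restrict_space intro!: prob_spaceI)
  have cdf_eq: "cdf (distr M borel Z) t = measure M {x \<in> space M. Z x \<le> t}"
    if [measurable]: "Z \<in> borel_measurable M" for Z t
    by (auto simp: cdf_def measure_distr intro!: arg_cong[where f="measure M"])
  have le: "DX.C t \<le> DY.C t" for t
    using dom by (simp add: cdf_eq first_order_dominates_def)
  have mIX: "DX.I \<in> borel_measurable ?N" and mIY: "DY.I \<in> borel_measurable ?N"
    using DX.measurable_CI DY.measurable_CI
    by (simp_all add: measurable_def sets_restrict_space space_restrict_space)
  have I: "DY.I w \<le> DX.I w" if w: "w \<in> {0<..<1}" for w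
  proof -
    have "w \<le> DX.C (DX.I w)" using DX.pseudoinverse[of w "DX.I w"] w by simp
    then have "w \<le> DY.C (DX.I w)" using le by (rule order_trans)
    then show ?thesis using DY.pseudoinverse[of w "DX.I w"] w by simp
  qed
  have lX: "distr M borel X = distr ?N borel DX.I" and lY: "distr M borel Y = distr ?N borel DY.I"
    using DX.distr_I_eq_M DY.distr_I_eq_M by simp_all
  have bX: "ess_bounded ?N DX.I"
    using X unfolding ess_bounded_distr_iff[OF mX] ess_bounded_distr_iff[OF mIX] DX.distr_I_eq_M .
  have bY: "ess_bounded ?N DY.I"
    using Y unfolding ess_bounded_distr_iff[OF mY] ess_bounded_distr_iff[OF mIY] DY.distr_I_eq_M .
  have "K_stat ?N a DY.I \<le> K_stat ?N a DX.I"
    using I by (intro N.K_stat_mono_AE bX bY AE_I2) (auto simp: space_restrict_space)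
  then show ?thesis
    using K_stat_law[OF M.prob_space_axioms N.prob_space_axioms X mIX lX, of a]
      K_stat_law[OF M.prob_space_axioms N.prob_space_axioms Y mIY lY, of a] by simp
qed

section \<open>Continuity in the parameter\<close>

text \<open>The homeomorphism \<open>a \<mapsto> a / (1 + \<bar>a\<bar>)\<close> from the extended reals onto \<open>[-1, 1]\<close>,
  and its inverse extended constantly to the real line.\<close>

definition squash :: "ereal \<Rightarrow> real" where
  "squash a = (if a = \<infinity> then 1 else if a = -\<infinity> then -1
     else real_of_ereal a / (1 + \<bar>real_of_ereal a\<bar>))"

definition unsquash :: "real \<Rightarrow> ereal" where
  "unsquash u = (if u \<ge> 1 then \<infinity> else if u \<le> -1 then -\<infinity> else ereal (u / (1 - \<bar>u\<bar>)))"

lemma measurable_squash [measurable]: "squash \<in> borel_measurable borel"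
  unfolding squash_def by measurable

lemma measurable_unsquash [measurable]: "unsquash \<in> borel_measurable borel"
  unfolding unsquash_def by measurable

lemma squash_bounds: "\<bar>squash a\<bar> \<le> 1"
  by (cases a) (auto simp: squash_def field_simps)

lemma unsquash_squash [simp]: "unsquash (squash a) = a"
proof (cases a)
  case (real r)
  have "r < 1 + \<bar>r\<bar>" "- (1 + \<bar>r\<bar>) < r" by auto
  then have lt: "r / (1 + \<bar>r\<bar>) < 1" "-1 < r / (1 + \<bar>r\<bar>)"
    by (simp_all add: field_simps)
  have "1 - \<bar>r\<bar> / (1 + \<bar>r\<bar>) = 1 / (1 + \<bar>r\<bar>)"
    by (simp add: field_simps)
  with lt real show ?thesis by (simp add: squash_def unsquash_def abs_divide)
qed (auto simp: squash_def unsquash_def)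

lemma unsquash_uminus: "unsquash (- u) = - unsquash u"
  by (auto simp: unsquash_def)

text \<open>For negative \<open>y\<close> put \<open>t = - y\<close>: the second-order Taylor
  polynomial, a lower bound of \<open>exp t\<close>, has product at least 1 with
  \<open>1 - t + t^2\<close>.\<close>

lemma exp_le_quadratic:
  fixes y :: real assumes "\<bar>y\<bar> \<le> 1" shows "exp y \<le> 1 + y + y\<^sup>2"
proof (cases "y \<ge> 0")
  case True then show ?thesis using exp_bound[of y] assms by simp
next
  case False
  define t where "t = - y"
  have t: "t \<ge> 0" using False by (simp add: t_def)
  have "1 \<le> 1 + (t\<^sup>2 + t ^ 3 + t ^ 4) / 2" using t by simp
  also have "\<dots> = (1 - t + t\<^sup>2) * (1 + t + t\<^sup>2 / 2)"
    by (simp add: field_simps power2_eq_square power3_eq_cube power4_eq_xxxx)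
  also have "\<dots> \<le> (1 - t + t\<^sup>2) * exp t"
  proof (rule mult_left_mono)
    show "1 + t + t\<^sup>2 / 2 \<le> exp t" by (rule exp_lower_Taylor_quadratic[OF t])
    have "1 - t + t\<^sup>2 = (1 - t / 2)\<^sup>2 + 3 / 4 * t\<^sup>2" by (simp add: power2_eq_square algebra_simps)
    then show "0 \<le> 1 - t + t\<^sup>2" by simp
  qed
  finally have "exp (- t) \<le> 1 - t + t\<^sup>2" by (simp add: exp_minus field_simps)
  then show ?thesis by (simp add: t_def)
qed

section \<open>Continuity of \<open>K_a\<close> in \<open>a\<close>, including the infinite
  endpoints\<close>

context prob_space
begin

lemma ln_mgf_Lipschitz:
  assumes X: "ess_bounded M X" and B: "AE x in M. \<bar>X x\<bar> \<le> B"
  shows "\<bar>ln (\<integral>x. exp (r * X x) \<partial>M) - ln (\<integral>x. exp (s * X x) \<partial>M)\<bar> \<le> B * \<bar>r - s\<bar>"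
proof -
  have le: "ln (\<integral>x. exp (r * X x) \<partial>M) \<le> ln (\<integral>x. exp (s * X x) \<partial>M) + B * \<bar>r - s\<bar>" for r s
  proof -
    have "(\<integral>x. exp (r * X x) \<partial>M) \<le> (\<integral>x. exp (B * \<bar>r - s\<bar>) * exp (s * X x) \<partial>M)"
    proof (intro integral_mono_AE integrable_mult_right integrable_exp_ess_bounded X)
      show "AE x in M. exp (r * X x) \<le> exp (B * \<bar>r - s\<bar>) * exp (s * X x)"
        using B
      proof eventually_elim
        case (elim x)
        have "(r - s) * X x \<le> \<bar>r - s\<bar> * \<bar>X x\<bar>" by (metis abs_ge_self abs_mult)
        also have "\<dots> \<le> \<bar>r - s\<bar> * B" using elim by (intro mult_left_mono) auto
        finally show ?case by (simp add: exp_add[symmetric] algebra_simps)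
      qed
    qed
    also have "\<dots> = exp (B * \<bar>r - s\<bar>) * (\<integral>x. exp (s * X x) \<partial>M)" by simp
    finally have "ln (\<integral>x. exp (r * X x) \<partial>M) \<le> ln (exp (B * \<bar>r - s\<bar>) * (\<integral>x. exp (s * X x) \<partial>M))"
      using integral_exp_pos[OF X, of r] by (intro ln_mono) auto
    then show ?thesis using integral_exp_pos[OF X, of s] by (simp add: ln_mult)
  qed
  show ?thesis using le[of r s] le[of s r] by (simp add: abs_le_iff abs_minus_commute)
qed

text \<open>Jensen's inequality, from the tangent line of the exponential at the mean.\<close>

lemma ln_mgf_ge:
  assumes X: "ess_bounded M X"
  shows "r * (\<integral>x. X x \<partial>M) \<le> ln (\<integral>x. exp (r * X x) \<partial>M)"
proof -
  let ?m = "\<integral>x. X x \<partial>M"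
  have "exp (r * ?m) = (\<integral>x. exp (r * ?m) * (1 + r * (X x - ?m)) \<partial>M)"
    using integrable_ess_bounded[OF X] by (simp add: prob_space algebra_simps)
  also have "\<dots> \<le> (\<integral>x. exp (r * X x) \<partial>M)"
  proof (rule integral_mono)
    show "integrable M (\<lambda>x. exp (r * ?m) * (1 + r * (X x - ?m)))"
      using integrable_ess_bounded[OF X] by auto
    show "exp (r * ?m) * (1 + r * (X x - ?m)) \<le> exp (r * X x)" for x
    proof -
      have "exp (r * ?m) * (1 + r * (X x - ?m)) \<le> exp (r * ?m) * exp (r * (X x - ?m))"
        by (intro mult_left_mono exp_ge_add_one_self) auto
      then show ?thesis by (simp add: exp_add[symmetric] algebra_simps)
    qed
  qed (rule integrable_exp_ess_bounded[OF X])
  finally show ?thesis using integral_exp_pos[OF X, of r] by (simp add: ln_ge_iff)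
qed

text \<open>Together with the Jensen bound this places the logarithm minus \<open>r\<close> times
  the mean between 0 and \<open>(r * B)^2\<close>. Division by \<open>r\<close> then yields
  continuity of \<open>K_r\<close> at \<open>r = 0\<close>.\<close>

lemma ln_mgf_le:
  assumes X: "ess_bounded M X" and B: "AE x in M. \<bar>X x\<bar> \<le> B" and r: "\<bar>r\<bar> * B \<le> 1"
  shows "ln (\<integral>x. exp (r * X x) \<partial>M) \<le> r * (\<integral>x. X x \<partial>M) + (r * B)\<^sup>2"
proof -
  have "(\<integral>x. exp (r * X x) \<partial>M) \<le> (\<integral>x. 1 + r * X x + (r * B)\<^sup>2 \<partial>M)"
  proof (rule integral_mono_AE)
    show "integrable M (\<lambda>x. 1 + r * X x + (r * B)\<^sup>2)"
      using integrable_ess_bounded[OF X] by auto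
    show "AE x in M. exp (r * X x) \<le> 1 + r * X x + (r * B)\<^sup>2"
      using B
    proof eventually_elim
      case (elim x)
      have "\<bar>r * X x\<bar> \<le> \<bar>r\<bar> * B" using elim by (simp add: abs_mult mult_left_mono)
      then have "\<bar>r * X x\<bar> \<le> 1" "\<bar>r * X x\<bar> \<le> \<bar>r * B\<bar>" using r elim by (auto simp: abs_mult intro: mult_left_mono)
      then have "exp (r * X x) \<le> 1 + r * X x + (r * X x)\<^sup>2" "(r * X x)\<^sup>2 \<le> (r * B)\<^sup>2"
        using exp_le_quadratic by (auto simp: abs_le_square_iff)
      then show ?case by simp
    qed
  qed (rule integrable_exp_ess_bounded[OF X])
  also have "\<dots> = 1 + (r * (\<integral>x. X x \<partial>M) + (r * B)\<^sup>2)"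
    using integrable_ess_bounded[OF X] by (simp add: prob_space)
  finally show ?thesis
    using integral_exp_pos[OF X, of r] ln_add_one_self_le_self2[of "(\<integral>x. exp (r * X x) \<partial>M) - 1"] by simp
qed

lemma isCont_K_stat_ereal:
  assumes X: "ess_bounded M X"
  shows "isCont (\<lambda>r. K_stat M (ereal r) X) r"
proof -
  obtain B where B: "B \<ge> 0" "AE x in M. \<bar>X x\<bar> \<le> B" by (rule ess_boundedE[OF X])
  let ?L = "\<lambda>r. ln (\<integral>x. exp (r * X x) \<partial>M)"
  show ?thesis
  proof (cases "r = 0")
    case False
    have "isCont ?L r"
    proof (rule isCont_def[THEN iffD2], rule LIM_zero_cancel, rule tendsto_0_le[where K=B])
      show "((\<lambda>s. s - r) \<longlongrightarrow> 0) (at r)" by (rule LIM_zero) simp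
      show "\<forall>\<^sub>F s in at r. norm (?L s - ?L r) \<le> norm (s - r) * B"
        using ln_mgf_Lipschitz[OF X B(2)] by (simp add: mult.commute)
    qed
    then have "isCont (\<lambda>s. 1 / s * ?L s) r"
      using False by (intro isCont_mult isCont_divide continuous_const continuous_ident)
    moreover have "\<forall>\<^sub>F s in nhds r. K_stat M (ereal s) X = 1 / s * ?L s"
      using t1_space_nhds[OF False] by eventually_elim (simp add: K_stat_def)
    ultimately show ?thesis using isCont_cong by fast
  next
    case True
    have "isCont (\<lambda>r. K_stat M (ereal r) X) 0"
    proof (rule isCont_def[THEN iffD2], rule LIM_zero_cancel, rule tendsto_0_le[where K="B\<^sup>2"])
      show "((\<lambda>s::real. s) \<longlongrightarrow> 0) (at 0)" by simp
      have "\<forall>\<^sub>F s in at 0. \<bar>s\<bar> * B < 1"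
        by (rule order_tendstoD(2)[where y=0]) (auto intro!: tendsto_eq_intros)
      moreover have "\<forall>\<^sub>F s in at (0::real). s \<noteq> 0" by (simp add: eventually_at_filter)
      ultimately show "\<forall>\<^sub>F s in at 0. norm (K_stat M (ereal s) X - K_stat M (ereal 0) X) \<le> norm s * B\<^sup>2"
      proof eventually_elim
        case (elim s)
        let ?m = "\<integral>x. X x \<partial>M"
        have "\<bar>?L s - s * ?m\<bar> \<le> s\<^sup>2 * B\<^sup>2"
          using ln_mgf_ge[OF X, of s] ln_mgf_le[OF X B(2), of s] elim by (simp add: power_mult_distrib)
        then have "\<bar>?L s - s * ?m\<bar> / \<bar>s\<bar> \<le> s\<^sup>2 * B\<^sup>2 / \<bar>s\<bar>"
          by (rule divide_right_mono) simp
        also have "s\<^sup>2 * B\<^sup>2 / \<bar>s\<bar> = \<bar>s\<bar> * B\<^sup>2"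
          using elim by (simp add: power2_eq_square abs_if)
        also have "\<bar>?L s - s * ?m\<bar> / \<bar>s\<bar> = \<bar>1 / s * ?L s - ?m\<bar>"
          using elim by (simp add: abs_divide[symmetric] diff_divide_distrib)
        finally show ?case using elim by (simp add: K_stat_def)
      qed
    qed
    with True show ?thesis by simp
  qed
qed

text \<open>The event that \<open>X\<close> comes within \<open>e\<close> of its essential maximum
  has positive probability. Restricting the expectation to it costs a fixed logarithm divided by
  \<open>r\<close>, which vanishes in the limit.\<close>

lemma K_stat_tendsto_ess_max:
  assumes X: "ess_bounded M X"
  shows "((\<lambda>r. K_stat M (ereal r) X) \<longlongrightarrow> ess_max M X) at_top"
proof (rule order_tendstoI)
  have [measurable]: "X \<in> borel_measurable M" using X by (simp add: ess_bounded_def)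
  let ?m = "ess_max M X"
  fix y assume y: "y < ?m"
  define e where "e = (?m - y) / 2"
  have e: "e > 0" using y by (simp add: e_def)
  let ?S = "{x \<in> space M. ?m - e < X x}"
  have "\<not> (AE x in M. X x \<le> ?m - e)" using ess_max_le_iff[OF X, of "?m - e"] e by simp
  then have "prob ?S \<noteq> 0"
    by (subst (asm) AE_iff_measurable[OF _ refl]) (auto simp: emeasure_eq_measure not_le)
  then have p: "prob ?S > 0" by (simp add: zero_less_measure_iff)
  have "((\<lambda>r. ln (prob ?S) / r) \<longlongrightarrow> 0) at_top"
    by (intro tendsto_divide_0[OF tendsto_const] filterlim_at_top_imp_at_infinity filterlim_ident)
  then have "\<forall>\<^sub>F r in at_top. ln (prob ?S) / r > - e" by (rule order_tendstoD(1)) (use e in simp)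
  then show "\<forall>\<^sub>F r in at_top. y < K_stat M (ereal r) X"
    using eventually_gt_at_top[of 0]
  proof eventually_elim
    case (elim r)
    have "prob ?S * exp (r * (?m - e)) = (\<integral>x. indicator ?S x * exp (r * (?m - e)) \<partial>M)" by simp
    also have "\<dots> \<le> (\<integral>x. exp (r * X x) \<partial>M)"
      using elim by (intro integral_mono integrable_exp_ess_bounded X integrable_mult_left)
        (auto simp: emeasure_eq_measure intro!: integrable_real_indicator split: split_indicator)
    finally have "ln (prob ?S * exp (r * (?m - e))) \<le> ln (\<integral>x. exp (r * X x) \<partial>M)"
      using p by (intro ln_mono) auto
    then have "(ln (prob ?S) + r * (?m - e)) / r \<le> K_stat M (ereal r) X"
      using p elim by (simp add: ln_mult K_stat_def divide_right_mono)
    moreover have "(ln (prob ?S) + r * (?m - e)) / r = ln (prob ?S) / r + (?m - e)"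
      using elim by (simp add: field_simps)
    moreover have "?m - e - e = y" by (simp add: e_def field_simps)
    ultimately show ?case using elim(1) by linarith
  qed
next
  fix y assume y: "ess_max M X < y"
  have "K_stat M (ereal r) X \<le> ess_max M X" for r
    using K_stat_mono_AE[OF X ess_bounded_const AE_le_ess_max[OF X], of "ereal r"]
    by (simp add: K_stat_const)
  then show "\<forall>\<^sub>F r in at_top. K_stat M (ereal r) X < y"
    using le_less_trans[OF _ y] by simp
qed

text \<open>At \<open>u = 1\<close> the left limit is that of \<open>K_r\<close> for
  \<open>r\<close> tending to infinity, and to the right of 1 \<open>unsquash\<close> is constant;
  \<open>u = -1\<close> follows by reflection. In this coordinate the functions are continuous on
  the whole real line, as weak convergence of real distributions requires.\<close>

lemma isCont_K_stat_unsquash: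
  assumes X: "ess_bounded M X"
  shows "isCont (\<lambda>u. K_stat M (unsquash u) X) u"
proof -
  have at1: "isCont (\<lambda>u. K_stat M (unsquash u) Y) 1" if Y: "ess_bounded M Y" for Y
  proof -
    have "((\<lambda>u. K_stat M (unsquash u) Y) \<longlongrightarrow> ess_max M Y) (at_left 1)"
    proof (rule Lim_transform_eventually)
      have "filterlim (\<lambda>u::real. u / (1 - u)) at_top (at_left 1)" by real_asymp
      then show "((\<lambda>u. K_stat M (ereal (u / (1 - u))) Y) \<longlongrightarrow> ess_max M Y) (at_left 1)"
        by (rule filterlim_compose[OF K_stat_tendsto_ess_max[OF Y]])
      have "\<forall>\<^sub>F u in at_left 1. u \<in> {0<..<(1::real)}" by (rule eventually_at_leftI[of 0]) auto
      then show "\<forall>\<^sub>F u in at_left 1. K_stat M (ereal (u / (1 - u))) Y = K_stat M (unsquash u) Y"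
        by eventually_elim (auto simp: unsquash_def)
    qed
    moreover have "((\<lambda>u. K_stat M (unsquash u) Y) \<longlongrightarrow> ess_max M Y) (at_right 1)"
    proof (rule Lim_transform_eventually[OF tendsto_const])
      have "\<forall>\<^sub>F u in at_right 1. u \<in> {1<..<(2::real)}" by (rule eventually_at_rightI[of 1 2]) auto
      then show "\<forall>\<^sub>F u in at_right 1. ess_max M Y = K_stat M (unsquash u) Y"
        by eventually_elim (auto simp: unsquash_def K_stat_def)
    qed
    ultimately show ?thesis
      unfolding isCont_def by (intro filterlim_split_at) (simp_all add: unsquash_def K_stat_def)
  qed
  consider "u = 1" | "u = -1" | "u > 1" | "u < -1" | "\<bar>u\<bar> < 1" by linarith
  then show ?thesis
  proof cases
    case 1 then show ?thesis using at1[OF X] by simp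
  next
    case 2
    have "isCont (\<lambda>u. K_stat M (unsquash u) (\<lambda>x. - X x)) (- u)"
      using at1[OF ess_bounded_uminus[OF X]] 2 by simp
    then have "isCont (\<lambda>u. - K_stat M (unsquash (- u)) (\<lambda>x. - X x)) u"
      by (intro isCont_minus isCont_o2[where f=uminus]) auto
    then show ?thesis by (simp add: K_stat_uminus unsquash_uminus)
  next
    case 3
    have "\<forall>\<^sub>F v in nhds u. v \<in> {1<..}" using 3 by (intro eventually_nhds_in_open) auto
    then have "\<forall>\<^sub>F v in nhds u. K_stat M (unsquash v) X = ess_max M X"
      by eventually_elim (simp add: unsquash_def K_stat_def)
    then show ?thesis using isCont_cong[of "\<lambda>u. K_stat M (unsquash u) X" "\<lambda>_. ess_max M X" u] by simp
  next
    case 4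
    have "\<forall>\<^sub>F v in nhds u. v \<in> {..<-1}" using 4 by (intro eventually_nhds_in_open) auto
    then have "\<forall>\<^sub>F v in nhds u. K_stat M (unsquash v) X = ess_min M X"
      by eventually_elim (simp add: unsquash_def K_stat_def)
    then show ?thesis using isCont_cong[of "\<lambda>u. K_stat M (unsquash u) X" "\<lambda>_. ess_min M X" u] by simp
  next
    case 5
    have "isCont (\<lambda>v. K_stat M (ereal (v / (1 - \<bar>v\<bar>))) X) u"
      by (rule isCont_o2[OF _ isCont_K_stat_ereal[OF X]]) (use 5 in \<open>auto intro!: continuous_intros\<close>)
    moreover have "\<forall>\<^sub>F v in nhds u. v \<in> {-1<..<1}" using 5 by (intro eventually_nhds_in_open) auto
    then have "\<forall>\<^sub>F v in nhds u. K_stat M (unsquash v) X = K_stat M (ereal (v / (1 - \<bar>v\<bar>))) X"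
      by eventually_elim (simp add: unsquash_def)
    ultimately show ?thesis using isCont_cong by fast
  qed
qed

lemma measurable_K_stat:
  assumes X: "ess_bounded M X"
  shows "(\<lambda>a. K_stat M a X) \<in> borel_measurable borel"
proof -
  have [measurable]: "(\<lambda>u. K_stat M (unsquash u) X) \<in> borel_measurable borel"
    using isCont_K_stat_unsquash[OF X] by (intro borel_measurable_continuous_onI) (simp add: continuous_at_imp_continuous_on)
  have "(\<lambda>a. K_stat M (unsquash (squash a)) X) \<in> borel_measurable borel" by measurable
  then show ?thesis by simp
qed

end

text \<open>Helly selection: measures carried by a fixed compact interval are tight. The test
  functions are bounded and continuous on the whole line, so their integrals converge along the
  subsequence.\<close>

lemma weak_limit_of_bounded_support:
  fixes \<nu> :: "nat \<Rightarrow> real measure" and k :: "'i \<Rightarrow> real \<Rightarrow> real"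
  assumes \<nu>: "\<And>n. real_distribution (\<nu> n)" "\<And>n. measure (\<nu> n) {-1..1} = 1"
    and k: "\<And>i u. i \<in> I \<Longrightarrow> isCont (k i) u" "\<And>i. i \<in> I \<Longrightarrow> \<exists>B. \<forall>u. \<bar>k i u\<bar> \<le> B"
    and lim: "\<And>i. i \<in> I \<Longrightarrow> (\<lambda>n. \<integral>u. k i u \<partial>\<nu> n) \<longlonglongrightarrow> v i"
  shows "\<exists>\<nu>'. real_distribution \<nu>' \<and> (\<forall>i\<in>I. (\<integral>u. k i u \<partial>\<nu>') = v i)"
proof -
  have "tight \<nu>" unfolding tight_def
  proof (intro conjI allI impI)
    fix e :: real assume e: "e > 0"
    \<comment> \<open>Tightness is stated with intervals open on the left, which would miss an atom
      at \<open>-1\<close>; hence the larger interval.\<close>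
    have "measure (\<nu> n) {-2<..2} = 1" for n
    proof -
      interpret real_distribution "\<nu> n" by fact
      have "measure (\<nu> n) {-1..1} \<le> measure (\<nu> n) {-2<..2}" by (intro finite_measure_mono) auto
      then show ?thesis using \<nu>(2)[of n] prob_le_1[of "{-2<..2}"] by linarith
    qed
    then show "\<exists>a b. a < b \<and> (\<forall>n. 1 - e < measure (\<nu> n) {a<..b})"
      using e by (intro exI[of _ "-2"] exI[of _ 2]) auto
  qed (rule \<nu>)
  then obtain r \<nu>' where r: "strict_mono r" "real_distribution \<nu>'" "weak_conv_m (\<nu> \<circ> id \<circ> r) \<nu>'"
    using tight_imp_convergent_subsubsequence[of \<nu> id] by (auto simp: strict_mono_def)
  have "(\<integral>u. k i u \<partial>\<nu>') = v i" if i: "i \<in> I" for i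
  proof (rule LIMSEQ_unique)
    obtain B where "\<And>u. \<bar>k i u\<bar> \<le> B" using k(2)[OF i] by auto
    then show "(\<lambda>n. \<integral>u. k i u \<partial>(\<nu> \<circ> id \<circ> r) n) \<longlonglongrightarrow> (\<integral>u. k i u \<partial>\<nu>')"
      using \<nu> r k(1)[OF i] by (intro weak_conv_imp_integral_bdd_continuous_conv) (auto simp: o_def)
    show "(\<lambda>n. \<integral>u. k i u \<partial>(\<nu> \<circ> id \<circ> r) n) \<longlonglongrightarrow> v i"
      using LIMSEQ_subseq_LIMSEQ[OF lim[OF i] r(1)] by (simp add: o_def)
  qed
  with r show ?thesis by auto
qed

section \<open>Polya's theorem in one variable\<close>

lemma zero_le_mult_pos: "0 \<le> a * b \<Longrightarrow> 0 < a \<Longrightarrow> 0 \<le> b" for a b :: real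
  by (simp add: zero_le_mult_iff)

lemma prod_falling_eq_fact:
  "(\<Prod>l<i. real k - real l) = (if i \<le> k then fact k / fact (k - i) else 0)"
proof (induction i)
  case (Suc i)
  show ?case
  proof (cases "Suc i \<le> k")
    case True
    then have "k - i = Suc (k - Suc i)" by simp
    then have "fact (k - i) = (real k - real i) * fact (k - Suc i)"
      using True by (simp add: of_nat_diff)
    then show ?thesis using Suc True by simp
  next
    case False
    then show ?thesis using Suc by (cases "i = k") auto
  qed
qed simp

text \<open>All factors have absolute value at most 1, and each differs from \<open>k / N\<close> by
  at most \<open>i / N\<close>; the difference of the two products is at most the sum of these
  errors.\<close>

lemma prod_falling_approx:
  fixes i k N :: nat
  assumes "k \<le> N" "i \<le> N" "N > 0"
  shows "\<bar>\<Prod>l<i. (real k - real l) / N\<bar> \<le> 1"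
    and "\<bar>(\<Prod>l<i. (real k - real l) / N) - (k / N) ^ i\<bar> \<le> real i * real i / N"
proof -
  have b: "\<bar>(real k - real l) / N\<bar> \<le> 1" if "l < i" for l
    using that assms by (auto simp: abs_divide)
  have b': "\<bar>real k / N\<bar> \<le> 1" using assms by simp
  show "\<bar>\<Prod>l<i. (real k - real l) / N\<bar> \<le> 1"
    unfolding abs_prod by (intro prod_le_1) (use b in auto)
  have "norm ((\<Prod>l<i. (real k - real l) / N) - (\<Prod>l<i. real k / N))
      \<le> (\<Sum>l<i. norm ((real k - real l) / N - real k / N))"
    by (rule norm_prod_diff) (use b b' in auto)
  also have "\<dots> \<le> (\<Sum>l<i. real i / N)"
  proof (rule sum_mono)
    fix l assume "l \<in> {..<i}"
    then show "norm ((real k - real l) / N - real k / N) \<le> real i / N"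
      by (simp add: diff_divide_distrib[symmetric] divide_right_mono)
  qed
  finally show "\<bar>(\<Prod>l<i. (real k - real l) / N) - (k / N) ^ i\<bar> \<le> real i * real i / N"
    by simp
qed

text \<open>Up to a factor that does not involve \<open>i\<close>, the binomial coefficient splits
  into falling factorials of \<open>k\<close> and of \<open>n + d - k\<close>. Where the left side
  vanishes, one of these contains a zero factor.\<close>

lemma choose_eq_prod_falling:
  assumes "k \<le> n + d" "i \<le> d"
  shows "fact k * fact (n + d - k) / fact n * (if i \<le> k then real (n choose (k - i)) else 0)
    = (\<Prod>l<i. real k - real l) * (\<Prod>l<d - i. real (n + d - k) - real l)"
proof (cases "i \<le> k \<and> k - i \<le> n")
  case True
  then have "n + d - k - (d - i) = n - (k - i)" "d - i \<le> n + d - k" using assms by auto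
  then have "(\<Prod>l<d - i. real (n + d - k) - real l) = fact (n + d - k) / fact (n - (k - i))"
    by (simp only: prod_falling_eq_fact if_True)
  moreover have "(\<Prod>l<i. real k - real l) = fact k / fact (k - i)"
    using True by (simp only: prod_falling_eq_fact if_True)
  moreover have "real (n choose (k - i)) = fact n / (fact (k - i) * fact (n - (k - i)))"
    using True by (intro binomial_fact) simp
  ultimately show ?thesis using True by (simp only: if_True) simp
next
  case False
  then have "i \<le> k \<Longrightarrow> \<not> d - i \<le> n + d - k" using assms by auto
  then show ?thesis using False by (auto simp: prod_falling_eq_fact)
qed

text \<open>The univariate case of Polya's theorem. Up to the positive factor \<open>n! N^d / (k! (N-k)!)\<close>
  with \<open>N = n + d\<close>, the coefficient of \<open>x^k\<close> in \<open>(1 + x)^n (\<Sum>i\<le>d. c i * x^i)\<close>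
  is close to the value at \<open>k / N\<close> of the homogenisation \<open>G\<close>.\<close>

lemma Polya_univariate:
  fixes c :: "nat \<Rightarrow> real"
  assumes c0: "c 0 > 0" and cd: "c d > 0" and pos: "\<And>x. x > 0 \<Longrightarrow> (\<Sum>i\<le>d. c i * x ^ i) > 0"
  shows "\<exists>n. \<forall>k. (\<Sum>i\<le>d. c i * (if i \<le> k then real (n choose (k - i)) else 0)) \<ge> 0"
proof -
  define G where "G t = (\<Sum>i\<le>d. c i * (t ^ i * (1 - t) ^ (d - i)))" for t :: real
  have Gpos: "G t > 0" if t: "t \<in> {0..1}" for t
  proof -
    consider "t = 0" | "t = 1" | "0 < t" "t < 1" using t by fastforce
    then show ?thesis
    proof cases
      case 1
      have "G 0 = (\<Sum>i\<le>d. if i = 0 then c 0 else 0)" unfolding G_def by (rule sum.cong) auto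
      then show ?thesis using 1 c0 by simp
    next
      case 2
      have "G 1 = (\<Sum>i\<le>d. if i = d then c d else 0)" unfolding G_def by (rule sum.cong) auto
      then show ?thesis using 2 cd by simp
    next
      case 3
      have "G t = (\<Sum>i\<le>d. (1 - t) ^ d * (c i * (t / (1 - t)) ^ i))"
        unfolding G_def
      proof (rule sum.cong[OF refl])
        fix i assume "i \<in> {..d}"
        then have "(1 - t) ^ d = (1 - t) ^ i * (1 - t) ^ (d - i)" by (simp flip: power_add)
        then show "c i * (t ^ i * (1 - t) ^ (d - i)) = (1 - t) ^ d * (c i * (t / (1 - t)) ^ i)"
          using 3 by (simp add: power_divide)
      qed
      also have "\<dots> = (1 - t) ^ d * (\<Sum>i\<le>d. c i * (t / (1 - t)) ^ i)" by (simp add: sum_distrib_left)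
      also have "\<dots> > 0" using 3 by (intro mult_pos_pos pos) auto
      finally show ?thesis .
    qed
  qed
  have "continuous_on {0..1} G" unfolding G_def by (intro continuous_intros)
  then obtain t0 where t0: "t0 \<in> {0..1}" "\<And>t. t \<in> {0..1} \<Longrightarrow> G t0 \<le> G t"
    using continuous_attains_inf[of "{0..1::real}" G] by fastforce
  \<comment> \<open>Each of the two falling products is off by at most \<open>d^2 / N\<close>, so
    \<open>C / N\<close> bounds the total error. The choice of \<open>n\<close> pushes it below the
    minimum \<open>G t0\<close>; \<open>n \<ge> 1\<close> keeps \<open>N\<close> positive when
    \<open>d = 0\<close>.\<close>
  define C where "C = (\<Sum>i\<le>d. \<bar>c i\<bar> * (2 * real d * real d))"
  obtain n where n: "real n \<ge> C / G t0" "n \<ge> 1"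
    by (meson max.bounded_iff real_arch_simple le_trans nat_le_linear of_nat_mono order_trans)
  define N where "N = n + d"
  have N: "N > 0" "C / real N \<le> G t0"
  proof -
    show "N > 0" using n by (simp add: N_def)
    have "C \<le> G t0 * real n" using n Gpos[OF t0(1)] by (simp add: field_simps)
    also have "\<dots> \<le> G t0 * real N" using Gpos[OF t0(1)] by (simp add: N_def)
    finally show "C / real N \<le> G t0" using \<open>N > 0\<close> by (simp add: field_simps)
  qed
  show ?thesis
  proof (intro exI[of _ n] allI)
    fix k
    show "(\<Sum>i\<le>d. c i * (if i \<le> k then real (n choose (k - i)) else 0)) \<ge> 0"
    proof (cases "k \<le> N")
      case False
      then have "(\<Sum>i\<le>d. c i * (if i \<le> k then real (n choose (k - i)) else 0)) = 0"
        by (intro sum.neutral) (auto simp: N_def)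
      then show ?thesis by simp
    next
      case k: True
      define A where "A i = (\<Prod>l<i. (real k - real l) / N)" for i
      define B where "B i = (\<Prod>l<i. (real (N - k) - real l) / N)" for i
      have t: "real k / N \<in> {0..1}" "real (N - k) / N = 1 - real k / N"
        using k N by (auto simp: field_simps of_nat_diff)
      have AB: "A i * B (d - i) \<ge> (k / N) ^ i * (1 - k / N) ^ (d - i) - 2 * real d * real d / N
          \<and> A i * B (d - i) \<le> (k / N) ^ i * (1 - k / N) ^ (d - i) + 2 * real d * real d / N"
        if i: "i \<le> d" for i
      proof -
        have A: "\<bar>A i - (k / N) ^ i\<bar> \<le> real d * real d / N"
          using prod_falling_approx(2)[of k N i] k N i mult_mono[of "real i" "real d" "real i" "real d"]
          unfolding A_def by (force simp: N_def intro: order_trans divide_right_mono)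
        have "\<bar>B (d - i) - (real (N - k) / N) ^ (d - i)\<bar> \<le> real (d - i) * real (d - i) / N"
          using prod_falling_approx(2)[of "N - k" N "d - i"] N unfolding B_def by (auto simp: N_def)
        also have "\<dots> \<le> real d * real d / N" by (intro divide_right_mono mult_mono) auto
        finally have B: "\<bar>B (d - i) - (1 - k / N) ^ (d - i)\<bar> \<le> real d * real d / N" by (simp add: t)
        have B1: "\<bar>B (d - i)\<bar> \<le> 1"
          using prod_falling_approx(1)[of "N - k" N "d - i"] N unfolding B_def by (auto simp: N_def)
        have k1: "\<bar>(k / N) ^ i\<bar> \<le> 1" using t by (auto simp: power_abs intro!: power_le_one)
        have "A i * B (d - i) - (k / N) ^ i * (1 - k / N) ^ (d - i)
            = (A i - (k / N) ^ i) * B (d - i) + (k / N) ^ i * (B (d - i) - (1 - k / N) ^ (d - i))"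
          by (simp add: algebra_simps)
        moreover have "\<bar>(A i - (k / N) ^ i) * B (d - i)\<bar> \<le> real d * real d / N * 1"
          unfolding abs_mult using A B1 by (intro mult_mono) auto
        moreover have "\<bar>(k / N) ^ i * (B (d - i) - (1 - k / N) ^ (d - i))\<bar> \<le> 1 * (real d * real d / N)"
          unfolding abs_mult using B k1 by (intro mult_mono) auto
        ultimately show ?thesis by (auto simp: abs_le_iff)
      qed
      have eq: "fact k * fact (N - k) / fact n * (if i \<le> k then real (n choose (k - i)) else 0)
          = real N ^ d * (A i * B (d - i))" if i: "i \<le> d" for i
      proof -
        have "real N ^ d = real N ^ i * real N ^ (d - i)" using i by (simp flip: power_add)
        then show ?thesis
          using choose_eq_prod_falling[of k n d i] i k N(1) by (simp add: A_def B_def prod_dividef N_def)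
      qed
      have "(\<Sum>i\<le>d. c i * ((k / N) ^ i * (1 - k / N) ^ (d - i))) - (\<Sum>i\<le>d. \<bar>c i\<bar> * (2 * real d * real d / N))
          \<le> (\<Sum>i\<le>d. c i * (A i * B (d - i)))"
        unfolding sum_subtractf[symmetric]
      proof (rule sum_mono)
        fix i assume "i \<in> {..d}"
        then have "\<bar>A i * B (d - i) - (k / N) ^ i * (1 - k / N) ^ (d - i)\<bar> \<le> 2 * real d * real d / N"
          using AB[of i] by (auto simp: abs_le_iff)
        then have "\<bar>c i * (A i * B (d - i) - (k / N) ^ i * (1 - k / N) ^ (d - i))\<bar> \<le> \<bar>c i\<bar> * (2 * real d * real d / N)"
          unfolding abs_mult by (rule mult_left_mono) simp
        then show "c i * ((k / N) ^ i * (1 - k / N) ^ (d - i)) - \<bar>c i\<bar> * (2 * real d * real d / N)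
            \<le> c i * (A i * B (d - i))"
          by (simp add: abs_le_iff right_diff_distrib)
      qed
      moreover have "(\<Sum>i\<le>d. \<bar>c i\<bar> * (2 * real d * real d / N)) = C / N"
        by (simp add: C_def sum_divide_distrib)
      ultimately have "0 \<le> (\<Sum>i\<le>d. c i * (A i * B (d - i)))"
        using N(2) t0(2)[OF t(1)] by (simp add: G_def)
      also have "(\<Sum>i\<le>d. c i * (A i * B (d - i)))
          = (\<Sum>i\<le>d. fact k * fact (N - k) / fact n / real N ^ d * (c i * (if i \<le> k then real (n choose (k - i)) else 0)))"
      proof (rule sum.cong[OF refl])
        fix i assume "i \<in> {..d}"
        then have "c i * (real N ^ d * (A i * B (d - i))) = fact k * fact (N - k) / fact n * (c i * (if i \<le> k then real (n choose (k - i)) else 0))"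
          unfolding eq[of i, symmetric, OF \<open>i \<in> {..d}\<close>[unfolded atMost_iff]] by (simp only: mult_ac)
        then show "c i * (A i * B (d - i)) = fact k * fact (N - k) / fact n / real N ^ d * (c i * (if i \<le> k then real (n choose (k - i)) else 0))"
          using N(1) by (simp add: field_simps)
      qed
      also have "\<dots> = fact k * fact (N - k) / fact n / real N ^ d * (\<Sum>i\<le>d. c i * (if i \<le> k then real (n choose (k - i)) else 0))"
        by (simp only: sum_distrib_left)
      finally have "0 \<le> fact k * fact (N - k) / fact n / real N ^ d * (\<Sum>i\<le>d. c i * (if i \<le> k then real (n choose (k - i)) else 0))" .
      moreover have "0 < fact k * fact (N - k) / fact n / real N ^ d" using N(1) by simp
      ultimately show ?thesis by (rule zero_le_mult_pos)
    qed
  qed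
qed

section \<open>Realising finitely supported laws on a nonatomic space\<close>

context prob_space
begin

text \<open>Of a part of intermediate measure and its complement in the set, one has at most half
  the measure; the halving is iterated.\<close>

lemma nonatomic_small_subset:
  assumes na: "nonatomic M" and A: "A \<in> events" "prob A > 0" and e: "e > 0"
  shows "\<exists>B\<in>events. B \<subseteq> A \<and> 0 < prob B \<and> prob B < e"
proof -
  have half: "\<exists>C\<in>events. C \<subseteq> B \<and> 0 < prob C \<and> prob C \<le> prob B / 2" if B: "B \<in> events" "prob B > 0" for B
  proof -
    obtain C where C: "C \<in> events" "C \<subseteq> B" "0 < prob C" "prob C < prob B"
      using na B unfolding nonatomic_def by blast
    have "prob (B - C) = prob B - prob C" using B C by (intro finite_measure_Diff) auto
    then have "B - C \<in> events" "B - C \<subseteq> B" "0 < prob (B - C)" "prob C \<le> prob B / 2 \<or> prob (B - C) \<le> prob B / 2"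
      using B C by auto
    with C show ?thesis by blast
  qed
  have "\<exists>B\<in>events. B \<subseteq> A \<and> 0 < prob B \<and> prob B \<le> prob A / 2 ^ n" for n
  proof (induction n)
    case (Suc n)
    then obtain B where B: "B \<in> events" "B \<subseteq> A" "0 < prob B" "prob B \<le> prob A / 2 ^ n" by auto
    obtain C where C: "C \<in> events" "C \<subseteq> B" "0 < prob C" "prob C \<le> prob B / 2" using half[OF B(1,3)] by auto
    have "prob C \<le> prob A / 2 ^ n / 2"
      by (rule order_trans[OF C(4) divide_right_mono[OF B(4)]]) simp
    with B C show ?case by (intro bexI[of _ C]) (auto simp: field_simps)
  qed (use A in auto)
  moreover obtain n where "inverse (2 ^ n) < e"
    using real_arch_pow_inv[OF e, of "1/2"] by (auto simp: power_one_over inverse_eq_divide)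
  ultimately obtain B where B: "B \<in> events" "B \<subseteq> A" "0 < prob B" "prob B \<le> prob A * inverse (2 ^ n)"
    by (metis divide_inverse)
  have "prob A * inverse (2 ^ n) \<le> 1 * inverse (2 ^ n)" by (intro mult_right_mono) auto
  then have "prob B < e" using B \<open>inverse (2 ^ n) < e\<close> by linarith
  with B show ?thesis by auto
qed

text \<open>Sierpinski's theorem, by greedy exhaustion: each step adds a set whose measure is at least
  half of the largest possible.\<close>

lemma nonatomic_intermediate_value:
  assumes na: "nonatomic M" and A: "A \<in> events" and t: "0 \<le> t" "t \<le> prob A"
  shows "\<exists>B\<in>events. B \<subseteq> A \<and> prob B = t"
proof -
  define P where "P B \<longleftrightarrow> B \<in> events \<and> B \<subseteq> A \<and> prob B \<le> t" for B
  define Q where "Q B B' \<longleftrightarrow> B \<subseteq> B' \<and>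
    (\<forall>C\<in>events. C \<subseteq> A - B \<longrightarrow> prob B + prob C \<le> t \<longrightarrow> prob C \<le> 2 * (prob B' - prob B))" for B B'
  have "\<exists>B. \<forall>n. P (B n) \<and> Q (B n) (B (Suc n))"
  proof (rule dependent_nat_choice)
    show "\<exists>B. P B" using t by (intro exI[of _ "{}"]) (auto simp: P_def)
    fix B assume B: "P B"
    let ?F = "{C \<in> events. C \<subseteq> A - B \<and> prob B + prob C \<le> t}"
    define s where "s = Sup (prob ` ?F)"
    have bdd: "bdd_above (prob ` ?F)" by (rule bdd_aboveI[of _ 1]) auto
    have "prob {} \<in> prob ` ?F" using B by (intro imageI) (auto simp: P_def)
    have le: "prob C \<le> s" if "C \<in> ?F" for C
      unfolding s_def using that bdd by (intro cSup_upper) auto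
    have "\<exists>C\<in>?F. s \<le> 2 * prob C"
    proof (cases "s \<le> 0")
      case True
      then show ?thesis using B by (intro bexI[of _ "{}"]) (auto simp: P_def)
    next
      case False
      then have "s / 2 < Sup (prob ` ?F)" by (simp add: s_def)
      moreover have "prob ` ?F \<noteq> {}" using \<open>prob {} \<in> prob ` ?F\<close> by blast
      ultimately obtain x where "x \<in> prob ` ?F" "s / 2 < x" by (rule less_cSupE)
      then obtain C where "C \<in> ?F" "s / 2 < prob C" by blast
      then show ?thesis by (intro bexI[of _ C]) auto
    qed
    then obtain C where C: "C \<in> ?F" "s \<le> 2 * prob C" by auto
    have "prob (B \<union> C) = prob B + prob C"
      using B C by (intro finite_measure_Union) (auto simp: P_def)
    then have "P (B \<union> C)" using B C by (auto simp: P_def)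
    moreover have "Q B (B \<union> C)"
      unfolding Q_def
    proof (intro conjI ballI impI)
      fix C' assume "C' \<in> events" "C' \<subseteq> A - B" "prob B + prob C' \<le> t"
      then have "prob C' \<le> s" by (intro le) simp
      then show "prob C' \<le> 2 * (prob (B \<union> C) - prob B)"
        using C(2) \<open>prob (B \<union> C) = prob B + prob C\<close> by simp
    qed simp
    ultimately show "\<exists>y. P y \<and> Q B y" by blast
  qed
  then obtain B where B: "\<And>n. P (B n)" "\<And>n. Q (B n) (B (Suc n))" by blast
  let ?B = "\<Union>n. B n"
  have inc: "incseq B" using B(2) by (intro incseq_SucI) (auto simp: Q_def)
  have ev: "range B \<subseteq> events" "?B \<in> events" "?B \<subseteq> A" using B(1) by (auto simp: P_def)
  have lim: "(\<lambda>n. prob (B n)) \<longlonglongrightarrow> prob ?B" by (rule finite_Lim_measure_incseq[OF ev(1) inc])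
  have le: "prob ?B \<le> t" using lim B(1) by (intro LIMSEQ_le_const2) (auto simp: P_def)
  have "prob ?B = t"
  proof (rule ccontr)
    assume "prob ?B \<noteq> t"
    then have lt: "prob ?B < t" using le by simp
    have "prob (A - ?B) = prob A - prob ?B" using ev A by (intro finite_measure_Diff) auto
    then have "0 < prob (A - ?B)" "0 < t - prob ?B" using lt t by auto
    \<comment> \<open>A leftover set of positive measure below the deficit is admissible at every
      stage. Every gain is therefore at least half its measure, although the gains tend to
      0.\<close>
    then obtain C where C: "C \<in> events" "C \<subseteq> A - ?B" "0 < prob C" "prob C < t - prob ?B"
      using nonatomic_small_subset[OF na, of "A - ?B" "t - prob ?B"] A ev by auto
    have "prob C \<le> 2 * (prob (B (Suc n)) - prob (B n))" for n
    proof -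
      have "prob (B n) \<le> prob ?B" using ev by (intro finite_measure_mono) auto
      then show ?thesis using B(2)[of n] C unfolding Q_def by fastforce
    qed
    moreover have "(\<lambda>n. 2 * (prob (B (Suc n)) - prob (B n))) \<longlonglongrightarrow> 2 * (prob ?B - prob ?B)"
      by (intro tendsto_intros lim LIMSEQ_Suc)
    ultimately have "prob C \<le> 2 * (prob ?B - prob ?B)" by (intro LIMSEQ_le_const) auto
    then show False using C by simp
  qed
  then show ?thesis using ev by blast
qed

lemma nonatomic_partition:
  assumes na: "nonatomic M" and "finite S" "S \<noteq> {}"
    and A: "A \<in> events" "(\<Sum>s\<in>S. w s) = prob A" and w: "\<And>s. s \<in> S \<Longrightarrow> w s \<ge> 0"
  shows "\<exists>Z. (\<forall>x\<in>A. Z x \<in> S) \<and> (\<forall>s\<in>S. {x \<in> A. Z x = s} \<in> events \<and> prob {x \<in> A. Z x = s} = w s)"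
  using assms(2,3) A w
proof (induction S arbitrary: A rule: finite_ne_induct)
  case (singleton s)
  then show ?case by (intro exI[of _ "\<lambda>_. s"]) auto
next
  case (insert s S)
  then obtain B where B: "B \<in> events" "B \<subseteq> A" "prob B = w s"
    using nonatomic_intermediate_value[OF na insert.prems(1), of "w s"] sum_nonneg[of S w] by auto
  have "prob (A - B) = prob A - prob B" using B insert.prems by (intro finite_measure_Diff) auto
  then have "\<exists>Z. (\<forall>x\<in>A - B. Z x \<in> S) \<and> (\<forall>u\<in>S. {x \<in> A - B. Z x = u} \<in> events \<and> prob {x \<in> A - B. Z x = u} = w u)"
    using insert.prems insert.hyps B by (intro insert.IH) auto
  then obtain Z where Z: "\<And>x. x \<in> A - B \<Longrightarrow> Z x \<in> S"
      "\<And>u. u \<in> S \<Longrightarrow> {x \<in> A - B. Z x = u} \<in> events \<and> prob {x \<in> A - B. Z x = u} = w u"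
    by blast
  define Z' where "Z' x = (if x \<in> B then s else Z x)" for x
  have "{x \<in> A. Z' x = s} = B" using Z(1) insert.hyps B by (auto simp: Z'_def)
  moreover have "{x \<in> A. Z' x = u} = {x \<in> A - B. Z x = u}" if "u \<in> S" for u
    using that insert.hyps B by (auto simp: Z'_def)
  ultimately show ?case
    using Z B by (intro exI[of _ Z']) (auto simp: Z'_def)
qed

text \<open>\<open>Z\<close> takes values in the support at every point, not just almost surely,
  since \<open>Linfty\<close> demands boundedness on the whole space.\<close>

lemma nonatomic_realize_pmf:
  assumes na: "nonatomic M" and fin: "finite (set_pmf p)"
  shows "\<exists>Z\<in>M \<rightarrow>\<^sub>M count_space UNIV. (\<forall>x\<in>space M. Z x \<in> set_pmf p) \<and> distr M (count_space UNIV) Z = measure_pmf p"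
proof -
  obtain Z where Z: "\<And>x. x \<in> space M \<Longrightarrow> Z x \<in> set_pmf p"
      "\<And>s. s \<in> set_pmf p \<Longrightarrow> {x \<in> space M. Z x = s} \<in> events \<and> prob {x \<in> space M. Z x = s} = pmf p s"
    using nonatomic_partition[OF na fin set_pmf_not_empty, of "space M" "pmf p"] fin
    by (auto simp: prob_space sum_pmf_eq_1)
  have "Z \<in> M \<rightarrow>\<^sub>M count_space (set_pmf p)"
  proof (subst measurable_count_space_eq2[OF fin], intro conjI ballI)
    show "Z \<in> space M \<rightarrow> set_pmf p" using Z by auto
    fix s assume "s \<in> set_pmf p"
    moreover have "Z -` {s} \<inter> space M = {x \<in> space M. Z x = s}" by auto
    ultimately show "Z -` {s} \<inter> space M \<in> events" using Z by simp
  qed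
  then have m [measurable]: "Z \<in> M \<rightarrow>\<^sub>M count_space UNIV"
    using measurable_compose[of Z M "count_space (set_pmf p)" "\<lambda>x. x" "count_space UNIV"] by simp
  have "distr M (count_space UNIV) Z = measure_pmf p"
  proof (rule measure_eqI_countable_AE[where \<Omega>="set_pmf p"])
    show "AE x in distr M (count_space UNIV) Z. x \<in> set_pmf p"
      using Z by (subst AE_distr_iff) auto
    show "AE x in measure_pmf p. x \<in> set_pmf p" by (simp add: AE_measure_pmf)
    fix s assume s: "s \<in> set_pmf p"
    have "Z -` {s} \<inter> space M = {x \<in> space M. Z x = s}" by auto
    then show "emeasure (distr M (count_space UNIV) Z) {s} = emeasure (measure_pmf p) {s}"
      using Z(2)[OF s] by (simp add: emeasure_distr emeasure_eq_measure emeasure_pmf_single)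
  qed (use fin in \<open>auto simp: countable_finite\<close>)
  then show ?thesis using Z m by blast
qed

end

section \<open>Finitely supported laws, their convolutions and independent realisations\<close>

lemma emeasure_pair_pmf_Times:
  "emeasure (measure_pmf (pair_pmf p q)) (A \<times> B) = emeasure (measure_pmf p) A * emeasure (measure_pmf q) B"
proof -
  have "emeasure (measure_pmf (pair_pmf p q)) (A \<times> B) = (\<integral>\<^sup>+x. indicator (A \<times> B) x \<partial>measure_pmf (pair_pmf p q))"
    by simp
  also have "\<dots> = (\<integral>\<^sup>+a. \<integral>\<^sup>+b. indicator A a * indicator B b \<partial>measure_pmf q \<partial>measure_pmf p)"
    by (simp add: nn_integral_pair_pmf' indicator_times)
  also have "\<dots> = emeasure (measure_pmf p) A * emeasure (measure_pmf q) B"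
    by (simp add: nn_integral_cmult nn_integral_multc)
  finally show ?thesis .
qed

definition conv_pmf :: "real pmf \<Rightarrow> real pmf \<Rightarrow> real pmf" where
  "conv_pmf p q = map_pmf (\<lambda>(x, y). x + y) (pair_pmf p q)"

text \<open>A pmf carries the discrete sigma-algebra; its image under the identity into
  \<open>borel\<close> is what can equal the law of a random variable.\<close>

definition has_law :: "'a measure \<Rightarrow> ('a \<Rightarrow> real) \<Rightarrow> real pmf \<Rightarrow> bool" where
  "has_law M X p \<longleftrightarrow> X \<in> Linfty M \<and> distr M borel X = distr (measure_pmf p) borel (\<lambda>x. x)"

definition K_pmf :: "real pmf \<Rightarrow> ereal \<Rightarrow> real" where
  "K_pmf p a = K_stat (measure_pmf p) a (\<lambda>x. x)"

lemma finite_conv_pmf: "finite (set_pmf p) \<Longrightarrow> finite (set_pmf q) \<Longrightarrow> finite (set_pmf (conv_pmf p q))"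
  by (simp add: conv_pmf_def)

lemma ess_bounded_pmf:
  fixes f :: "'b \<Rightarrow> real" assumes "finite (set_pmf p)" shows "ess_bounded (measure_pmf p) f"
proof (rule ess_boundedI[where B="Max ((\<lambda>x. \<bar>f x\<bar>) ` set_pmf p)"])
  show "AE x in measure_pmf p. \<bar>f x\<bar> \<le> Max ((\<lambda>x. \<bar>f x\<bar>) ` set_pmf p)"
    using assms by (auto simp: AE_measure_pmf_iff)
qed simp

lemma K_stat_has_law:
  assumes "prob_space M" "has_law M X p"
  shows "K_stat M a X = K_pmf p a"
  unfolding K_pmf_def using assms
  by (intro K_stat_law) (auto simp: has_law_def prob_space_measure_pmf Linfty_ess_bounded)

lemma K_stat_pmf:
  assumes "finite (set_pmf p)"
  shows "K_stat (measure_pmf p) a f = K_pmf (map_pmf f p) a"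
  unfolding K_pmf_def
  by (rule K_stat_law) (auto simp: prob_space_measure_pmf ess_bounded_pmf[OF assms] map_pmf_rep_eq distr_distr o_def intro!: measure_pmf.prob_space_distr)

context prob_space
begin

lemma has_law_comp:
  assumes m [measurable]: "Z \<in> M \<rightarrow>\<^sub>M count_space UNIV" and Z: "\<forall>x\<in>space M. Z x \<in> set_pmf p"
    and d: "distr M (count_space UNIV) Z = measure_pmf p" and fin: "finite (set_pmf p)"
  shows "has_law M (\<lambda>x. f (Z x)) (map_pmf f p)"
proof -
  have "bounded ((\<lambda>x. f (Z x)) ` space M)"
    by (rule bounded_subset[OF finite_imp_bounded[of "f ` set_pmf p"]]) (use Z fin in auto)
  moreover have "distr M borel (\<lambda>x. f (Z x)) = distr (distr M (count_space UNIV) Z) borel f"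
    by (simp add: distr_distr o_def)
  then have "distr M borel (\<lambda>x. f (Z x)) = distr (measure_pmf (map_pmf f p)) borel (\<lambda>x. x)"
    unfolding d by (simp add: map_pmf_rep_eq distr_distr o_def)
  moreover have "(\<lambda>x. f (Z x)) \<in> borel_measurable M"
    by (rule measurable_compose[OF m]) simp
  ultimately show ?thesis by (auto simp: has_law_def Linfty_def)
qed

lemma ex_has_law:
  assumes "nonatomic M" "finite (set_pmf p)"
  shows "\<exists>X. has_law M X p"
  using nonatomic_realize_pmf[OF assms] has_law_comp[of _ p "\<lambda>x. x"] assms by (auto simp: map_pmf_ident)

text \<open>Both variables are coordinates of one realisation of the product law. Additivity can be
  exploited because such independent pairs exist on the given space itself.\<close>

lemma ex_indep_has_law:
  assumes na: "nonatomic M" and fin: "finite (set_pmf p)" "finite (set_pmf q)"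
  shows "\<exists>X Y. has_law M X p \<and> has_law M Y q \<and> indep_var borel X borel Y
    \<and> has_law M (\<lambda>x. X x + Y x) (conv_pmf p q)"
proof -
  let ?pq = "pair_pmf p q"
  have fin': "finite (set_pmf ?pq)" using fin by simp
  obtain Z where Z: "Z \<in> M \<rightarrow>\<^sub>M count_space UNIV" "\<forall>x\<in>space M. Z x \<in> set_pmf ?pq"
      "distr M (count_space UNIV) Z = measure_pmf ?pq"
    using nonatomic_realize_pmf[OF na fin'] by blast
  note [measurable] = Z(1)
  define X where "X x = fst (Z x)" for x
  define Y where "Y x = snd (Z x)" for x
  have X: "has_law M X p" using has_law_comp[OF Z fin', of fst] by (simp add: X_def[abs_def] map_fst_pair_pmf)
  have Y: "has_law M Y q" using has_law_comp[OF Z fin', of snd] by (simp add: Y_def[abs_def] map_snd_pair_pmf)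
  have XY: "has_law M (\<lambda>x. X x + Y x) (conv_pmf p q)"
    using has_law_comp[OF Z fin', of "\<lambda>z. fst z + snd z"] by (simp add: X_def Y_def conv_pmf_def case_prod_unfold)
  have mX [measurable]: "X \<in> borel_measurable M" and mY [measurable]: "Y \<in> borel_measurable M"
    using X Y by (auto simp: has_law_def Linfty_def)
  have "distr M borel X \<Otimes>\<^sub>M distr M borel Y = distr M (borel \<Otimes>\<^sub>M borel) (\<lambda>x. (X x, Y x))"
  proof (rule pair_measure_eqI)
    show "sigma_finite_measure (distr M borel X)" "sigma_finite_measure (distr M borel Y)"
      by (auto intro!: prob_space_imp_sigma_finite prob_space_distr)
    show "sets (distr M borel X \<Otimes>\<^sub>M distr M borel Y) = sets (distr M (borel \<Otimes>\<^sub>M borel) (\<lambda>x. (X x, Y x)))"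
      by (simp cong: sets_pair_measure_cong)
    fix A B assume AB: "A \<in> sets (distr M borel X)" "B \<in> sets (distr M borel Y)"
    then have [measurable]: "A \<in> sets borel" "B \<in> sets borel" by auto
    have "emeasure (distr M (borel \<Otimes>\<^sub>M borel) (\<lambda>x. (X x, Y x))) (A \<times> B)
        = emeasure M ((\<lambda>x. (X x, Y x)) -` (A \<times> B) \<inter> space M)" by (simp add: emeasure_distr)
    also have "\<dots> = emeasure M (Z -` (A \<times> B) \<inter> space M)" by (simp add: X_def Y_def)
    also have "\<dots> = emeasure (distr M (count_space UNIV) Z) (A \<times> B)" by (simp add: emeasure_distr)
    also have "\<dots> = emeasure (measure_pmf p) A * emeasure (measure_pmf q) B"
      by (simp add: Z(3) emeasure_pair_pmf_Times)
    finally show "emeasure (distr M borel X) A * emeasure (distr M borel Y) B =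
        emeasure (distr M (borel \<Otimes>\<^sub>M borel) (\<lambda>x. (X x, Y x))) (A \<times> B)"
      using X Y by (simp add: has_law_def emeasure_distr)
  qed
  then have "indep_var borel X borel Y" by (subst indep_var_distribution_eq) simp
  with X Y XY show ?thesis by blast
qed

lemma K_pmf_conv:
  assumes na: "nonatomic M" and fin: "finite (set_pmf p)" "finite (set_pmf q)"
  shows "K_pmf (conv_pmf p q) a = K_pmf p a + K_pmf q a"
proof -
  obtain X Y where XY: "has_law M X p" "has_law M Y q" "indep_var borel X borel Y"
      "has_law M (\<lambda>x. X x + Y x) (conv_pmf p q)"
    using ex_indep_has_law[OF assms] by blast
  show ?thesis
    using K_stat_add[of X Y a] XY
    by (simp add: K_stat_has_law[OF prob_space_axioms] has_law_def Linfty_ess_bounded flip: K_stat_has_law[OF prob_space_axioms])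
qed

end

section \<open>Monotonicity with respect to the cumulant order\<close>

lemma measure_pair_pmf:
  "measure (measure_pmf (pair_pmf p q)) A = (\<integral>y. measure (measure_pmf p) {x. (x, y) \<in> A} \<partial>measure_pmf q)"
proof -
  have "emeasure (measure_pmf (pair_pmf p q)) A = emeasure (measure_pmf (map_pmf (\<lambda>(y, x). (x, y)) (pair_pmf q p))) A"
    by (subst pair_commute_pmf) simp
  also have "\<dots> = (\<integral>\<^sup>+y. \<integral>\<^sup>+x. indicator A (x, y) \<partial>measure_pmf p \<partial>measure_pmf q)"
    by (simp add: nn_integral_pair_pmf' flip: nn_integral_indicator,
        intro nn_integral_cong, simp add: indicator_def)
  also have "\<dots> = (\<integral>\<^sup>+y. ennreal (measure (measure_pmf p) {x. (x, y) \<in> A}) \<partial>measure_pmf q)"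
  proof (rule nn_integral_cong)
    fix y
    have "(\<integral>\<^sup>+x. indicator A (x, y) \<partial>measure_pmf p) = (\<integral>\<^sup>+x. indicator {x. (x, y) \<in> A} x \<partial>measure_pmf p)"
      by (intro nn_integral_cong) (auto simp: indicator_def)
    then show "(\<integral>\<^sup>+x. indicator A (x, y) \<partial>measure_pmf p) = ennreal (measure (measure_pmf p) {x. (x, y) \<in> A})"
      by (simp add: measure_pmf.emeasure_eq_measure)
  qed
  also have "\<dots> = ennreal (\<integral>y. measure (measure_pmf p) {x. (x, y) \<in> A} \<partial>measure_pmf q)"
    by (intro nn_integral_eq_integral measure_pmf.integrable_const_bound[where B=1]) auto
  finally show ?thesis
    by (simp add: measure_pmf.emeasure_eq_measure)
qed

text \<open>On a grid the exponential moment is the probability generating function at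
  \<open>exp (a * e)\<close>, which turns comparisons of \<open>K_a\<close> into polynomial
  inequalities.\<close>

lemma K_pmf_scaled_nat:
  fixes p :: "nat pmf"
  shows "K_pmf (map_pmf (\<lambda>i. e * real i) p) (ereal a)
    = (if a = 0 then e * (\<integral>i. real i \<partial>measure_pmf p) else 1 / a * ln (\<integral>i. exp (a * e) ^ i \<partial>measure_pmf p))"
proof -
  have "exp (a * (e * real i)) = exp (a * e) ^ i" for i
    by (simp add: exp_of_nat_mult[symmetric] mult_ac)
  then show ?thesis by (simp add: K_pmf_def K_stat_def)
qed

text \<open>Summation by parts. The second identity is the substitute for the first at
  \<open>x = 1\<close>, where the factor \<open>1 - x\<close> destroys all information; there means
  replace generating functions.\<close>

lemma sum_diff_telescope:
  fixes c r :: "nat \<Rightarrow> real" and x :: real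
  assumes "\<And>k. c k = (\<Sum>i\<le>k. r i)"
  shows "(1 - x) * (\<Sum>i\<le>n. c i * x ^ i) = (\<Sum>i\<le>n. r i * x ^ i) - c n * x ^ Suc n"
    and "(\<Sum>i\<le>n. c i) = (real n + 1) * c n - (\<Sum>i\<le>n. real i * r i)"
proof -
  have c: "c 0 = r 0" "\<And>k. c (Suc k) = c k + r (Suc k)" using assms by simp_all
  show "(1 - x) * (\<Sum>i\<le>n. c i * x ^ i) = (\<Sum>i\<le>n. r i * x ^ i) - c n * x ^ Suc n"
    by (induction n) (simp_all add: c algebra_simps)
  show "(\<Sum>i\<le>n. c i) = (real n + 1) * c n - (\<Sum>i\<le>n. real i * r i)"
    by (induction n) (simp_all add: c algebra_simps)
qed

text \<open>If \<open>X\<close>, \<open>Y\<close> have laws \<open>p\<close>, \<open>q\<close> then \<open>E t^X - E t^Y\<close> is \<open>t - 1\<close> times the polynomial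
  whose coefficients are the differences of the distribution functions. Multiplying this
  polynomial by \<open>(1 + t)^n\<close> amounts to adding an independent binomial variable.\<close>

lemma binomial_catalyst:
  fixes p q :: "nat pmf"
  assumes fin: "finite (set_pmf p)" "finite (set_pmf q)"
    and q0: "0 \<in> set_pmf q" and p0: "0 \<notin> set_pmf p"
    and D: "D \<in> set_pmf p" "\<And>i. i \<in> set_pmf p \<Longrightarrow> i \<le> D" "\<And>i. i \<in> set_pmf q \<Longrightarrow> i < D"
    and e: "e > 0"
    and K: "\<And>a. K_pmf (map_pmf (\<lambda>i. e * real i) q) (ereal a) < K_pmf (map_pmf (\<lambda>i. e * real i) p) (ereal a)"
  shows "\<exists>n. \<forall>k. measure (measure_pmf (pair_pmf p (binomial_pmf n (1/2)))) {(i, j). i + j \<le> k}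
    \<le> measure (measure_pmf (pair_pmf q (binomial_pmf n (1/2)))) {(i, j). i + j \<le> k}"
proof -
  define r where "r i = pmf q i - pmf p i" for i
  define c where "c k = measure (measure_pmf q) {..k} - measure (measure_pmf p) {..k}" for k :: nat
  have c_sum: "c k = (\<Sum>i\<le>k. r i)" for k
    by (simp add: c_def r_def measure_measure_pmf_finite sum_subtractf)
  obtain d where d: "D = Suc d" using D p0 by (cases D) auto
  have c_ge: "c k = 0" if "k \<ge> D" for k
  proof -
    have "\<And>i. i \<in> set_pmf p \<Longrightarrow> i \<le> k" "\<And>i. i \<in> set_pmf q \<Longrightarrow> i \<le> k"
      using that D(2,3) by (meson le_trans less_imp_le)+
    then have "measure (measure_pmf p) {..k} = 1" "measure (measure_pmf q) {..k} = 1"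
      by (auto simp: measure_pmf.prob_eq_1 AE_measure_pmf_iff)
    then show ?thesis by (simp add: c_def)
  qed
  \<comment> \<open>The conditions on the supports serve the two ends of the polynomial:
    \<open>c 0\<close> is the mass of \<open>q\<close> at 0, and \<open>c d\<close> below is the
    mass of \<open>p\<close> at \<open>D\<close>.\<close>
  have c0: "c 0 > 0" using q0 p0 by (simp add: c_sum r_def set_pmf_iff pmf_pos)
  have cd: "c d > 0"
  proof -
    have "c D = c d + r D" by (simp add: c_sum d)
    moreover have "r D = - pmf p D" using D(3)[of D] by (auto simp: r_def set_pmf_iff)
    ultimately show ?thesis using c_ge[of D] D(1) by (simp add: pmf_positive)
  qed
  have ex: "(\<integral>i. f i \<partial>measure_pmf q) - (\<integral>i. f i \<partial>measure_pmf p) = (\<Sum>i\<le>D. r i * f i)" for f :: "nat \<Rightarrow> real"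
  proof -
    have "(\<integral>i. f i \<partial>measure_pmf q) = (\<Sum>i\<le>D. f i * pmf q i)" "(\<integral>i. f i \<partial>measure_pmf p) = (\<Sum>i\<le>D. f i * pmf p i)"
      using D by (auto intro!: integral_measure_pmf_real dest: less_imp_le)
    then show ?thesis by (simp add: r_def sum_subtractf algebra_simps)
  qed
  have pos: "(\<Sum>i\<le>d. c i * x ^ i) > 0" if x: "x > 0" for x
  proof -
    have sD: "(\<Sum>i\<le>d. c i * x ^ i) = (\<Sum>i\<le>D. c i * x ^ i)" using c_ge[of D] by (simp add: d)
    have tel: "(1 - x) * (\<Sum>i\<le>d. c i * x ^ i) = (\<integral>i. x ^ i \<partial>measure_pmf q) - (\<integral>i. x ^ i \<partial>measure_pmf p)"
      unfolding sD sum_diff_telescope(1)[of c r, OF c_sum] ex using c_ge[of D] by simp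
    have ipos: "(\<integral>i. x ^ i \<partial>measure_pmf s) > 0" if "finite (set_pmf s)" for s
      using that x unfolding integral_measure_pmf_real[OF that, of s "\<lambda>i. x ^ i", simplified]
      by (intro sum_pos) (auto simp: set_pmf_not_empty pmf_positive)
    \<comment> \<open>Every positive \<open>x\<close> is \<open>exp (a * e)\<close> for one real
      \<open>a\<close>, whose sign is that of \<open>x - 1\<close>. The sign of \<open>1 / a\<close>
      decides the direction in which the logarithms compare, and it matches the sign of
      \<open>1 - x\<close> in \<open>tel\<close>.\<close>
    define a where "a = ln x / e"
    have xa: "exp (a * e) = x" using e x by (simp add: a_def)
    consider "x = 1" | "x > 1" | "x < 1" by linarith
    then show ?thesis
    proof cases
      case 1
      have "(\<integral>i. real i \<partial>measure_pmf q) < (\<integral>i. real i \<partial>measure_pmf p)"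
        using K[of 0] e unfolding K_pmf_scaled_nat by simp
      moreover have "(\<Sum>i\<le>D. c i) = - (\<Sum>i\<le>D. r i * real i)"
        unfolding sum_diff_telescope(2)[of c r, OF c_sum] using c_ge[of D] by (simp add: mult.commute)
      ultimately show ?thesis unfolding sD using ex[of real] 1 by simp
    next
      case 2
      then have a: "a > 0" using e by (simp add: a_def)
      then have "(\<integral>i. x ^ i \<partial>measure_pmf q) < (\<integral>i. x ^ i \<partial>measure_pmf p)"
        using K[of a] ipos fin unfolding K_pmf_scaled_nat xa by (simp add: divide_less_cancel)
      then have "(1 - x) * (\<Sum>i\<le>d. c i * x ^ i) < 0" using tel by simp
      then show ?thesis using 2 by (simp add: mult_less_0_iff)
    next
      case 3
      then have a: "a < 0" using e x by (simp add: a_def divide_neg_pos)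
      then have "(\<integral>i. x ^ i \<partial>measure_pmf p) < (\<integral>i. x ^ i \<partial>measure_pmf q)"
        using K[of a] ipos fin unfolding K_pmf_scaled_nat xa by (simp add: divide_less_cancel)
      then have "(1 - x) * (\<Sum>i\<le>d. c i * x ^ i) > 0" using tel by simp
      then show ?thesis using 3 by (simp add: zero_less_mult_iff)
    qed
  qed
  obtain n where n: "\<And>k. (\<Sum>i\<le>d. c i * (if i \<le> k then real (n choose (k - i)) else 0)) \<ge> 0"
    using Polya_univariate[OF c0 cd pos] by blast
  \<comment> \<open>Success probability 1/2 makes the weights proportional to the coefficients of
    \<open>(1 + t)^n\<close>.\<close>
  let ?z = "binomial_pmf n (1/2)"
  have z: "pmf ?z j = real (n choose j) / 2 ^ n" for j
  proof (cases "j \<le> n")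
    case True
    then have "(1/2::real) ^ j * (1/2) ^ (n - j) = (1/2) ^ n" by (simp flip: power_add)
    then show ?thesis by (simp add: power_one_over mult.assoc)
  qed (simp add: binomial_eq_0)
  have "measure (measure_pmf (pair_pmf p ?z)) {(i, j). i + j \<le> k} \<le> measure (measure_pmf (pair_pmf q ?z)) {(i, j). i + j \<le> k}" for k
  proof -
    have m: "measure (measure_pmf (pair_pmf s ?z)) {(i, j). i + j \<le> k}
        = (\<Sum>j\<le>k. measure (measure_pmf s) {..k - j} * pmf ?z j)" for s
    proof -
      have "measure (measure_pmf (pair_pmf s ?z)) {(i, j). i + j \<le> k}
          = (\<integral>j. measure (measure_pmf s) {i. i + j \<le> k} \<partial>measure_pmf ?z)"
        by (simp add: measure_pair_pmf)
      also have "\<dots> = (\<Sum>j\<le>k. measure (measure_pmf s) {i. i + j \<le> k} * pmf ?z j)"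
      proof (rule integral_measure_pmf_real)
        fix j assume "measure (measure_pmf s) {i. i + j \<le> k} \<noteq> 0"
        then have "{i. i + j \<le> k} \<noteq> {}" by force
        then show "j \<in> {..k}" by auto
      qed simp
      also have "\<dots> = (\<Sum>j\<le>k. measure (measure_pmf s) {..k - j} * pmf ?z j)"
        by (intro sum.cong arg_cong2[where f="(*)"] arg_cong2[where f=measure]) auto
      finally show ?thesis .
    qed
    have "0 \<le> (\<Sum>i\<le>d. c i * (if i \<le> k then real (n choose (k - i)) else 0))" by (rule n)
    also have "\<dots> = (\<Sum>i\<in>{..d} \<inter> {..k}. c i * real (n choose (k - i)))"
      by (rule sum.mono_neutral_cong_right) auto
    also have "\<dots> = (\<Sum>i\<le>k. c i * real (n choose (k - i)))"
      using c_ge d by (intro sum.mono_neutral_left) auto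
    also have "\<dots> = (\<Sum>j\<le>k. c (k - j) * real (n choose j))"
      by (rule sum.reindex_bij_witness[of _ "\<lambda>j. k - j" "\<lambda>j. k - j"]) auto
    also have "\<dots> = 2 ^ n * (\<Sum>j\<le>k. c (k - j) * pmf ?z j)"
      by (simp add: z sum_distrib_left)
    finally have "0 \<le> (\<Sum>j\<le>k. c (k - j) * pmf ?z j)" by (rule zero_le_mult_pos) simp
    then show ?thesis unfolding m by (simp add: c_def left_diff_distrib sum_subtractf)
  qed
  then show ?thesis by blast
qed

section \<open>The functional on finitely supported laws\<close>

locale monotone_additive_functional = prob_space M for M :: "'a measure" +
  fixes \<Phi> :: "('a \<Rightarrow> real) \<Rightarrow> real"
  assumes nonatomic: "nonatomic M" and monotone_additive: "monotone_additive_statistic M \<Phi>"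
begin

text \<open>Law invariance makes the choice of the representative immaterial. The definition is of
  interest for laws that are realised on \<open>M\<close>, among them all finitely supported
  ones.\<close>

definition \<phi> :: "real pmf \<Rightarrow> real" where
  "\<phi> p = \<Phi> (SOME X. has_law M X p)"

lemma Phi_has_law:
  assumes "has_law M X p" shows "\<Phi> X = \<phi> p"
proof -
  have "has_law M (SOME X. has_law M X p) p"
    using assms by (rule someI[where P="\<lambda>X. has_law M X p"])
  then have "X \<in> Linfty M" "(SOME X. has_law M X p) \<in> Linfty M"
      "distr M borel X = distr M borel (SOME X. has_law M X p)"
    using assms by (auto simp: has_law_def)
  then show ?thesis
    using monotone_additive
    unfolding \<phi>_def monotone_additive_statistic_def statistic_def by blast
qed

lemma phi_conv:
  assumes "finite (set_pmf p)" "finite (set_pmf q)"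
  shows "\<phi> (conv_pmf p q) = \<phi> p + \<phi> q"
proof -
  obtain X Y where XY: "has_law M X p" "has_law M Y q" "indep_var borel X borel Y"
      "has_law M (\<lambda>x. X x + Y x) (conv_pmf p q)"
    using ex_indep_has_law[OF nonatomic assms] by blast
  then have "\<Phi> (\<lambda>x. X x + Y x) = \<Phi> X + \<Phi> Y"
    using monotone_additive
    unfolding monotone_additive_statistic_def additive_stat_def has_law_def by blast
  then show ?thesis using XY by (simp add: Phi_has_law)
qed

lemma phi_return: "\<phi> (return_pmf c) = c"
proof -
  have "has_law M (\<lambda>_. c) (return_pmf c)"
    by (auto simp: has_law_def Linfty_def return_pmf.rep_eq distr_return distr_const intro: bounded_subset[of "{c}"])
  then have "\<Phi> (\<lambda>_. c) = \<phi> (return_pmf c)" by (rule Phi_has_law)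
  then show ?thesis
    using monotone_additive unfolding monotone_additive_statistic_def statistic_def by simp
qed

lemma phi_first_order:
  assumes fin: "finite (set_pmf p)" "finite (set_pmf q)"
    and le: "\<And>t. measure (measure_pmf p) {..t} \<le> measure (measure_pmf q) {..t}"
  shows "\<phi> q \<le> \<phi> p"
proof -
  obtain X Y where XY: "has_law M X p" "has_law M Y q"
    using ex_has_law[OF nonatomic] fin by metis
  have *: "measure M {x \<in> space M. Z x \<le> t} = measure (measure_pmf s) {..t}" if "has_law M Z s" for Z s t
  proof -
    have [measurable]: "Z \<in> borel_measurable M" using that by (auto simp: has_law_def Linfty_def)
    have "measure M {x \<in> space M. Z x \<le> t} = measure (distr M borel Z) {..t}"
      by (auto simp: measure_distr intro!: arg_cong[where f="measure M"])
    also have "\<dots> = measure (distr (measure_pmf s) borel (\<lambda>x. x)) {..t}" using that by (simp add: has_law_def)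
    also have "\<dots> = measure (measure_pmf s) {..t}" by (simp add: measure_distr)
    finally show ?thesis .
  qed
  have "first_order_dominates M X Y"
    unfolding first_order_dominates_def using le *[OF XY(1)] *[OF XY(2)] by simp
  then have "\<Phi> Y \<le> \<Phi> X"
    using monotone_additive XY
    unfolding monotone_additive_statistic_def monotone_stat_def has_law_def by blast
  then show ?thesis using XY by (simp add: Phi_has_law)
qed

lemma phi_mono:
  assumes fin: "finite (set_pmf p)" and le: "\<And>x. x \<in> set_pmf p \<Longrightarrow> f x \<le> g x"
  shows "\<phi> (map_pmf f p) \<le> \<phi> (map_pmf g p)"
proof (rule phi_first_order)
  fix t
  show "measure (measure_pmf (map_pmf g p)) {..t} \<le> measure (measure_pmf (map_pmf f p)) {..t}"
    unfolding measure_map_pmf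
    by (rule measure_pmf.finite_measure_mono_AE) (use le in \<open>auto simp: AE_measure_pmf_iff intro: order_trans\<close>)
qed (use fin in auto)

lemma phi_shift:
  assumes "finite (set_pmf p)"
  shows "\<phi> (map_pmf (\<lambda>x. f x + c) p) = \<phi> (map_pmf f p) + c"
proof -
  have "conv_pmf (map_pmf f p) (return_pmf c) = map_pmf (\<lambda>x. f x + c) p"
    by (simp add: conv_pmf_def pair_return_pmf2 map_pmf_comp)
  then show ?thesis using phi_conv[of "map_pmf f p" "return_pmf c"] assms by (simp add: phi_return)
qed

lemma phi_nat_dominance:
  fixes p q :: "nat pmf"
  assumes fin: "finite (set_pmf p)" "finite (set_pmf q)"
    and q0: "0 \<in> set_pmf q" and p0: "0 \<notin> set_pmf p"
    and D: "D \<in> set_pmf p" "\<And>i. i \<in> set_pmf p \<Longrightarrow> i \<le> D" "\<And>i. i \<in> set_pmf q \<Longrightarrow> i < D"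
    and e: "e > 0"
    and K: "\<And>a. K_pmf (map_pmf (\<lambda>i. e * real i) q) (ereal a) < K_pmf (map_pmf (\<lambda>i. e * real i) p) (ereal a)"
  shows "\<phi> (map_pmf (\<lambda>i. e * real i) q) \<le> \<phi> (map_pmf (\<lambda>i. e * real i) p)"
proof -
  obtain n where n: "\<And>k. measure (measure_pmf (pair_pmf p (binomial_pmf n (1/2)))) {(i, j). i + j \<le> k}
    \<le> measure (measure_pmf (pair_pmf q (binomial_pmf n (1/2)))) {(i, j). i + j \<le> k}"
    using binomial_catalyst[OF assms] by blast
  let ?s = "\<lambda>i. e * real i" and ?z = "binomial_pmf n (1/2)"
  have finz: "finite (set_pmf ?z)" by (rule finite_subset[of _ "{..n}"]) (auto simp: set_pmf_binomial_eq)
  have conv: "conv_pmf (map_pmf ?s r) (map_pmf ?s ?z) = map_pmf (\<lambda>(i, j). e * real (i + j)) (pair_pmf r ?z)" for r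
    by (simp add: conv_pmf_def map_pair[symmetric] map_pmf_comp case_prod_unfold distrib_left)
  have "\<phi> (conv_pmf (map_pmf ?s q) (map_pmf ?s ?z)) \<le> \<phi> (conv_pmf (map_pmf ?s p) (map_pmf ?s ?z))"
  proof (rule phi_first_order)
    fix t :: real
    \<comment> \<open>On the grid a real threshold becomes the integer threshold
      \<open>\<lfloor>t / e\<rfloor>\<close>. Negative \<open>t\<close> needs its own case, because
      \<open>nat\<close> would return 0 and wrongly admit the pair of zeros.\<close>
    have "(\<lambda>(i::nat, j). e * real (i + j)) -` {..t} = (if t < 0 then {} else {(i, j). i + j \<le> nat \<lfloor>t / e\<rfloor>})"
    proof (cases "t < 0")
      case True
      have "0 \<le> e * real m" for m using e by simp
      then have "\<not> e * real m \<le> t" for m using True by (meson not_le order_less_le_trans)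
      then show ?thesis using True by (auto simp del: of_nat_add)
    next
      case False
      have "e * real m \<le> t \<longleftrightarrow> m \<le> nat \<lfloor>t / e\<rfloor>" for m
      proof -
        have "e * real m \<le> t \<longleftrightarrow> real m \<le> t / e" using e by (simp add: field_simps)
        also have "\<dots> \<longleftrightarrow> m \<le> nat \<lfloor>t / e\<rfloor>" using False e by (simp add: le_nat_iff le_floor_iff)
        finally show ?thesis .
      qed
      then show ?thesis using False by (simp only: vimage_def case_prod_unfold if_False atMost_iff)
    qed
    then show "measure (measure_pmf (conv_pmf (map_pmf ?s p) (map_pmf ?s ?z))) {..t}
        \<le> measure (measure_pmf (conv_pmf (map_pmf ?s q) (map_pmf ?s ?z))) {..t}"
      unfolding conv measure_map_pmf using n[of "nat \<lfloor>t / e\<rfloor>"] by (simp only:) (simp split: if_split)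
  qed (use fin finz in \<open>auto intro!: finite_conv_pmf\<close>)
  then show ?thesis using fin finz by (simp add: phi_conv)
qed

text \<open>Both laws are moved to a grid anchored at the minimum of \<open>q\<close>:
  \<open>q\<close> is rounded down, \<open>p\<close> is rounded up and raised by one more cell. This
  makes all inequalities strict and puts the supports into the position that the grid case
  demands.\<close>

lemma phi_K_mono:
  assumes fin: "finite (set_pmf p)" "finite (set_pmf q)" and K: "\<And>a. K_pmf q a \<le> K_pmf p a"
  shows "\<phi> q \<le> \<phi> p"
proof (rule field_le_epsilon)
  fix e' :: real assume e': "e' > 0"
  \<comment> \<open>Rounding \<open>q\<close> costs at most one \<open>e\<close>; rounding
    \<open>p\<close>, with the additional cell, costs at most two.\<close>
  define e where "e = e' / 3"
  have e: "e > 0" using e' by (simp add: e_def)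
  define c where "c = Min (set_pmf q)"
  have c: "c \<in> set_pmf q" "\<And>x. x \<in> set_pmf q \<Longrightarrow> c \<le> x"
    using fin by (auto simp: c_def set_pmf_not_empty)
  \<comment> \<open>The summand 1 creates the strict margin \<open>e\<close> and keeps 0 out of the
    support of \<open>p'\<close>.\<close>
  define I where "I x = nat \<lceil>(x - c) / e\<rceil> + 1" for x
  define J where "J x = nat \<lfloor>(x - c) / e\<rfloor>" for x
  have eb: "ess_bounded (measure_pmf s) f" if "finite (set_pmf s)" for s :: "real pmf" and f :: "real \<Rightarrow> real"
    by (rule ess_bounded_pmf[OF that])
  \<comment> \<open>The parameter \<open>-\<infinity>\<close> compares the minima: no point of
    \<open>p\<close> lies below \<open>c\<close>, so \<open>nat\<close> truncates nothing.\<close>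
  have pc: "c \<le> x" if x: "x \<in> set_pmf p" for x
  proof -
    have "c \<le> K_pmf q (- \<infinity>)"
      using measure_pmf.K_stat_mono_AE[of q "\<lambda>_. c" "\<lambda>x. x" "-\<infinity>"] eb fin c(2)
      by (simp add: K_pmf_def measure_pmf.K_stat_const AE_measure_pmf_iff ess_bounded_const)
    also have "\<dots> \<le> K_pmf p (- \<infinity>)" by (rule K)
    finally have "ess_max (measure_pmf p) (\<lambda>x. - x) \<le> - c"
      by (simp add: K_pmf_def K_stat_def ess_min_def)
    then show ?thesis using x by (simp add: measure_pmf.ess_max_le_iff eb fin AE_measure_pmf_iff)
  qed
  have I: "x - c + e \<le> e * real (I x)" "e * real (I x) \<le> x - c + 2 * e" if "c \<le> x" for x
  proof -
    have "0 \<le> (x - c) / e" using that e by simp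
    then have "(x - c) / e + 1 \<le> real (I x)" "real (I x) \<le> (x - c) / e + 2"
      unfolding I_def by linarith+
    then have "e * ((x - c) / e + 1) \<le> e * real (I x)" "e * real (I x) \<le> e * ((x - c) / e + 2)"
      using e by (auto intro: mult_left_mono)
    moreover have "e * ((x - c) / e + 1) = x - c + e" "e * ((x - c) / e + 2) = x - c + 2 * e"
      using e by (simp_all add: distrib_left)
    ultimately show "x - c + e \<le> e * real (I x)" "e * real (I x) \<le> x - c + 2 * e"
      by simp_all
  qed
  have J: "x - c - e \<le> e * real (J x)" "e * real (J x) \<le> x - c" if "c \<le> x" for x
  proof -
    have "0 \<le> (x - c) / e" using that e by simp
    then have "(x - c) / e - 1 \<le> real (J x)" "real (J x) \<le> (x - c) / e"
      unfolding J_def by linarith+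
    then have "e * ((x - c) / e - 1) \<le> e * real (J x)" "e * real (J x) \<le> e * ((x - c) / e)"
      using e by (intro mult_left_mono; simp)+
    moreover have w: "e * ((x - c) / e) = x - c" using e by simp
    moreover have "e * ((x - c) / e - 1) = x - c - e" by (simp only: right_diff_distrib w mult_1_right)
    ultimately show "x - c - e \<le> e * real (J x)" "e * real (J x) \<le> x - c"
      by simp_all
  qed
  define p' where "p' = map_pmf I p"
  define q' where "q' = map_pmf J q"
  let ?s = "\<lambda>i. e * real i"
  have P: "map_pmf ?s p' = map_pmf (\<lambda>x. e * real (I x)) p" and Q: "map_pmf ?s q' = map_pmf (\<lambda>x. e * real (J x)) q"
    by (simp_all add: p'_def q'_def map_pmf_comp)
  have "\<phi> (map_pmf ?s q') \<le> \<phi> (map_pmf ?s p')"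
  proof (rule phi_nat_dominance[OF _ _ _ _ _ _ _ e])
    show "finite (set_pmf p')" "finite (set_pmf q')" using fin by (simp_all add: p'_def q'_def)
    have "J c = 0" by (simp add: J_def)
    then show "0 \<in> set_pmf q'" using c(1) by (force simp: q'_def)
    show "0 \<notin> set_pmf p'" by (auto simp: p'_def I_def)
    define m where "m = Max (set_pmf p)"
    have m: "m \<in> set_pmf p" "\<And>x. x \<in> set_pmf p \<Longrightarrow> x \<le> m"
      using fin by (auto simp: m_def set_pmf_not_empty)
    show "I m \<in> set_pmf p'" using m by (simp add: p'_def)
    show "i \<le> I m" if i: "i \<in> set_pmf p'" for i
    proof -
      obtain x where "x \<in> set_pmf p" "i = I x" using i by (auto simp: p'_def)
      then have "(x - c) / e \<le> (m - c) / e" using m(2)[of x] e by (simp add: divide_right_mono)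
      then have "nat \<lceil>(x - c) / e\<rceil> \<le> nat \<lceil>(m - c) / e\<rceil>" by (intro nat_mono ceiling_mono)
      then show ?thesis using \<open>i = I x\<close> by (simp only: I_def add_le_mono1)
    qed
    show "i < I m" if i: "i \<in> set_pmf q'" for i
    proof -
      obtain y where y: "y \<in> set_pmf q" "i = J y" using i by (auto simp: q'_def)
      have "ess_max (measure_pmf q) (\<lambda>x. x) \<le> ess_max (measure_pmf p) (\<lambda>x. x)"
        using K[of \<infinity>] by (simp add: K_pmf_def K_stat_def)
      also have "\<dots> \<le> m" using m by (simp add: measure_pmf.ess_max_le_iff eb fin AE_measure_pmf_iff)
      finally have "y \<le> m" using y by (simp add: measure_pmf.ess_max_le_iff eb fin AE_measure_pmf_iff)
      then have "(y - c) / e \<le> (m - c) / e" using e by (simp add: divide_right_mono)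
      then have "\<lfloor>(y - c) / e\<rfloor> \<le> \<lceil>(m - c) / e\<rceil>" by linarith
      then show ?thesis unfolding y I_def J_def by linarith
    qed
    show "K_pmf (map_pmf ?s q') (ereal a) < K_pmf (map_pmf ?s p') (ereal a)" for a
    proof -
      have "K_pmf (map_pmf ?s q') a \<le> K_pmf (map_pmf (\<lambda>x. x + (- c)) q) a"
        unfolding Q K_stat_pmf[OF fin(2), symmetric]
        using J(2) c by (intro measure_pmf.K_stat_mono_AE eb fin) (auto simp: AE_measure_pmf_iff)
      also have "\<dots> = K_pmf q a - c"
        unfolding K_stat_pmf[OF fin(2), symmetric]
        using measure_pmf.K_stat_shift[where X="\<lambda>x. x" and a="ereal a" and c="- c", OF eb[OF fin(2)]] by (simp add: K_pmf_def)
      also have "\<dots> \<le> K_pmf p a - c" using K by simp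
      also have "\<dots> = K_pmf (map_pmf (\<lambda>x. x + (e - c)) p) a - e"
        unfolding K_stat_pmf[OF fin(1), symmetric]
        using measure_pmf.K_stat_shift[where X="\<lambda>x. x" and a="ereal a" and c="e - c", OF eb[OF fin(1)]] by (simp add: K_pmf_def)
      also have "\<dots> < K_pmf (map_pmf (\<lambda>x. x + (e - c)) p) a" using e by simp
      also have "\<dots> \<le> K_pmf (map_pmf ?s p') a"
        unfolding P K_stat_pmf[OF fin(1), symmetric]
        using I(1) pc by (intro measure_pmf.K_stat_mono_AE eb fin) (auto simp: AE_measure_pmf_iff algebra_simps)
      finally show ?thesis .
    qed
  qed
  moreover have "\<phi> q \<le> \<phi> (map_pmf ?s q') + (c + e)"
    unfolding Q phi_shift[OF fin(2), symmetric]
    using phi_mono[OF fin(2), of "\<lambda>x. x" "\<lambda>x. e * real (J x) + (c + e)"] J(1) c(2)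
    by (force simp: map_pmf_ident)
  moreover have "\<phi> (map_pmf ?s p') \<le> \<phi> p + (2 * e - c)"
    unfolding P
    using phi_mono[OF fin(1), of "\<lambda>x. e * real (I x)" "\<lambda>x. x + (2 * e - c)"] I(2) pc
      phi_shift[OF fin(1), of "\<lambda>x. x" "2 * e - c"]
    by (force simp: map_pmf_ident)
  ultimately show "\<phi> q \<le> \<phi> p + e'" by (simp add: e_def)
qed

end

section \<open>The induced positive linear functional\<close>

text \<open>The inverse of \<open>\<infinity>\<close> is 0, so the value there is
  \<open>max 0 t\<close>.\<close>

definition ramp :: "real \<Rightarrow> ereal \<Rightarrow> real" where
  "ramp t a = (if 0 < a then max 0 (t - real_of_ereal (inverse a)) else 0)"

definition two_point_pmf :: "real \<Rightarrow> nat \<Rightarrow> real pmf" where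
  "two_point_pmf t n = map_pmf (\<lambda>b. if b then t * real n else 0) (bernoulli_pmf (exp (- real n)))"

lemma finite_two_point_pmf: "finite (set_pmf (two_point_pmf t n))"
  by (simp add: two_point_pmf_def)

lemma K_two_point_pmf:
  assumes n: "n > 0" and t: "t > 0"
  shows "K_pmf (two_point_pmf t n) a = (case a of
      ereal r \<Rightarrow> if r = 0 then t * real n * exp (- real n)
        else 1 / r * ln (exp (r * t * real n) * exp (- real n) + (1 - exp (- real n)))
    | PInfty \<Rightarrow> t * real n | MInfty \<Rightarrow> 0)"
proof -
  let ?B = "bernoulli_pmf (exp (- real n))" and ?f = "\<lambda>b. if b then t * real n else 0"
  have K: "K_pmf (two_point_pmf t n) a = K_stat (measure_pmf ?B) a ?f"
    unfolding two_point_pmf_def by (rule K_stat_pmf[symmetric]) simp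
  \<comment> \<open>For \<open>n > 0\<close> the success probability is strictly below 1, so both
    values are charged; the essential maximum and minimum depend on this.\<close>
  have set: "set_pmf ?B = UNIV" using n by (intro set_pmf_bernoulli) auto
  have mx: "ess_max (measure_pmf ?B) g = max (g True) (g False)" for g
    by (rule measure_pmf.ess_max_unique) (auto simp: ess_bounded_pmf AE_measure_pmf_iff set UNIV_bool)
  show ?thesis
    unfolding K K_stat_def using t by (auto simp: mx ess_min_def mult.assoc split: ereal.split)
qed

text \<open>In the coordinate \<open>1 / a\<close> the cumulant functions of rare large values are asymptotically ramps.\<close>

lemma K_two_point_pmf_approx:
  assumes n: "n > 0" and t: "t > 0"
  shows "\<bar>K_pmf (two_point_pmf t n) a - real n * ramp t a\<bar> \<le> 2 * t"
proof -
  let ?n = "real n"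
  have n1: "?n \<ge> 1" using n by simp
  have E: "exp (- ?n) < 1" using n by simp
  have "?n \<le> exp ?n" using exp_ge_add_one_self[of ?n] by linarith
  then have ne: "?n * exp (- ?n) \<le> 1" by (simp add: exp_minus field_simps)
  show ?thesis
  proof (cases a)
    case PInf
    then show ?thesis using t by (simp add: K_two_point_pmf[OF n t] ramp_def)
  next
    case MInf
    then show ?thesis using t by (simp add: K_two_point_pmf[OF n t] ramp_def)
  next
    case (real r)
    define S where "S = exp (r * t * ?n) * exp (- ?n) + (1 - exp (- ?n))"
    consider "r = 0" | "r < 0" | "r > 0" by linarith
    then show ?thesis
    proof cases
      case 1
      have "t * (?n * exp (- ?n)) \<le> t * 1" using ne t by (intro mult_left_mono) auto
      then show ?thesis using 1 real t by (simp add: K_two_point_pmf[OF n t] ramp_def mult_ac)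
    next
      case 2
      have K: "K_pmf (two_point_pmf t n) a = 1 / r * ln S" "ramp t a = 0"
        using 2 real by (simp_all add: K_two_point_pmf[OF n t] S_def ramp_def)
      have S: "S = 1 - exp (- ?n) * (1 - exp (r * t * ?n))" by (simp add: S_def algebra_simps)
      have rt: "r * t * ?n \<le> 0" using 2 t by (simp add: mult_nonpos_nonneg mult_nonneg_nonneg mult_le_0_iff)
      have e1: "exp (r * t * ?n) \<le> 1" using rt by simp
      have "S \<le> 1" using e1 unfolding S by simp
      moreover have "S > 0" using E unfolding S_def by (intro add_pos_pos) auto
      ultimately have ln0: "ln S \<le> 0" by simp
      \<comment> \<open>By Jensen the cumulant at negative \<open>r\<close> lies between 0 and the
        mean \<open>t * n * exp (- n)\<close>, which is at most \<open>t\<close>.\<close>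
      have "r * t * ?n * exp (- ?n) \<le> ln S"
      proof -
        have "(\<integral>b. (if b then t * ?n else 0) \<partial>measure_pmf (bernoulli_pmf (exp (- ?n)))) = t * ?n * exp (- ?n)"
          by simp
        moreover have "(\<integral>b. exp (r * (if b then t * ?n else 0)) \<partial>measure_pmf (bernoulli_pmf (exp (- ?n)))) = S"
          by (simp add: S_def mult.assoc)
        ultimately show ?thesis
          using measure_pmf.ln_mgf_ge[OF ess_bounded_pmf, of "bernoulli_pmf (exp (- ?n))" r "\<lambda>b. if b then t * ?n else 0"]
          by (simp add: mult.assoc)
      qed
      then have "1 / r * ln S \<le> 1 / r * (r * t * ?n * exp (- ?n))"
        using 2 by (intro mult_left_mono_neg) auto
      also have "\<dots> = t * (?n * exp (- ?n))" using 2 by simp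
      also have "\<dots> \<le> t * 1" using ne t by (intro mult_left_mono) auto
      finally have "1 / r * ln S \<le> t" by simp
      moreover have "0 \<le> 1 / r * ln S" using ln0 2 by (simp add: divide_nonpos_neg)
      ultimately show ?thesis using K t by simp
    next
      case 3
      have K: "K_pmf (two_point_pmf t n) a = 1 / r * ln S" "ramp t a = max 0 (t - 1 / r)"
        using 3 real by (simp_all add: K_two_point_pmf[OF n t] S_def ramp_def inverse_eq_divide)
      have rt: "r * t * ?n \<ge> 0" using 3 t by simp
      have S: "S = 1 + exp (- ?n) * (exp (r * t * ?n) - 1)" by (simp add: S_def algebra_simps)
      have S1: "S \<ge> 1" using rt unfolding S by simp
      have S2: "S \<ge> exp (r * t * ?n - ?n)" using E unfolding S_def by (simp add: exp_diff exp_minus field_simps)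
      have lower: "?n * max 0 (t - 1 / r) \<le> 1 / r * ln S"
      proof (cases "t - 1 / r \<le> 0")
        case True then show ?thesis using S1 3 by simp
      next
        case False
        have "r * t * ?n - ?n \<le> ln S" using S1 S2 by (simp add: ln_ge_iff)
        then have "1 / r * (r * t * ?n - ?n) \<le> 1 / r * ln S" using 3 by (intro mult_left_mono) auto
        then show ?thesis using False 3 by (simp add: field_simps max_def)
      qed
      have upper: "1 / r * ln S \<le> ?n * max 0 (t - 1 / r) + 2 * t"
      proof (cases "r * t \<le> 1")
        case False
        then have "0 \<le> (r * t - 1) * ?n" by simp
        then have "1 \<le> exp (r * t * ?n - ?n)" by (simp add: algebra_simps)
        moreover have "S \<le> exp (r * t * ?n - ?n) + 1" unfolding S_def by (simp add: exp_diff exp_minus field_simps)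
        ultimately have "S \<le> 2 * exp (r * t * ?n - ?n)" by linarith
        then have "ln S \<le> ln (2 * exp (r * t * ?n - ?n))" using S1 by (intro ln_mono) auto
        also have "\<dots> = ln 2 + (r * t * ?n - ?n)" by (simp add: ln_mult)
        \<comment> \<open>Since \<open>ln 2 < 1 < r * t\<close>, the constant is traded for a
          multiple of \<open>r\<close>, which the division by \<open>r\<close> turns into
          \<open>t\<close>.\<close>
        also have "\<dots> \<le> r * t + (r * t * ?n - ?n)" using False ln_2_less_1 by simp
        finally have "1 / r * ln S \<le> 1 / r * (r * t + (r * t * ?n - ?n))" using 3 by (intro mult_left_mono) auto
        also have "\<dots> = t + ?n * (t - 1 / r)" using 3 by (simp add: field_simps)
        also have "\<dots> \<le> t + ?n * max 0 (t - 1 / r)" by (intro add_left_mono mult_left_mono) auto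
        also have "\<dots> \<le> ?n * max 0 (t - 1 / r) + 2 * t" using t by simp
        finally show ?thesis .
      next
        case True
        let ?u = "r * t * ?n"
        have u: "?u \<le> ?n" using True mult_right_mono[of "r * t" 1 ?n] by simp
        have "ln S \<le> S - 1" using S1 ln_le_minus_one[of S] by simp
        then have "1 / r * ln S \<le> 1 / r * (exp (- ?n) * (exp ?u - 1))" using 3 by (intro mult_left_mono) (auto simp: S)
        \<comment> \<open>The danger is the factor \<open>1 / r\<close>. For small \<open>r\<close>
          it cancels against \<open>exp ?u - 1 \<le> ?u * exp ?u\<close>; for \<open>?u\<close>
          above \<open>?n / 2\<close> it is itself at most \<open>2 * t\<close>.\<close>
        also have "\<dots> \<le> 2 * t"
        proof (cases "?u \<le> ?n / 2")
          case True
          have "exp ?u - 1 \<le> ?u * exp ?u"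
            using exp_ge_add_one_self[of "- ?u"] by (simp add: exp_minus field_simps)
          also have "\<dots> \<le> ?u * exp (?n / 2)" using True rt by (intro mult_left_mono) auto
          finally have "exp (- ?n) * (exp ?u - 1) \<le> exp (- ?n) * (?u * exp (?n / 2))" by (intro mult_left_mono) auto
          also have "\<dots> = ?u * exp (- (?n / 2))" by (simp add: exp_add[symmetric] mult.left_commute)
          finally have "1 / r * (exp (- ?n) * (exp ?u - 1)) \<le> 1 / r * (?u * exp (- (?n / 2)))" using 3 by (intro mult_left_mono) auto
          also have "\<dots> = 2 * t * ((?n / 2) * exp (- (?n / 2)))" using 3 by simp
          also have "\<dots> \<le> 2 * t * 1"
            using t exp_ge_add_one_self[of "?n / 2"] by (intro mult_left_mono) (auto simp: exp_minus field_simps)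
          finally show ?thesis by simp
        next
          case False
          have "exp (- ?n) * (exp ?u - 1) \<le> exp (- ?n) * exp ?n" using u by (intro mult_left_mono) (auto intro: order_trans[of _ "exp ?u"])
          then have "exp (- ?n) * (exp ?u - 1) \<le> 1" by (simp add: exp_minus)
          then have "1 / r * (exp (- ?n) * (exp ?u - 1)) \<le> 1 / r * 1" using 3 by (intro mult_left_mono) auto
          also have "1 / r \<le> 2 * t"
          proof -
            have "1 * ?n \<le> (2 * (r * t)) * ?n" using False by simp
            then have "1 \<le> 2 * (r * t)" using n by (simp only: mult_le_cancel_right)
            then show ?thesis using 3 by (simp add: field_simps)
          qed
          finally show ?thesis by simp
        qed
        also have "\<dots> \<le> ?n * max 0 (t - 1 / r) + 2 * t" by simp
        finally show ?thesis .
      qed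
      show ?thesis unfolding K using lower upper by (simp add: abs_le_iff)
    qed
  qed
qed

lemma K_pmf_return: "K_pmf (return_pmf c) a = c"
proof -
  have "K_pmf (return_pmf c) a = K_stat (measure_pmf (return_pmf c)) a (\<lambda>_. c)"
    unfolding K_pmf_def
    by (intro antisym measure_pmf.K_stat_mono_AE ess_bounded_pmf) (auto simp: AE_measure_pmf_iff)
  then show ?thesis by (simp add: measure_pmf.K_stat_const)
qed

lemma K_pmf_bounded:
  assumes "finite (set_pmf p)" shows "\<exists>B. \<forall>a. \<bar>K_pmf p a\<bar> \<le> B"
proof -
  obtain B where "AE x in measure_pmf p. \<bar>x\<bar> \<le> B" by (rule ess_boundedE[OF ess_bounded_pmf[OF assms]])
  then have "\<bar>K_pmf p a\<bar> \<le> B" for a unfolding K_pmf_def by (intro measure_pmf.K_stat_abs_le) auto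
  then show ?thesis by blast
qed

lemma K_pmf_uminus: "finite (set_pmf p) \<Longrightarrow> K_pmf (map_pmf uminus p) a = - K_pmf p (- a)"
  by (simp only: K_stat_pmf[symmetric]) (simp only: measure_pmf.K_stat_uminus K_pmf_def)

context monotone_additive_functional
begin

text \<open>The positive linear functional induced by \<open>\<Phi>\<close> on the uniform closure of the space of
  rational multiples of differences of cumulant functions, as a relation.\<close>

definition pmf_limit :: "(ereal \<Rightarrow> real) \<Rightarrow> real \<Rightarrow> bool" where
  "pmf_limit f v \<longleftrightarrow> (\<forall>e>0. \<exists>p q. \<exists>n::nat>0. finite (set_pmf p) \<and> finite (set_pmf q) \<and>
     (\<forall>a. \<bar>f a - (K_pmf p a - K_pmf q a) / n\<bar> \<le> e) \<and> \<bar>v - (\<phi> p - \<phi> q) / n\<bar> \<le> e)"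

lemma pmf_limitE:
  assumes "pmf_limit f v" "e > 0"
  obtains p q n where "finite (set_pmf p)" "finite (set_pmf q)" "(n::nat) > 0"
    "\<And>a. \<bar>f a - (K_pmf p a - K_pmf q a) / n\<bar> \<le> e" "\<bar>v - (\<phi> p - \<phi> q) / n\<bar> \<le> e"
  using assms unfolding pmf_limit_def by blast

section \<open>Linearity, positivity and closedness of the induced functional\<close>

lemma ex_pmf_power:
  assumes fin: "finite (set_pmf p)"
  shows "\<exists>p'. finite (set_pmf p') \<and> (\<forall>a. K_pmf p' a = real k * K_pmf p a) \<and> \<phi> p' = real k * \<phi> p"
proof (induction k)
  case 0
  show ?case by (intro exI[of _ "return_pmf 0"]) (simp add: K_pmf_return phi_return)
next
  case (Suc k)
  then obtain p' where p': "finite (set_pmf p')" "\<And>a. K_pmf p' a = real k * K_pmf p a" "\<phi> p' = real k * \<phi> p"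
    by auto
  show ?case
    by (intro exI[of _ "conv_pmf p p'"])
      (use p' fin in \<open>simp add: K_pmf_conv[OF nonatomic] phi_conv finite_conv_pmf distrib_right\<close>)
qed

lemma ex_pmf_combination:
  assumes "finite (set_pmf p)" "finite (set_pmf q)"
  shows "\<exists>r. finite (set_pmf r) \<and> (\<forall>a. K_pmf r a = real k * K_pmf p a + real l * K_pmf q a)
    \<and> \<phi> r = real k * \<phi> p + real l * \<phi> q"
proof -
  obtain p' where p': "finite (set_pmf p')" "\<And>a. K_pmf p' a = real k * K_pmf p a" "\<phi> p' = real k * \<phi> p"
    using ex_pmf_power[OF assms(1)] by blast
  obtain q' where q': "finite (set_pmf q')" "\<And>a. K_pmf q' a = real l * K_pmf q a" "\<phi> q' = real l * \<phi> q"
    using ex_pmf_power[OF assms(2)] by blast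
  show ?thesis
    by (intro exI[of _ "conv_pmf p' q'"]) (use p' q' in \<open>simp add: K_pmf_conv[OF nonatomic] phi_conv finite_conv_pmf\<close>)
qed

lemma pmf_limit_K: "finite (set_pmf p) \<Longrightarrow> pmf_limit (K_pmf p) (\<phi> p)"
  unfolding pmf_limit_def
  by (intro allI impI exI[of _ p] exI[of _ "return_pmf 0"] exI[of _ "1::nat"]) (simp add: K_pmf_return phi_return)

lemma pmf_limit_const: "pmf_limit (\<lambda>_. c) c"
  using pmf_limit_K[of "return_pmf c"] by (simp add: K_pmf_return[abs_def] phi_return)

lemma pmf_limit_uminus:
  assumes "pmf_limit f v" shows "pmf_limit (\<lambda>a. - f a) (- v)"
  unfolding pmf_limit_def
proof (intro allI impI)
  fix e :: real assume "e > 0"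
  then obtain p q n where *: "finite (set_pmf p)" "finite (set_pmf q)" "(n::nat) > 0"
      "\<And>a. \<bar>f a - (K_pmf p a - K_pmf q a) / n\<bar> \<le> e" "\<bar>v - (\<phi> p - \<phi> q) / n\<bar> \<le> e"
    by (rule pmf_limitE[OF assms]) blast
  have "\<bar>- x - (z - y) / n\<bar> = \<bar>x - (y - z) / n\<bar>" for x y z :: real
    by (simp add: diff_divide_distrib abs_if)
  with * show "\<exists>p q. \<exists>n::nat>0. finite (set_pmf p) \<and> finite (set_pmf q) \<and>
     (\<forall>a. \<bar>- f a - (K_pmf p a - K_pmf q a) / n\<bar> \<le> e) \<and> \<bar>- v - (\<phi> p - \<phi> q) / n\<bar> \<le> e"
    by (intro exI[of _ q] exI[of _ p] exI[of _ n]) simp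
qed

lemma pmf_limit_add:
  assumes f: "pmf_limit f v" and g: "pmf_limit g w"
  shows "pmf_limit (\<lambda>a. f a + g a) (v + w)"
  unfolding pmf_limit_def
proof (intro allI impI)
  fix e :: real assume e: "e > 0"
  then have e2: "e / 2 > 0" by simp
  obtain p q n where pq: "finite (set_pmf p)" "finite (set_pmf q)" "(n::nat) > 0"
      "\<And>a. \<bar>f a - (K_pmf p a - K_pmf q a) / n\<bar> \<le> e / 2" "\<bar>v - (\<phi> p - \<phi> q) / n\<bar> \<le> e / 2"
    by (rule pmf_limitE[OF f e2]) blast
  obtain p' q' m where pq': "finite (set_pmf p')" "finite (set_pmf q')" "(m::nat) > 0"
      "\<And>a. \<bar>g a - (K_pmf p' a - K_pmf q' a) / m\<bar> \<le> e / 2" "\<bar>w - (\<phi> p' - \<phi> q') / m\<bar> \<le> e / 2"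
    by (rule pmf_limitE[OF g e2]) blast
  obtain r where r: "finite (set_pmf r)" "\<And>a. K_pmf r a = real m * K_pmf p a + real n * K_pmf p' a"
      "\<phi> r = real m * \<phi> p + real n * \<phi> p'"
    using ex_pmf_combination[OF pq(1) pq'(1)] by blast
  obtain s where s: "finite (set_pmf s)" "\<And>a. K_pmf s a = real m * K_pmf q a + real n * K_pmf q' a"
      "\<phi> s = real m * \<phi> q + real n * \<phi> q'"
    using ex_pmf_combination[OF pq(2) pq'(2)] by blast
  have eq: "((real m * x + real n * x') - (real m * y + real n * y')) / real (n * m) = (x - y) / n + (x' - y') / m"
    for x x' y y' using pq(3) pq'(3) by (simp add: field_simps)
  have "\<bar>f a + g a - (K_pmf r a - K_pmf s a) / real (n * m)\<bar> \<le> e" for a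
    unfolding r s eq using pq(4)[of a] pq'(4)[of a] by linarith
  moreover have "\<bar>v + w - (\<phi> r - \<phi> s) / real (n * m)\<bar> \<le> e"
    unfolding r s eq using pq(5) pq'(5) by linarith
  ultimately show "\<exists>p q. \<exists>n::nat>0. finite (set_pmf p) \<and> finite (set_pmf q) \<and>
     (\<forall>a. \<bar>f a + g a - (K_pmf p a - K_pmf q a) / n\<bar> \<le> e) \<and> \<bar>v + w - (\<phi> p - \<phi> q) / n\<bar> \<le> e"
    using r(1) s(1) pq(3) pq'(3) by (intro exI[of _ r] exI[of _ s] exI[of _ "n * m"]) simp
qed

lemma pmf_limit_diff:
  assumes "pmf_limit f v" "pmf_limit g w" shows "pmf_limit (\<lambda>a. f a - g a) (v - w)"
  using pmf_limit_add[OF assms(1) pmf_limit_uminus[OF assms(2)]] by simp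

lemma pmf_limit_sum:
  assumes "finite S" "\<And>i. i \<in> S \<Longrightarrow> pmf_limit (f i) (v i)"
  shows "pmf_limit (\<lambda>a. \<Sum>i\<in>S. f i a) (\<Sum>i\<in>S. v i)"
  using assms by (induction S rule: finite_induct) (auto intro: pmf_limit_add pmf_limit_const)

text \<open>Shifting \<open>p\<close> by \<open>n * (e / 2)\<close> absorbs the approximation error,
  so that monotonicity in the cumulant order applies to the approximants.\<close>

lemma pmf_limit_nonneg:
  assumes f: "pmf_limit f v" and nn: "\<And>a. f a \<ge> 0" shows "v \<ge> 0"
proof (rule field_le_epsilon)
  fix e :: real assume e: "e > 0"
  then have e2: "e / 2 > 0" by simp
  obtain p q n where pq: "finite (set_pmf p)" "finite (set_pmf q)" "(n::nat) > 0"
      "\<And>a. \<bar>f a - (K_pmf p a - K_pmf q a) / n\<bar> \<le> e / 2" "\<bar>v - (\<phi> p - \<phi> q) / n\<bar> \<le> e / 2"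
    by (rule pmf_limitE[OF f e2]) blast
  let ?p = "map_pmf (\<lambda>x. x + real n * (e / 2)) p"
  have "\<phi> q \<le> \<phi> ?p"
  proof (rule phi_K_mono)
    fix a
    have "- (e / 2) \<le> (K_pmf p a - K_pmf q a) / n" using pq(4)[of a] nn[of a] by linarith
    then have "K_pmf q a \<le> K_pmf p a + real n * (e / 2)" using pq(3) by (simp add: field_simps)
    also have "\<dots> = K_pmf ?p a"
      unfolding K_stat_pmf[OF pq(1), symmetric] by (simp add: measure_pmf.K_stat_shift ess_bounded_pmf pq(1) K_pmf_def)
    finally show "K_pmf q a \<le> K_pmf ?p a" .
  qed (use pq in auto)
  also have "\<phi> ?p = \<phi> p + real n * (e / 2)" using phi_shift[OF pq(1), of "\<lambda>x. x"] by (simp add: map_pmf_ident)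
  finally have "- (e / 2) \<le> (\<phi> p - \<phi> q) / n" using pq(3) by (simp add: field_simps)
  then show "0 \<le> v + e" using pq(5) by linarith
qed

lemma pmf_limit_abs_le:
  assumes f: "pmf_limit f v" and b: "\<And>a. \<bar>f a\<bar> \<le> b" shows "\<bar>v\<bar> \<le> b"
proof -
  have "0 \<le> b - v" using b by (intro pmf_limit_nonneg[OF pmf_limit_diff[OF pmf_limit_const f]]) (simp add: abs_le_iff)
  moreover have "0 \<le> b + f a" for a using b[of a] by linarith
  then have "0 \<le> b + v" by (rule pmf_limit_nonneg[OF pmf_limit_add[OF pmf_limit_const f]])
  ultimately show ?thesis by (simp add: abs_le_iff)
qed

text \<open>The functional is a contraction for the uniform norm. The case \<open>b = 0\<close> says
  that the value is determined by the function, so the relation is single-valued.\<close>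

lemma pmf_limit_diff_le:
  assumes "pmf_limit f v" "pmf_limit g w" "\<And>a. \<bar>f a - g a\<bar> \<le> b" shows "\<bar>v - w\<bar> \<le> b"
  using pmf_limit_abs_le[OF pmf_limit_diff[OF assms(1,2)] assms(3)] .

lemma pmf_limit_closed:
  assumes "\<And>e. e > 0 \<Longrightarrow> \<exists>g w. pmf_limit g w \<and> (\<forall>a. \<bar>f a - g a\<bar> \<le> e) \<and> \<bar>v - w\<bar> \<le> e"
  shows "pmf_limit f v"
  unfolding pmf_limit_def
proof (intro allI impI)
  fix e :: real assume "e > 0"
  then have e2: "e / 2 > 0" by simp
  obtain g w where g: "pmf_limit g w" "\<And>a. \<bar>f a - g a\<bar> \<le> e / 2" "\<bar>v - w\<bar> \<le> e / 2"
    using assms[OF e2] by blast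
  obtain p q n where pq: "finite (set_pmf p)" "finite (set_pmf q)" "(n::nat) > 0"
      "\<And>a. \<bar>g a - (K_pmf p a - K_pmf q a) / n\<bar> \<le> e / 2" "\<bar>w - (\<phi> p - \<phi> q) / n\<bar> \<le> e / 2"
    by (rule pmf_limitE[OF g(1) e2]) blast
  have "\<bar>f a - (K_pmf p a - K_pmf q a) / n\<bar> \<le> e" for a using g(2)[of a] pq(4)[of a] by linarith
  moreover have "\<bar>v - (\<phi> p - \<phi> q) / n\<bar> \<le> e" using g(3) pq(5) by linarith
  ultimately show "\<exists>p q. \<exists>n::nat>0. finite (set_pmf p) \<and> finite (set_pmf q) \<and>
     (\<forall>a. \<bar>f a - (K_pmf p a - K_pmf q a) / n\<bar> \<le> e) \<and> \<bar>v - (\<phi> p - \<phi> q) / n\<bar> \<le> e"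
    using pq by blast
qed

lemma pmf_limit_bounded:
  assumes "pmf_limit f v" shows "\<exists>B. \<forall>a. \<bar>f a\<bar> \<le> B"
proof -
  obtain p q n where pq: "finite (set_pmf p)" "finite (set_pmf q)" "(n::nat) > 0"
      "\<And>a. \<bar>f a - (K_pmf p a - K_pmf q a) / n\<bar> \<le> 1"
    by (rule pmf_limitE[OF assms zero_less_one]) blast
  obtain B C where BC: "\<And>a. \<bar>K_pmf p a\<bar> \<le> B" "\<And>a. \<bar>K_pmf q a\<bar> \<le> C"
    using K_pmf_bounded pq by metis
  have "\<bar>f a\<bar> \<le> 1 + (B + C) / n" for a
  proof -
    have "\<bar>K_pmf p a - K_pmf q a\<bar> \<le> B + C" using BC[of a] by linarith
    then have "\<bar>(K_pmf p a - K_pmf q a) / n\<bar> \<le> (B + C) / n" by (simp add: divide_right_mono)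
    then show ?thesis using pq(4)[of a] by linarith
  qed
  then show ?thesis by blast
qed

text \<open>The numerator is realised by repeated convolution, and the denominator is absorbed into
  the divisor \<open>n\<close> of the approximants.\<close>

lemma pmf_limit_scale_rat:
  assumes f: "pmf_limit f v" and l: "l > 0"
  shows "pmf_limit (\<lambda>a. real k / real l * f a) (real k / real l * v)"
  unfolding pmf_limit_def
proof (intro allI impI)
  fix e :: real assume e: "e > 0"
  define e' where "e' = e / (real k / real l + 1)"
  have e': "e' > 0" using e l by (simp add: e'_def add_nonneg_pos)
  have e'': "real k / real l * e' \<le> e" using e l by (simp add: e'_def field_simps)
  obtain p q n where pq: "finite (set_pmf p)" "finite (set_pmf q)" "(n::nat) > 0"
      "\<And>a. \<bar>f a - (K_pmf p a - K_pmf q a) / n\<bar> \<le> e'" "\<bar>v - (\<phi> p - \<phi> q) / n\<bar> \<le> e'"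
    by (rule pmf_limitE[OF f e']) blast
  obtain r where r: "finite (set_pmf r)" "\<And>a. K_pmf r a = real k * K_pmf p a" "\<phi> r = real k * \<phi> p"
    using ex_pmf_power[OF pq(1)] by blast
  obtain s where s: "finite (set_pmf s)" "\<And>a. K_pmf s a = real k * K_pmf q a" "\<phi> s = real k * \<phi> q"
    using ex_pmf_power[OF pq(2)] by blast
  have *: "\<bar>real k / real l * x - (real k * y - real k * z) / real (l * n)\<bar> \<le> e"
    if "\<bar>x - (y - z) / n\<bar> \<le> e'" for x y z
  proof -
    have "real k / real l * x - (real k * y - real k * z) / real (l * n) = real k / real l * (x - (y - z) / n)"
      using l pq(3) by (simp add: field_simps)
    then have "\<bar>real k / real l * x - (real k * y - real k * z) / real (l * n)\<bar> = real k / real l * \<bar>x - (y - z) / n\<bar>"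
      by (simp add: abs_mult)
    also have "\<dots> \<le> real k / real l * e'" using that by (intro mult_left_mono) auto
    finally show ?thesis using e'' by linarith
  qed
  show "\<exists>p q. \<exists>n::nat>0. finite (set_pmf p) \<and> finite (set_pmf q) \<and>
     (\<forall>a. \<bar>real k / real l * f a - (K_pmf p a - K_pmf q a) / n\<bar> \<le> e) \<and> \<bar>real k / real l * v - (\<phi> p - \<phi> q) / n\<bar> \<le> e"
    using r s l pq *[OF pq(4)] *[OF pq(5)]
    by (intro exI[of _ r] exI[of _ s] exI[of _ "l * n"]) (simp del: of_nat_mult)
qed

text \<open>Functions in the domain are bounded, so a real multiple is a uniform limit of rational
  multiples.\<close>

lemma pmf_limit_scale:
  assumes f: "pmf_limit f v" shows "pmf_limit (\<lambda>a. c * f a) (c * v)"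
proof -
  have pos: "pmf_limit (\<lambda>a. c * f a) (c * v)" if c: "c \<ge> 0" for c
  proof (rule pmf_limit_closed)
    fix e :: real assume e: "e > 0"
    obtain B where B: "\<And>a. \<bar>f a\<bar> \<le> B" using pmf_limit_bounded[OF f] by blast
    have vB: "\<bar>v\<bar> \<le> B" by (rule pmf_limit_abs_le[OF f B])
    define d where "d = e / (B + 1)"
    have d: "d > 0" "d * B \<le> e" using e vB by (auto simp: d_def field_simps)
    obtain q where q: "q \<in> \<rat>" "c < q" "q < c + d" using Rats_dense_in_real[of c "c + d"] d by auto
    then obtain k l where kl: "l \<noteq> 0" "q = real k / real l"
      using c Rats_abs_nat_div_natE[of q] by (metis abs_of_nonneg less_eq_real_def order_less_le_trans)
    have *: "\<bar>c * x - q * x\<bar> \<le> e" if "\<bar>x\<bar> \<le> B" for x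
    proof -
      have "\<bar>c * x - q * x\<bar> = \<bar>q - c\<bar> * \<bar>x\<bar>" by (simp add: abs_mult[symmetric] left_diff_distrib abs_minus_commute)
      also have "\<dots> \<le> d * B" using q that vB d by (intro mult_mono) auto
      finally show ?thesis using d by simp
    qed
    have "pmf_limit (\<lambda>a. q * f a) (q * v)" unfolding kl using kl by (intro pmf_limit_scale_rat f) simp
    then show "\<exists>g w. pmf_limit g w \<and> (\<forall>a. \<bar>c * f a - g a\<bar> \<le> e) \<and> \<bar>c * v - w\<bar> \<le> e"
      using * B vB by blast
  qed
  show ?thesis
  proof (cases "c \<ge> 0")
    case True then show ?thesis by (rule pos)
  next
    case False
    then show ?thesis using pmf_limit_uminus[OF pos[of "- c"]] by simp
  qed
qed

text \<open>The contraction property makes the values \<open>w n\<close> a Cauchy sequence; their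
  limit is the value at \<open>f\<close>.\<close>

lemma pmf_limit_complete:
  assumes g: "\<And>n. pmf_limit (g n) (w n)" and lim: "\<And>n a. \<bar>f a - g n a\<bar> \<le> d n" and d: "d \<longlonglongrightarrow> 0"
  shows "\<exists>v. pmf_limit f v"
proof -
  have diff: "\<bar>w m - w n\<bar> \<le> d m + d n" for m n
  proof (rule pmf_limit_diff_le[OF g g])
    show "\<bar>g m a - g n a\<bar> \<le> d m + d n" for a using lim[of a m] lim[of a n] by linarith
  qed
  have "Cauchy w"
  proof (rule metric_CauchyI)
    fix e :: real assume e: "e > 0"
    then have "\<forall>\<^sub>F n in sequentially. d n < e / 2" using d by (intro order_tendstoD) auto
    then obtain N where N: "\<And>n. n \<ge> N \<Longrightarrow> d n < e / 2" by (auto simp: eventually_sequentially)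
    show "\<exists>M. \<forall>m\<ge>M. \<forall>n\<ge>M. dist (w m) (w n) < e"
    proof (intro exI[of _ N] allI impI)
      fix m n assume "m \<ge> N" "n \<ge> N"
      then show "dist (w m) (w n) < e" using N[of m] N[of n] diff[of m n] by (simp add: dist_real_def)
    qed
  qed
  then obtain v where v: "w \<longlonglongrightarrow> v" using Cauchy_convergent convergent_def by blast
  have "pmf_limit f v"
  proof (rule pmf_limit_closed)
    fix e :: real assume e: "e > 0"
    have "\<forall>\<^sub>F n in sequentially. d n < e" using d e by (intro order_tendstoD) auto
    moreover have "\<forall>\<^sub>F n in sequentially. dist (w n) v < e" using v e by (rule tendstoD)
    ultimately have "\<forall>\<^sub>F n in sequentially. d n < e \<and> dist (w n) v < e" by (rule eventually_conj)
    then obtain n where n: "d n < e" "dist (w n) v < e" by (auto simp: eventually_sequentially)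
    have "\<bar>f a - g n a\<bar> \<le> e" for a using lim[of a n] n(1) by linarith
    moreover have "\<bar>v - w n\<bar> \<le> e" using n(2) by (simp add: dist_real_def abs_minus_commute)
    ultimately show "\<exists>g w. pmf_limit g w \<and> (\<forall>a. \<bar>f a - g a\<bar> \<le> e) \<and> \<bar>v - w\<bar> \<le> e"
      using g by blast
  qed
  then show ?thesis ..
qed

lemma pmf_limit_ramp:
  assumes t: "t > 0"
  shows "\<exists>v. pmf_limit (ramp t) v" "\<exists>v. pmf_limit (\<lambda>a. ramp t (- a)) v"
proof -
  let ?p = "\<lambda>n. two_point_pmf t (Suc n)"
  have d: "(\<lambda>n. 2 * t / real (Suc n)) \<longlonglongrightarrow> 0" by (intro LIMSEQ_Suc lim_const_over_n)
  have *: "\<bar>ramp t a - 1 / real (Suc n) * K_pmf (?p n) a\<bar> \<le> 2 * t / real (Suc n)" for n a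
  proof -
    have "\<bar>ramp t a - 1 / real (Suc n) * K_pmf (?p n) a\<bar> = \<bar>(K_pmf (?p n) a - real (Suc n) * ramp t a) / real (Suc n)\<bar>"
      by (simp add: abs_minus_commute diff_divide_distrib del: of_nat_Suc)
    also have "\<dots> \<le> 2 * t / real (Suc n)"
      using K_two_point_pmf_approx[of "Suc n" t a] t by (simp add: divide_right_mono del: of_nat_Suc)
    finally show ?thesis .
  qed
  show "\<exists>v. pmf_limit (ramp t) v"
    by (rule pmf_limit_complete[OF pmf_limit_scale[OF pmf_limit_K[OF finite_two_point_pmf]] * d])
  have **: "\<bar>ramp t (- a) - (- 1 / real (Suc n)) * K_pmf (map_pmf uminus (?p n)) a\<bar> \<le> 2 * t / real (Suc n)" for n a
    using *[of "- a" n] by (simp add: K_pmf_uminus finite_two_point_pmf del: of_nat_Suc)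
  have "pmf_limit (\<lambda>a. (- 1 / real (Suc n)) * K_pmf (map_pmf uminus (?p n)) a) ((- 1 / real (Suc n)) * \<phi> (map_pmf uminus (?p n)))" for n
    by (intro pmf_limit_scale pmf_limit_K) (simp add: finite_two_point_pmf)
  then show "\<exists>v. pmf_limit (\<lambda>a. ramp t (- a)) v"
    using ** d by (rule pmf_limit_complete)
qed

end

section \<open>Existence of the representing measure\<close>

lemma squash_uminus: "squash (- a) = - squash a"
  by (cases a) (auto simp: squash_def)

lemma squash_pos: "0 < a \<Longrightarrow> squash a = 1 / (1 + real_of_ereal (inverse a))"
  by (cases a) (auto simp: squash_def field_simps)

lemma real_of_ereal_inverse_nonneg: "0 < a \<Longrightarrow> 0 \<le> real_of_ereal (inverse a)"
  by (cases a) auto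

text \<open>On the positive half line \<open>squash\<close> is \<open>1 / (1 + s)\<close> with
  \<open>s = 1 / a\<close>; this bound converts distances in \<open>s\<close> into distances between
  values of \<open>squash\<close>.\<close>

lemma inverse_one_plus_diff_le:
  fixes s s' :: real assumes "s \<ge> 0" "s' \<ge> 0"
  shows "\<bar>1 / (1 + s) - 1 / (1 + s')\<bar> \<le> \<bar>s - s'\<bar>"
proof -
  have "1 / (1 + s) - 1 / (1 + s') = (s' - s) / ((1 + s) * (1 + s'))"
    using assms by (simp add: field_simps add_nonneg_eq_0_iff)
  then have "\<bar>1 / (1 + s) - 1 / (1 + s')\<bar> = \<bar>s - s'\<bar> / ((1 + s) * (1 + s'))"
    using assms by (simp add: abs_divide abs_mult abs_minus_commute)
  also have "\<dots> \<le> \<bar>s - s'\<bar> / 1"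
    using assms mult_mono[of 1 "1 + s" 1 "1 + s'"] by (intro divide_left_mono) auto
  finally show ?thesis by simp
qed

text \<open>In the coordinate \<open>s = 1 / a\<close> on the positive half line, \<open>step m j\<close> decreases linearly
  from 1 to 0 between \<open>j / m\<close> and \<open>(j + 1) / m\<close>, and \<open>hat m j\<close> is the tent with apex
  \<open>j / m\<close>, that is, at \<open>a = node m j\<close>.\<close>

definition step :: "nat \<Rightarrow> nat \<Rightarrow> ereal \<Rightarrow> real" where
  "step m j a = real m * (ramp (real (Suc j) / m) a - ramp (real j / m) a)"

definition hat :: "nat \<Rightarrow> nat \<Rightarrow> ereal \<Rightarrow> real" where
  "hat m j a = (if j = 0 then step m 0 a else step m j a - step m (j - 1) a)"

definition node :: "nat \<Rightarrow> nat \<Rightarrow> ereal" where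
  "node m j = (if j = 0 then \<infinity> else ereal (real m / real j))"

lemma step_nonpos: "a \<le> 0 \<Longrightarrow> step m j a = 0"
  by (auto simp: step_def ramp_def)

lemma step_eq_1: "m > 0 \<Longrightarrow> 0 < a \<Longrightarrow> real_of_ereal (inverse a) \<le> real j / m \<Longrightarrow> step m j a = 1"
  by (simp add: step_def ramp_def max_def field_simps)

lemma step_eq_0: "m > 0 \<Longrightarrow> real (Suc j) / m \<le> real_of_ereal (inverse a) \<Longrightarrow> step m j a = 0"
  by (simp add: step_def ramp_def max_def field_simps)

lemma step_nonneg: "0 \<le> step m j a"
proof -
  have "real j / m \<le> real (Suc j) / m" by (intro divide_right_mono) auto
  then have "ramp (real j / m) a \<le> ramp (real (Suc j) / m) a" by (auto simp: ramp_def)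
  then show ?thesis by (simp add: step_def)
qed

lemma step_le_1: assumes "m > 0" shows "step m j a \<le> 1"
proof -
  have "ramp (real (Suc j) / m) a \<le> ramp (real j / m) a + 1 / m"
    by (auto simp: ramp_def max_def add_divide_distrib)
  then have "real m * (ramp (real (Suc j) / m) a - ramp (real j / m) a) \<le> real m * (1 / m)"
    by (intro mult_left_mono) auto
  then show ?thesis using assms by (simp add: step_def)
qed

lemma step_mono: assumes m: "m > 0" shows "step m j a \<le> step m (Suc j) a"
proof (cases "0 < a \<and> real_of_ereal (inverse a) \<le> real (Suc j) / m")
  case True
  then show ?thesis using step_eq_1[OF m, of a "Suc j"] step_le_1[OF m] by simp
next
  case False
  then have "step m j a = 0" using step_nonpos[of a m j] step_eq_0[OF m, of j a] by fastforce
  then show ?thesis using step_nonneg by simp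
qed

lemma hat_nonneg: "m > 0 \<Longrightarrow> 0 \<le> hat m j a"
  using step_mono[of m "j - 1" a] step_nonneg[of m 0 a] by (auto simp: hat_def)

lemma sum_hat: "(\<Sum>j<Suc n. hat m j a) = step m n a"
  by (induction n) (auto simp: hat_def)

lemma squash_node: "m > 0 \<Longrightarrow> squash (node m j) = 1 / (1 + real j / m)"
  by (subst squash_pos) (auto simp: node_def)

lemma hat_support:
  assumes m: "m > 0" and nz: "hat m j a \<noteq> 0"
  shows "\<bar>squash (node m j) - squash a\<bar> \<le> 1 / m"
proof -
  have a: "0 < a"
  proof (rule ccontr)
    assume "\<not> 0 < a"
    then have "step m i a = 0" for i by (intro step_nonpos) simp
    then show False using nz by (simp add: hat_def split: if_splits)
  qed
  let ?s = "real_of_ereal (inverse a)"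
  have s: "?s \<ge> 0" by (rule real_of_ereal_inverse_nonneg[OF a])
  have le: "?s \<le> real (Suc j) / m"
  proof (rule ccontr)
    assume "\<not> ?thesis"
    then have "real (Suc j) / m \<le> ?s" by simp
    moreover have "real j / m \<le> real (Suc j) / m" by (intro divide_right_mono) auto
    ultimately have "step m j a = 0" "j > 0 \<Longrightarrow> step m (j - 1) a = 0"
      using step_eq_0[OF m, of j a] step_eq_0[OF m, of "j - 1" a] by auto
    then show False using nz by (auto simp: hat_def split: if_splits)
  qed
  have ge: "(real j - 1) / m \<le> ?s"
  proof (rule ccontr)
    assume n: "\<not> ?thesis"
    have "(real j - 1) / m \<le> 0" if "j = 0" using that by simp
    then have j: "j > 0" using s n by (meson not_gr_zero order_trans)
    have "?s \<le> real (j - 1) / m" "?s \<le> real j / m"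
    proof -
      show *: "?s \<le> real (j - 1) / m" using n j by (simp add: of_nat_diff)
      have "real (j - 1) / m \<le> real j / m" by (intro divide_right_mono) auto
      with * show "?s \<le> real j / m" by linarith
    qed
    then have "step m j a = 1" "step m (j - 1) a = 1" using step_eq_1[OF m a] by auto
    then show False using nz j by (simp add: hat_def)
  qed
  have "\<bar>real j / m - ?s\<bar> \<le> 1 / m"
    using le ge by (simp add: abs_le_iff add_divide_distrib diff_divide_distrib)
  then show ?thesis
    using inverse_one_plus_diff_le[of "real j / m" ?s] s a m by (simp add: squash_node squash_pos)
qed

text \<open>With mesh \<open>1 / m\<close>, the index \<open>m * m - 1\<close> reaches up to
  \<open>1 / a = m - 1 / m\<close>. Beyond it \<open>a\<close> is so close to 0 that
  \<open>squash a\<close> is at most \<open>1 / m\<close>, which explains the number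
  \<open>m * m\<close> of tents on each side.\<close>

lemma step_less_1_squash:
  assumes m: "m > 0" and lt: "step m (m * m - 1) a < 1" and a: "0 < a"
  shows "\<bar>squash a\<bar> \<le> 1 / m"
proof -
  let ?s = "real_of_ereal (inverse a)"
  have "?s > real (m * m - 1) / m" using step_eq_1[OF m a, of "m * m - 1"] lt by force
  moreover have "real (m * m - 1) / m = real m - 1 / m" using m by (simp add: of_nat_diff field_simps)
  moreover have "1 / real m \<le> 1" using m by simp
  ultimately have "real m \<le> 1 + ?s" by linarith
  then show ?thesis using m a by (simp add: squash_pos frac_le)
qed

context monotone_additive_functional
begin

lemma pmf_limit_step: "\<exists>v. pmf_limit (step m j) v" "\<exists>v. pmf_limit (\<lambda>a. step m j (- a)) v"
proof (atomize (full), cases "m = 0")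
  case True
  then show "(\<exists>v. pmf_limit (step m j) v) \<and> (\<exists>v. pmf_limit (\<lambda>a. step m j (- a)) v)"
    using pmf_limit_const[of 0] by (auto simp: step_def[abs_def])
next
  case False
  have "ramp 0 = (\<lambda>_. 0)"
    using real_of_ereal_inverse_nonneg by (auto simp: ramp_def fun_eq_iff)
  then have "(\<exists>v. pmf_limit (ramp t) v) \<and> (\<exists>v. pmf_limit (\<lambda>a. ramp t (- a)) v)" if "t \<ge> 0" for t
    using that pmf_limit_ramp[of t] pmf_limit_const[of 0] by (cases "t = 0") auto
  then have *: "(\<exists>v. pmf_limit (ramp (real i / m)) v) \<and> (\<exists>v. pmf_limit (\<lambda>a. ramp (real i / m) (- a)) v)" for i
    by simp
  show "(\<exists>v. pmf_limit (step m j) v) \<and> (\<exists>v. pmf_limit (\<lambda>a. step m j (- a)) v)"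
  proof
    obtain v w where "pmf_limit (ramp (real (Suc j) / m)) v" "pmf_limit (ramp (real j / m)) w" using * by blast
    then show "\<exists>v. pmf_limit (step m j) v"
      unfolding step_def[abs_def] by (intro exI[of _ "real m * (v - w)"] pmf_limit_scale pmf_limit_diff)
    obtain v w where "pmf_limit (\<lambda>a. ramp (real (Suc j) / m) (- a)) v" "pmf_limit (\<lambda>a. ramp (real j / m) (- a)) w"
      using * by blast
    then show "\<exists>v. pmf_limit (\<lambda>a. step m j (- a)) v"
      unfolding step_def[abs_def] by (intro exI[of _ "real m * (v - w)"] pmf_limit_scale pmf_limit_diff)
  qed
qed

lemma pmf_limit_hat: "\<exists>v. pmf_limit (hat m j) v" "\<exists>v. pmf_limit (\<lambda>a. hat m j (- a)) v"
proof -
  obtain v w where "pmf_limit (step m j) v" "pmf_limit (step m (j - 1)) w" using pmf_limit_step by blast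
  then show "\<exists>v. pmf_limit (hat m j) v"
    unfolding hat_def[abs_def] by (cases "j = 0") (auto intro: pmf_limit_diff)
  obtain v w where "pmf_limit (\<lambda>a. step m j (- a)) v" "pmf_limit (\<lambda>a. step m (j - 1) (- a)) w"
    using pmf_limit_step by blast
  then show "\<exists>v. pmf_limit (\<lambda>a. hat m j (- a)) v"
    unfolding hat_def[abs_def] by (cases "j = 0") (auto intro: pmf_limit_diff)
qed

text \<open>The tents on both half lines and the remainder around 0 form a partition of unity inside
  the domain of the functional. Their values are the weights, and positivity bounds the quadrature
  error by the oscillation of \<open>f\<close> on their supports.\<close>

lemma ex_quadrature:
  assumes m: "m > 0"
  shows "\<exists>(S :: (nat + nat) set) x w. finite S \<and> (\<forall>i\<in>S. w i \<ge> 0) \<and> (\<Sum>i\<in>S. w i) = 1 \<and>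
    (\<forall>f v e. pmf_limit f v \<longrightarrow> (\<forall>a b. \<bar>squash a - squash b\<bar> \<le> 1 / real m \<longrightarrow> \<bar>f a - f b\<bar> \<le> e) \<longrightarrow>
       \<bar>(\<Sum>i\<in>S. w i * f (x i)) - v\<bar> \<le> e)"
proof -
  define N where "N = m * m"
  define n where "n = N - 1"
  have N: "N = Suc n" using m by (simp add: N_def n_def)
  \<comment> \<open>Below \<open>N\<close>, \<open>Inl j\<close> indexes the tents for positive
    \<open>a\<close> and \<open>Inr j\<close> their mirror images; \<open>Inl N\<close> is the
    remainder, whose node is 0.\<close>
  define S :: "(nat + nat) set" where "S = {..N} <+> {..<N}"
  define x where "x i = (case i of Inl j \<Rightarrow> if j = N then 0 else node m j | Inr j \<Rightarrow> - node m j)" for i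
  define h where "h i a = (case i of Inl j \<Rightarrow> if j = N then 1 - step m n a - step m n (- a) else hat m j a
      | Inr j \<Rightarrow> hat m j (- a))" for i a
  have fin: "finite S" by (simp add: S_def)
  have h_nonneg: "h i a \<ge> 0" for i a
  proof -
    \<comment> \<open>The two steps live on opposite half lines, so at most one of them is
      subtracted from 1 and the remainder is nonnegative.\<close>
    have "step m n a = 0 \<or> step m n (- a) = 0"
      using step_nonpos[of a m n] step_nonpos[of "- a" m n] ereal_0_le_uminus_iff ereal_uminus_le_0_iff by (meson linear)
    then show ?thesis
      using step_le_1[OF m, of n a] step_le_1[OF m, of n "- a"] hat_nonneg[OF m]
      by (auto simp: h_def split: sum.split)
  qed
  have sum_S: "(\<Sum>i\<in>S. g i) = (\<Sum>j<N. g (Inl j)) + g (Inl N) + (\<Sum>j<N. g (Inr j))" for g :: "nat + nat \<Rightarrow> real"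
    unfolding S_def by (subst sum.Plus) (auto simp: lessThan_Suc_atMost[symmetric])
  have h_sum: "(\<Sum>i\<in>S. h i a) = 1" for a
    unfolding sum_S using sum_hat[of m a n] sum_hat[of m "- a" n] by (simp add: h_def N del: sum.lessThan_Suc)
  have supp: "\<bar>squash (x i) - squash a\<bar> \<le> 1 / m" if "h i a \<noteq> 0" for i a
  proof (cases i)
    case (Inr j)
    then show ?thesis using that hat_support[OF m, of j "- a"]
      by (simp add: h_def x_def squash_uminus abs_minus_commute)
  next
    case (Inl j)
    show ?thesis
    proof (cases "j = N")
      case False
      then show ?thesis using Inl that hat_support[OF m, of j a] by (simp add: h_def x_def)
    next
      case True
      have s0: "squash 0 = 0" by (simp add: squash_def zero_ereal_def)
      have nz: "1 - step m n a - step m n (- a) \<noteq> 0" using that Inl True by (simp add: h_def)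
      consider "a = 0" | "0 < a" | "0 < - a" using less_linear[of a 0] by (auto simp: ereal_less_uminus_reorder)
      then have "\<bar>squash a\<bar> \<le> 1 / m"
      proof cases
        case 1 then show ?thesis by (simp add: s0)
      next
        case 2
        then have "step m n (- a) = 0" by (intro step_nonpos) (simp add: less_imp_le)
        then show ?thesis using nz step_le_1[OF m, of n a] 2
          by (intro step_less_1_squash[OF m]) (auto simp: n_def N_def)
      next
        case 3
        then have "step m n a = 0" by (intro step_nonpos) (simp add: less_imp_le)
        then have "\<bar>squash (- a)\<bar> \<le> 1 / m" using nz step_le_1[OF m, of n "- a"] 3
          by (intro step_less_1_squash[OF m]) (auto simp: n_def N_def)
        then show ?thesis by (simp add: squash_uminus)
      qed
      then show ?thesis using Inl True by (simp add: x_def s0)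
    qed
  qed
  have "\<exists>v. pmf_limit (h i) v" for i
  proof (cases i)
    case (Inl j)
    obtain v v' where "pmf_limit (step m n) v" "pmf_limit (\<lambda>a. step m n (- a)) v'" using pmf_limit_step by blast
    then have "pmf_limit (\<lambda>a. 1 - step m n a - step m n (- a)) (1 - v - v')"
      by (intro pmf_limit_diff pmf_limit_const)
    then show ?thesis using Inl pmf_limit_hat(1)[of m j] by (cases "j = N") (auto simp: h_def[abs_def])
  next
    case (Inr j)
    then show ?thesis using pmf_limit_hat(2)[of m j] by (simp add: h_def[abs_def])
  qed
  then obtain w where w: "\<And>i. pmf_limit (h i) (w i)" by metis
  have "pmf_limit (\<lambda>a. \<Sum>i\<in>S. h i a) (\<Sum>i\<in>S. w i)" by (intro pmf_limit_sum fin w)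
  then have "pmf_limit (\<lambda>a. 1) (\<Sum>i\<in>S. w i)" by (simp add: h_sum)
  then have w1: "(\<Sum>i\<in>S. w i) = 1" using pmf_limit_diff_le[OF _ pmf_limit_const[of 1], of _ _ 0] by fastforce
  have w0: "w i \<ge> 0" for i using pmf_limit_nonneg[OF w h_nonneg] .
  have "\<bar>(\<Sum>i\<in>S. w i * f (x i)) - v\<bar> \<le> e"
    if f: "pmf_limit f v" and e: "\<And>a b. \<bar>squash a - squash b\<bar> \<le> 1 / real m \<Longrightarrow> \<bar>f a - f b\<bar> \<le> e" for f v e
  proof (rule pmf_limit_diff_le[OF _ f])
    have "pmf_limit (\<lambda>a. \<Sum>i\<in>S. f (x i) * h i a) (\<Sum>i\<in>S. f (x i) * w i)"
      by (intro pmf_limit_sum fin pmf_limit_scale w)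
    then show "pmf_limit (\<lambda>a. \<Sum>i\<in>S. f (x i) * h i a) (\<Sum>i\<in>S. w i * f (x i))"
      by (simp only: mult.commute[of "w _"])
    fix a
    have "(\<Sum>i\<in>S. f (x i) * h i a) - f a = (\<Sum>i\<in>S. (f (x i) - f a) * h i a)"
      by (simp add: left_diff_distrib sum_subtractf sum_distrib_left[symmetric] h_sum)
    also have "\<bar>\<dots>\<bar> \<le> (\<Sum>i\<in>S. e * h i a)"
    proof (rule order_trans[OF sum_abs sum_mono])
      fix i assume "i \<in> S"
      show "\<bar>(f (x i) - f a) * h i a\<bar> \<le> e * h i a"
      proof (cases "h i a = 0")
        case False
        then have "\<bar>f (x i) - f a\<bar> \<le> e" using supp by (intro e) auto
        then show ?thesis using h_nonneg[of i a] by (simp add: abs_mult mult_right_mono)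
      qed simp
    qed
    also have "\<dots> = e" by (simp add: sum_distrib_left[symmetric] h_sum)
    finally show "\<bar>(\<Sum>i\<in>S. f (x i) * h i a) - f a\<bar> \<le> e" .
  qed
  then show ?thesis using fin w0 w1 by (intro exI[of _ S] exI[of _ x] exI[of _ w]) blast
qed

text \<open>The weights as a discrete measure, transported by \<open>squash\<close> into the compact
  interval from -1 to 1.\<close>

lemma ex_quadrature_distribution:
  assumes m: "m > 0"
  shows "\<exists>\<nu>. real_distribution \<nu> \<and> measure \<nu> {-1..1} = 1 \<and>
    (\<forall>f v e. pmf_limit f v \<longrightarrow> (\<lambda>u. f (unsquash u)) \<in> borel_measurable borel \<longrightarrow>
       (\<forall>a b. \<bar>squash a - squash b\<bar> \<le> 1 / real m \<longrightarrow> \<bar>f a - f b\<bar> \<le> e) \<longrightarrow>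
       \<bar>(\<integral>u. f (unsquash u) \<partial>\<nu>) - v\<bar> \<le> e)"
proof -
  obtain S :: "(nat + nat) set" and x w where S: "finite S" "\<And>i. i \<in> S \<Longrightarrow> w i \<ge> 0" "(\<Sum>i\<in>S. w i) = 1"
    "\<And>f v e. pmf_limit f v \<Longrightarrow> (\<And>a b. \<bar>squash a - squash b\<bar> \<le> 1 / real m \<Longrightarrow> \<bar>f a - f b\<bar> \<le> e) \<Longrightarrow>
       \<bar>(\<Sum>i\<in>S. w i * f (x i)) - v\<bar> \<le> e"
    using ex_quadrature[OF m] by metis
  define P where "P = point_measure S (\<lambda>i. ennreal (w i))"
  have P: "prob_space P"
  proof (rule prob_spaceI)
    have "emeasure P (space P) = (\<Sum>i\<in>S. ennreal (w i))"
      using S(1) by (simp add: P_def emeasure_point_measure_finite space_point_measure)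
    also have "\<dots> = ennreal (\<Sum>i\<in>S. w i)" using S(2) by (intro sum_ennreal) auto
    finally show "emeasure P (space P) = 1" using S(3) by simp
  qed
  interpret P: prob_space P by (rule P)
  have X [measurable]: "(\<lambda>i. squash (x i)) \<in> borel_measurable P"
    by (simp add: P_def measurable_point_measure_eq1)
  define \<nu> where "\<nu> = distr P borel (\<lambda>i. squash (x i))"
  have "measure \<nu> {-1..1} = P.prob (space P)"
    unfolding \<nu>_def by (subst measure_distr) (use squash_bounds in \<open>auto simp: abs_le_iff minus_le_iff intro!: arg_cong[where f=P.prob]\<close>)
  then have "measure \<nu> {-1..1} = 1" by (simp add: P.prob_space)
  moreover have "real_distribution \<nu>" unfolding \<nu>_def by (rule P.real_distribution_distr) simp
  moreover have "(\<integral>u. f (unsquash u) \<partial>\<nu>) = (\<Sum>i\<in>S. w i * f (x i))"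
    if [measurable]: "(\<lambda>u. f (unsquash u)) \<in> borel_measurable borel" for f :: "ereal \<Rightarrow> real"
    unfolding \<nu>_def using S(1,2)
    by (subst integral_distr) (simp_all add: P_def lebesgue_integral_point_measure_finite measurable_point_measure_eq1)
  ultimately show ?thesis using S(4) by (intro exI[of _ \<nu>]) simp
qed

section \<open>From finitely supported laws to all bounded variables\<close>

lemma has_law_shift:
  assumes X: "has_law M X p" shows "has_law M (\<lambda>x. X x + c) (map_pmf (\<lambda>x. x + c) p)"
proof -
  have [measurable]: "X \<in> borel_measurable M" using X by (simp add: has_law_def Linfty_def)
  have "(\<lambda>x. X x + c) ` space M = (\<lambda>y. y + c) ` (X ` space M)" by auto
  then have bdd: "bounded ((\<lambda>x. X x + c) ` space M)"
    using X bounded_translation[of "X ` space M" c] by (simp add: has_law_def Linfty_def add.commute)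
  have "distr M borel (\<lambda>x. X x + c) = distr (distr M borel X) borel (\<lambda>y. y + c)"
    by (simp add: distr_distr o_def)
  moreover have "distr M borel X = distr (measure_pmf p) borel (\<lambda>x. x)" using X by (simp add: has_law_def)
  ultimately have "distr M borel (\<lambda>x. X x + c) = distr (distr (measure_pmf p) borel (\<lambda>x. x)) borel (\<lambda>y. y + c)"
    by (simp only:)
  then have "distr M borel (\<lambda>x. X x + c) = distr (measure_pmf (map_pmf (\<lambda>x. x + c) p)) borel (\<lambda>x. x)"
    by (simp add: map_pmf_rep_eq distr_distr o_def)
  with bdd show ?thesis by (simp add: has_law_def Linfty_def)
qed

lemma ex_pmf_finite_range:
  assumes X [measurable]: "X \<in> borel_measurable M" and fin: "finite (X ` space M)"
  shows "\<exists>p. finite (set_pmf p) \<and> has_law M X p"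
proof -
  have "X \<in> M \<rightarrow>\<^sub>M count_space (X ` space M)"
  proof (subst measurable_count_space_eq2[OF fin], intro conjI ballI)
    fix s
    show "X -` {s} \<inter> space M \<in> events" by (intro measurable_sets[OF X]) auto
  qed auto
  then have X' [measurable]: "X \<in> M \<rightarrow>\<^sub>M count_space UNIV"
    using measurable_compose[of X M "count_space (X ` space M)" "\<lambda>x. x" "count_space UNIV"] by simp
  define d where "d = distr M (count_space UNIV) X"
  \<comment> \<open>Some values may be taken with probability 0, while \<open>Abs_pmf\<close> asks
    that almost every point be an atom.\<close>
  have "AE x in M. \<forall>s\<in>X ` space M. X x = s \<longrightarrow> measure d {s} \<noteq> 0"
  proof (intro AE_finite_allI fin)
    fix s assume "s \<in> X ` space M"
    show "AE x in M. X x = s \<longrightarrow> measure d {s} \<noteq> 0"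
    proof (cases "measure d {s} = 0")
      case True
      then have "prob (X -` {s} \<inter> space M) = 0" by (simp add: d_def measure_distr)
      moreover have "X -` {s} \<inter> space M = {x \<in> space M. X x = s}" by auto
      moreover have "{x \<in> space M. X x = s} \<in> events" by measurable
      ultimately have "AE x in M. \<not> X x = s" by (intro AE_I'[of "{x \<in> space M. X x = s}"]) (auto simp: emeasure_eq_measure null_sets_def)
      then show ?thesis by eventually_elim simp
    qed simp
  qed
  then have "AE x in M. measure d {X x} \<noteq> 0" by (rule AE_mp) (rule AE_I2, auto)
  then have "AE x in d. measure d {x} \<noteq> 0" unfolding d_def by (subst AE_distr_iff) auto
  moreover have "prob_space d" "sets d = UNIV" by (simp_all add: d_def prob_space_distr)
  ultimately have d: "measure_pmf (Abs_pmf d) = d" by (intro Abs_pmf_inverse) simp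
  have "AE x in d. x \<in> X ` space M" unfolding d_def by (subst AE_distr_iff) auto
  then have "set_pmf (Abs_pmf d) \<subseteq> X ` space M"
    unfolding AE_measure_pmf_iff[symmetric, of "Abs_pmf d"] subset_eq d .
  moreover have "distr M borel X = distr d borel (\<lambda>x. x)" by (simp add: d_def distr_distr o_def)
  ultimately have "finite (set_pmf (Abs_pmf d)) \<and> has_law M X (Abs_pmf d)"
    using fin finite_subset[OF _ fin] finite_imp_bounded[OF fin] by (auto simp: has_law_def Linfty_def d)
  then show ?thesis ..
qed

lemma Phi_mono:
  assumes "X \<in> Linfty M" "Y \<in> Linfty M" "\<And>x. x \<in> space M \<Longrightarrow> X x \<le> Y x"
  shows "\<Phi> X \<le> \<Phi> Y"
proof -
  have [measurable]: "X \<in> borel_measurable M" "Y \<in> borel_measurable M" using assms by (auto simp: Linfty_def)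
  have "first_order_dominates M Y X"
    unfolding first_order_dominates_def
    by (intro allI finite_measure_mono) (use assms(3) in \<open>auto intro: order_trans\<close>)
  then show ?thesis
    using monotone_additive assms unfolding monotone_additive_statistic_def monotone_stat_def by blast
qed

text \<open>Rounding down to multiples of \<open>e\<close> leaves finitely many values and moves
  \<open>\<Phi>\<close> and every \<open>K_a\<close> by at most \<open>e\<close>, uniformly in
  \<open>a\<close>.\<close>

lemma pmf_limit_Linfty:
  assumes X: "X \<in> Linfty M"
  shows "pmf_limit (\<lambda>a. K_stat M a X) (\<Phi> X)"
proof (rule pmf_limit_closed)
  fix e :: real assume e: "e > 0"
  have mX [measurable]: "X \<in> borel_measurable M" using X by (simp add: Linfty_def)
  obtain B where B: "\<And>x. x \<in> space M \<Longrightarrow> \<bar>X x\<bar> \<le> B" using X by (auto simp: Linfty_def bounded_iff)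
  define Y where "Y x = e * real_of_int \<lfloor>X x / e\<rfloor>" for x
  have Y: "Y x \<le> X x" "X x \<le> Y x + e" for x
  proof -
    have "real_of_int \<lfloor>X x / e\<rfloor> \<le> X x / e" "X x / e \<le> real_of_int \<lfloor>X x / e\<rfloor> + 1" by linarith+
    then have "e * real_of_int \<lfloor>X x / e\<rfloor> \<le> e * (X x / e)" "e * (X x / e) \<le> e * (real_of_int \<lfloor>X x / e\<rfloor> + 1)"
      using e by (intro mult_left_mono; simp)+
    then show "Y x \<le> X x" "X x \<le> Y x + e" using e by (simp_all add: Y_def distrib_left)
  qed
  have mY: "Y \<in> borel_measurable M" unfolding Y_def by measurable
  have "Y ` space M \<subseteq> (\<lambda>k. e * real_of_int k) ` {\<lfloor>- B / e\<rfloor>..\<lfloor>B / e\<rfloor>}"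
  proof
    fix y assume "y \<in> Y ` space M"
    then obtain x where x: "x \<in> space M" "y = Y x" by auto
    have "- B \<le> X x" "X x \<le> B" using B[OF x(1)] by (auto simp: abs_le_iff)
    then have "- B / e \<le> X x / e" "X x / e \<le> B / e" using e by (intro divide_right_mono; simp)+
    then have "\<lfloor>- B / e\<rfloor> \<le> \<lfloor>X x / e\<rfloor>" "\<lfloor>X x / e\<rfloor> \<le> \<lfloor>B / e\<rfloor>" by (intro floor_mono; simp)+
    then show "y \<in> (\<lambda>k. e * real_of_int k) ` {\<lfloor>- B / e\<rfloor>..\<lfloor>B / e\<rfloor>}" by (auto simp: x Y_def)
  qed
  then have "finite (Y ` space M)" by (rule finite_subset) simp
  then obtain p where p: "finite (set_pmf p)" "has_law M Y p" using ex_pmf_finite_range[OF mY] by blast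
  have Ye: "has_law M (\<lambda>x. Y x + e) (map_pmf (\<lambda>x. x + e) p)" by (rule has_law_shift[OF p(2)])
  have "\<Phi> Y \<le> \<Phi> X" using p Y X by (intro Phi_mono) (auto simp: has_law_def)
  moreover have "\<Phi> X \<le> \<Phi> (\<lambda>x. Y x + e)" using Ye Y X by (intro Phi_mono) (auto simp: has_law_def)
  moreover have "\<Phi> (\<lambda>x. Y x + e) = \<phi> p + e"
    using Phi_has_law[OF Ye] phi_shift[OF p(1), of "\<lambda>x. x" e] by (simp add: map_pmf_ident)
  ultimately have "\<bar>\<Phi> X - \<phi> p\<bar> \<le> e" using Phi_has_law[OF p(2)] by (simp add: abs_le_iff)
  moreover have "\<bar>K_stat M a X - K_pmf p a\<bar> \<le> e" for a
  proof -
    have "\<bar>K_stat M a X - K_stat M a Y\<bar> \<le> e"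
    proof (intro K_stat_diff_le Linfty_ess_bounded X)
      show "Y \<in> Linfty M" using p by (simp add: has_law_def)
      show "AE x in M. \<bar>X x - Y x\<bar> \<le> e" using Y by (intro AE_I2) (simp add: abs_le_iff diff_le_eq add.commute)
    qed
    then show ?thesis by (simp add: K_stat_has_law[OF prob_space_axioms p(2)])
  qed
  ultimately show "\<exists>g w. pmf_limit g w \<and> (\<forall>a. \<bar>K_stat M a X - g a\<bar> \<le> e) \<and> \<bar>\<Phi> X - w\<bar> \<le> e"
    using pmf_limit_K[OF p(1)] by blast
qed

text \<open>Uniform continuity in the coordinate \<open>squash a\<close> drives the oscillation over
  distance \<open>1 / (n + 1)\<close>, and with it the quadrature error, to 0. The weak limit on the
  line is then carried to the extended reals by \<open>unsquash\<close>.\<close>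

lemma ex_representing_measure: "\<exists>\<mu>. borel_prob_measure \<mu> \<and> represents M \<mu> \<Phi>"
proof -
  let ?k = "\<lambda>X u. K_stat M (unsquash u) X"
  have cont: "isCont (?k X) u" if "X \<in> Linfty M" for X u
    using isCont_K_stat_unsquash[OF Linfty_ess_bounded[OF that]] .
  have mk [measurable]: "?k X \<in> borel_measurable borel" if "X \<in> Linfty M" for X
    using cont[OF that] by (intro borel_measurable_continuous_onI) (simp add: continuous_at_imp_continuous_on)
  have bdd: "\<exists>B. \<forall>a. \<bar>K_stat M a X\<bar> \<le> B" if X: "X \<in> Linfty M" for X
  proof -
    obtain B where "AE x in M. \<bar>X x\<bar> \<le> B" by (rule ess_boundedE[OF Linfty_ess_bounded[OF X]])
    then have "\<bar>K_stat M a X\<bar> \<le> B" for a using X by (intro K_stat_abs_le) (auto simp: Linfty_def)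
    then show ?thesis by blast
  qed
  obtain \<nu> where \<nu>: "\<And>n. real_distribution (\<nu> n)" "\<And>n. measure (\<nu> n) {-1..1} = 1"
    "\<And>n f v e. pmf_limit f v \<Longrightarrow> (\<lambda>u. f (unsquash u)) \<in> borel_measurable borel \<Longrightarrow>
       (\<And>a b. \<bar>squash a - squash b\<bar> \<le> 1 / real (Suc n) \<Longrightarrow> \<bar>f a - f b\<bar> \<le> e) \<Longrightarrow>
       \<bar>(\<integral>u. f (unsquash u) \<partial>\<nu> n) - v\<bar> \<le> e"
    using ex_quadrature_distribution[OF zero_less_Suc] by metis
  have lim: "(\<lambda>n. \<integral>u. ?k X u \<partial>\<nu> n) \<longlonglongrightarrow> \<Phi> X" if X: "X \<in> Linfty M" for X
  proof (rule LIMSEQ_I)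
    fix e :: real assume e: "e > 0"
    have "uniformly_continuous_on {-1..1} (?k X)"
      using cont[OF X] by (intro compact_uniformly_continuous) (auto simp: continuous_at_imp_continuous_on)
    then obtain d where d: "d > 0" "\<And>u v. u \<in> {-1..1} \<Longrightarrow> v \<in> {-1..1} \<Longrightarrow> dist v u < d \<Longrightarrow> dist (?k X v) (?k X u) < e / 2"
      unfolding uniformly_continuous_on_def using e by (metis half_gt_zero)
    obtain N where N: "1 / real (Suc N) < d" using nat_approx_posE[OF d(1)] by blast
    have "\<bar>(\<integral>u. ?k X u \<partial>\<nu> n) - \<Phi> X\<bar> \<le> e / 2" if n: "n \<ge> N" for n
    proof (rule \<nu>(3)[OF pmf_limit_Linfty[OF X] mk[OF X]])
      fix a b assume "\<bar>squash a - squash b\<bar> \<le> 1 / real (Suc n)"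
      also have "\<dots> \<le> 1 / real (Suc N)" using n by (intro divide_left_mono) auto
      finally have "dist (squash a) (squash b) < d" using N by (simp add: dist_real_def)
      then show "\<bar>K_stat M a X - K_stat M b X\<bar> \<le> e / 2"
        using d(2)[of "squash b" "squash a"] squash_bounds[of a] squash_bounds[of b] by (simp add: abs_le_iff dist_real_def)
    qed
    then show "\<exists>N. \<forall>n\<ge>N. norm ((\<integral>u. ?k X u \<partial>\<nu> n) - \<Phi> X) < e"
      using e by (intro exI[of _ N]) (fastforce intro: le_less_trans)
  qed
  have "\<exists>\<nu>'. real_distribution \<nu>' \<and> (\<forall>X\<in>Linfty M. (\<integral>u. ?k X u \<partial>\<nu>') = \<Phi> X)"
    using \<nu>(1,2) cont bdd lim by (intro weak_limit_of_bounded_support[of \<nu>]) blast+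
  then obtain \<nu>' where \<nu>': "real_distribution \<nu>'" "\<And>X. X \<in> Linfty M \<Longrightarrow> (\<integral>u. ?k X u \<partial>\<nu>') = \<Phi> X" by blast
  interpret N: real_distribution \<nu>' by (rule \<nu>'(1))
  have u [measurable]: "unsquash \<in> \<nu>' \<rightarrow>\<^sub>M borel" by (simp add: measurable_cong_sets[OF N.events_eq_borel refl])
  let ?\<mu> = "distr \<nu>' borel unsquash"
  have "represents M ?\<mu> \<Phi>"
    unfolding represents_def
  proof
    fix X assume X: "X \<in> Linfty M"
    have [measurable]: "(\<lambda>a. K_stat M a X) \<in> borel_measurable borel"
      by (rule measurable_K_stat[OF Linfty_ess_bounded[OF X]])
    interpret D: prob_space ?\<mu> by (rule N.prob_space_distr[OF u])
    obtain B where "\<And>a. \<bar>K_stat M a X\<bar> \<le> B" using bdd[OF X] by blast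
    then have "integrable ?\<mu> (\<lambda>a. K_stat M a X)" by (intro D.integrable_const_bound[where B=B]) auto
    moreover have "(\<integral>a. K_stat M a X \<partial>?\<mu>) = \<Phi> X" by (simp add: integral_distr \<nu>'(2)[OF X])
    ultimately show "has_bochner_integral ?\<mu> (\<lambda>a. K_stat M a X) (\<Phi> X)"
      by (simp add: has_bochner_integral_iff)
  qed
  moreover have "borel_prob_measure ?\<mu>" by (simp add: borel_prob_measure_def N.prob_space_distr)
  ultimately show ?thesis by blast
qed

end

section \<open>Uniqueness of the representing measure\<close>

lemma const_Linfty: "(\<lambda>_. c) \<in> Linfty M"
  by (auto simp: Linfty_def intro: bounded_subset[of "{c}"])

lemma add_Linfty:
  assumes "X \<in> Linfty M" "Y \<in> Linfty M" shows "(\<lambda>x. X x + Y x) \<in> Linfty M"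
proof -
  obtain B where B: "\<And>x. x \<in> space M \<Longrightarrow> norm (X x) \<le> B" using assms by (auto simp: Linfty_def bounded_iff)
  obtain C where C: "\<And>x. x \<in> space M \<Longrightarrow> norm (Y x) \<le> C" using assms by (auto simp: Linfty_def bounded_iff)
  have "norm (X x + Y x) \<le> B + C" if "x \<in> space M" for x
    using B[OF that] C[OF that] by (rule norm_triangle_le[OF add_mono])
  then have "bounded ((\<lambda>x. X x + Y x) ` space M)" by (auto simp: bounded_iff)
  then show ?thesis using assms by (auto simp: Linfty_def)
qed

lemma represented_monotone_additive:
  assumes M: "prob_space M" and \<mu>: "borel_prob_measure \<mu>" and rep: "represents M \<mu> \<Phi>"
  shows "monotone_additive_statistic M \<Phi>"
proof -
  interpret prob_space M by (rule M)
  interpret \<mu>: prob_space \<mu> using \<mu> by (simp add: borel_prob_measure_def)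
  have hb: "has_bochner_integral \<mu> (\<lambda>a. K_stat M a X) (\<Phi> X)" if "X \<in> Linfty M" for X
    using rep that by (simp add: represents_def)
  then have int: "integrable \<mu> (\<lambda>a. K_stat M a X)" "\<Phi> X = (\<integral>a. K_stat M a X \<partial>\<mu>)" if "X \<in> Linfty M" for X
    using that by (auto simp: has_bochner_integral_iff)
  have "\<Phi> X = \<Phi> Y" if XY: "X \<in> Linfty M" "Y \<in> Linfty M" "distr M borel X = distr M borel Y" for X Y
  proof -
    have "K_stat M a X = K_stat M a Y" for a
      using XY by (intro K_stat_law M Linfty_ess_bounded) (auto simp: Linfty_def)
    then show ?thesis using XY by (simp add: int(2))
  qed
  moreover have "\<Phi> (\<lambda>_. c) = c" for c
    by (simp add: int(2)[OF const_Linfty] K_stat_const \<mu>.prob_space)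
  moreover have "\<Phi> Y \<le> \<Phi> X" if XY: "X \<in> Linfty M" "Y \<in> Linfty M" "first_order_dominates M X Y" for X Y
    using XY unfolding int(2)[OF XY(1)] int(2)[OF XY(2)]
    by (intro integral_mono int(1) K_stat_first_order_mono[OF M] Linfty_ess_bounded) auto
  moreover have "\<Phi> (\<lambda>x. X x + Y x) = \<Phi> X + \<Phi> Y"
    if XY: "X \<in> Linfty M" "Y \<in> Linfty M" "indep_var borel X borel Y" for X Y
    using int(1)[OF XY(1)] int(1)[OF XY(2)] XY
    unfolding int(2)[OF XY(1)] int(2)[OF XY(2)] int(2)[OF add_Linfty[OF XY(1,2)]]
    by (simp add: K_stat_add Linfty_ess_bounded)
  ultimately show ?thesis
    unfolding monotone_additive_statistic_def statistic_def monotone_stat_def additive_stat_def by blast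
qed

section \<open>Tail masses recovered from integrals of ramps\<close>

lemma measurable_ramp [measurable]: "ramp t \<in> borel_measurable borel"
  unfolding ramp_def by measurable

lemma ramp_bounds: "0 \<le> t \<Longrightarrow> \<bar>ramp t a\<bar> \<le> t"
  using real_of_ereal_inverse_nonneg[of a] by (auto simp: ramp_def)

text \<open>The right derivative of \<open>max 0 (t - s)\<close> in \<open>t\<close> is the
  indicator of \<open>s \<le> t\<close>. For \<open>s = 1 / a\<close> this is a closed tail in
  \<open>squash a\<close>.\<close>

lemma ramp_quotient_tendsto:
  assumes t: "t > 0"
  shows "(\<lambda>k. real (Suc k) * (ramp (t + 1 / real (Suc k)) a - ramp t a)) \<longlonglongrightarrow> indicator {a. 1 / (1 + t) \<le> squash a} a"
proof (cases "0 < a")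
  case False
  then have "squash a \<le> 0" by (cases a) (auto simp: squash_def divide_le_0_iff)
  moreover have "0 < 1 / (1 + t)" using t by simp
  ultimately have "\<not> 1 / (1 + t) \<le> squash a" by linarith
  then show ?thesis using False by (simp add: ramp_def)
next
  case True
  let ?s = "real_of_ereal (inverse a)"
  have s: "?s \<ge> 0" by (rule real_of_ereal_inverse_nonneg[OF True])
  have "1 / (1 + t) \<le> 1 / (1 + u) \<longleftrightarrow> u \<le> t" if "u \<ge> 0" for u
    using that t by (simp add: field_simps)
  then have iff: "1 / (1 + t) \<le> squash a \<longleftrightarrow> ?s \<le> t"
    unfolding squash_pos[OF True] using s by blast
  show ?thesis
  proof (cases "?s \<le> t")
    case le: True
    have "real (Suc k) * (ramp (t + 1 / real (Suc k)) a - ramp t a) = 1" for k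
    proof -
      have "ramp (t + q) a - ramp t a = q" if "0 \<le> q" for q
        using that le True by (auto simp: ramp_def max_def)
      then have "ramp (t + 1 / real (Suc k)) a - ramp t a = 1 / real (Suc k)" by simp
      then show ?thesis by (simp del: of_nat_Suc)
    qed
    then show ?thesis using le iff by simp
  next
    case gt: False
    then obtain N where N: "1 / real (Suc N) < ?s - t" using nat_approx_posE[of "?s - t"] by auto
    have "real (Suc k) * (ramp (t + 1 / real (Suc k)) a - ramp t a) = 0" if "k \<ge> N" for k
    proof -
      have "1 / real (Suc k) \<le> 1 / real (Suc N)" using that by (intro divide_left_mono) auto
      then show ?thesis using gt N True by (simp add: ramp_def del: of_nat_Suc)
    qed
    then have "\<forall>\<^sub>F k in sequentially. real (Suc k) * (ramp (t + 1 / real (Suc k)) a - ramp t a) = 0"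
      by (auto simp: eventually_sequentially)
    then show ?thesis using gt iff by (simp add: tendsto_eventually)
  qed
qed

lemma ramp_quotient_bounds:
  "\<bar>real (Suc k) * (ramp (t + 1 / real (Suc k)) a - ramp t a)\<bar> \<le> 1"
proof -
  have "\<bar>ramp (t + q) a - ramp t a\<bar> \<le> q" if "0 \<le> q" for q
    using that by (auto simp: ramp_def max_def abs_if)
  then have "\<bar>ramp (t + 1 / real (Suc k)) a - ramp t a\<bar> \<le> 1 / real (Suc k)"
    by simp
  then have "real (Suc k) * \<bar>ramp (t + 1 / real (Suc k)) a - ramp t a\<bar> \<le> real (Suc k) * (1 / real (Suc k))"
    by (rule mult_left_mono) simp
  then show ?thesis by (simp add: abs_mult del: of_nat_Suc)
qed

text \<open>\<open>\<sigma>\<close> stands for the identity or for negation, which treats both half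
  lines at once. Ramps are 1-Lipschitz in \<open>t\<close>, so the constant 1 dominates the
  quotients.\<close>

lemma squash_tail_tendsto:
  assumes "prob_space \<mu>" and sets: "sets \<mu> = sets borel" and t: "t > 0"
    and \<sigma> [measurable]: "\<sigma> \<in> borel_measurable borel"
  shows "(\<lambda>k. real (Suc k) * ((\<integral>a. ramp (t + 1 / real (Suc k)) (\<sigma> a) \<partial>\<mu>) - (\<integral>a. ramp t (\<sigma> a) \<partial>\<mu>)))
     \<longlonglongrightarrow> measure \<mu> {a. 1 / (1 + t) \<le> squash (\<sigma> a)}"
proof -
  interpret \<mu>: prob_space \<mu> by fact
  note [measurable_cong] = sets
  have sp: "space \<mu> = UNIV" using sets_eq_imp_space_eq[OF sets] by simp
  let ?A = "{a. 1 / (1 + t) \<le> squash (\<sigma> a)}"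
  have A: "?A \<in> sets \<mu>"
  proof -
    have "{a \<in> space \<mu>. 1 / (1 + t) \<le> squash (\<sigma> a)} \<in> sets \<mu>" by measurable
    then show ?thesis by (simp add: sp)
  qed
  have int: "integrable \<mu> (\<lambda>a. ramp s (\<sigma> a))" if "s \<ge> 0" for s
    using ramp_bounds[OF that] by (intro \<mu>.integrable_const_bound[where B=s]) auto
  have "(\<lambda>k. \<integral>a. real (Suc k) * (ramp (t + 1 / real (Suc k)) (\<sigma> a) - ramp t (\<sigma> a)) \<partial>\<mu>) \<longlonglongrightarrow> (\<integral>a. indicator ?A a \<partial>\<mu>)"
  proof (rule integral_dominated_convergence[where w="\<lambda>_. 1"])
    show "AE a in \<mu>. (\<lambda>k. real (Suc k) * (ramp (t + 1 / real (Suc k)) (\<sigma> a) - ramp t (\<sigma> a))) \<longlonglongrightarrow> indicator ?A a"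
      using ramp_quotient_tendsto[OF t] by (intro AE_I2) (auto simp: indicator_def)
    show "AE a in \<mu>. norm (real (Suc k) * (ramp (t + 1 / real (Suc k)) (\<sigma> a) - ramp t (\<sigma> a))) \<le> 1" for k
      using ramp_quotient_bounds by (intro AE_I2) (simp only: real_norm_def)
    show "indicat_real ?A \<in> borel_measurable \<mu>" using A by simp
  qed auto
  moreover have "(\<integral>a. real (Suc k) * (ramp (t + 1 / real (Suc k)) (\<sigma> a) - ramp t (\<sigma> a)) \<partial>\<mu>)
      = real (Suc k) * ((\<integral>a. ramp (t + 1 / real (Suc k)) (\<sigma> a) \<partial>\<mu>) - (\<integral>a. ramp t (\<sigma> a) \<partial>\<mu>))" for k
    using int[of t] int[of "t + 1 / real (Suc k)"] t by (simp add: add_nonneg_nonneg del: of_nat_Suc)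
  moreover have "(\<integral>a. indicator ?A a \<partial>\<mu>) = measure \<mu> ?A" using A by simp
  ultimately show ?thesis by (simp only:)
qed

text \<open>Both measures integrate \<open>c * K_stat M a X\<close> to \<open>c * \<Phi> X\<close>,
  and uniform limits of such functions inherit the agreement.\<close>

lemma representing_integral_eq:
  assumes M: "prob_space M"
    and \<mu>: "borel_prob_measure \<mu>" "represents M \<mu> \<Phi>" and \<nu>: "borel_prob_measure \<nu>" "represents M \<nu> \<Phi>"
    and f: "f \<in> borel_measurable borel"
    and appr: "\<And>e. e > 0 \<Longrightarrow> \<exists>X\<in>Linfty M. \<exists>c. \<forall>a. \<bar>f a - c * K_stat M a X\<bar> \<le> e"
  shows "(\<integral>a. f a \<partial>\<mu>) = (\<integral>a. f a \<partial>\<nu>)"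
proof -
  have "\<bar>(\<integral>a. f a \<partial>\<mu>) - (\<integral>a. f a \<partial>\<nu>)\<bar> \<le> e" if e: "e > 0" for e
  proof -
    interpret prob_space M by (rule M)
    obtain X c where X: "X \<in> Linfty M" "\<And>a. \<bar>f a - c * K_stat M a X\<bar> \<le> e / 2"
      using appr[of "e / 2"] e by auto
    obtain B where "AE x in M. \<bar>X x\<bar> \<le> B" by (rule ess_boundedE[OF Linfty_ess_bounded[OF X(1)]])
    then have B: "\<bar>K_stat M a X\<bar> \<le> B" for a using X(1) by (intro K_stat_abs_le) (auto simp: Linfty_def)
    have fB: "\<bar>f a\<bar> \<le> e / 2 + \<bar>c\<bar> * B" for a
    proof -
      have "\<bar>c * K_stat M a X\<bar> \<le> \<bar>c\<bar> * B" unfolding abs_mult using B[of a] by (intro mult_left_mono) auto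
      then show ?thesis using X(2)[of a] by linarith
    qed
    have *: "\<bar>(\<integral>a. f a \<partial>\<kappa>) - c * \<Phi> X\<bar> \<le> e / 2" if l: "borel_prob_measure \<kappa>" "represents M \<kappa> \<Phi>" for \<kappa>
    proof -
      interpret l: prob_space \<kappa> using l by (simp add: borel_prob_measure_def)
      have sets: "sets \<kappa> = sets borel" using l by (simp add: borel_prob_measure_def)
      have fm: "f \<in> borel_measurable \<kappa>" using f measurable_cong_sets[OF sets refl] by blast
      have fi: "integrable \<kappa> f" using fB fm by (intro l.integrable_const_bound[where B="e / 2 + \<bar>c\<bar> * B"]) auto
      have K: "integrable \<kappa> (\<lambda>a. K_stat M a X)" "(\<integral>a. K_stat M a X \<partial>\<kappa>) = \<Phi> X"
        using l X(1) by (auto simp: represents_def has_bochner_integral_iff)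
      have "(\<integral>a. f a \<partial>\<kappa>) - c * \<Phi> X = (\<integral>a. f a - c * K_stat M a X \<partial>\<kappa>)"
        using fi K by simp
      also have "\<bar>\<dots>\<bar> \<le> (\<integral>a. \<bar>f a - c * K_stat M a X\<bar> \<partial>\<kappa>)" by (rule integral_abs_bound)
      also have "\<dots> \<le> (\<integral>a. e / 2 \<partial>\<kappa>)" using fi K X(2) by (intro integral_mono) auto
      finally show ?thesis by (simp add: l.prob_space)
    qed
    show ?thesis using *[OF \<mu>] *[OF \<nu>] by linarith
  qed
  then have "\<bar>(\<integral>a. f a \<partial>\<mu>) - (\<integral>a. f a \<partial>\<nu>)\<bar> \<le> 0"
    by (rule field_le_epsilon) (simp only: add_0)
  then show ?thesis by simp
qed

text \<open>The images under \<open>squash\<close> are compared on the half lines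
  \<open>{x<..}\<close>, which determine a finite measure on the line. Ramps and mirrored ramps give
  the thresholds on either side of 0; passage to the limit and total mass 1 take care of the
  rest.\<close>

lemma representing_measure_unique:
  assumes M: "prob_space M" and na: "nonatomic M"
    and \<mu>: "borel_prob_measure \<mu>" "represents M \<mu> \<Phi>" and \<nu>: "borel_prob_measure \<nu>" "represents M \<nu> \<Phi>"
  shows "\<mu> = \<nu>"
proof -
  interpret prob_space M by (rule M)
  have appr: "\<exists>X\<in>Linfty M. \<exists>c. \<forall>a. \<bar>ramp t a - c * K_stat M a X\<bar> \<le> e"
      "\<exists>X\<in>Linfty M. \<exists>c. \<forall>a. \<bar>ramp t (- a) - c * K_stat M a X\<bar> \<le> e" if t: "t > 0" and e: "e > 0" for t e
  proof -
    obtain n where n: "real n > 2 * t / e" using reals_Archimedean2 by blast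
    have "2 * t / e > 0" using t e by simp
    then have n0: "n > 0" using n by (cases n) auto
    have ne: "2 * t / real n \<le> e" using n n0 e by (simp add: field_simps)
    let ?p = "two_point_pmf t n"
    have ap: "\<bar>ramp t a - 1 / real n * K_pmf ?p a\<bar> \<le> e" for a
    proof -
      have "\<bar>ramp t a - 1 / real n * K_pmf ?p a\<bar> = \<bar>(K_pmf ?p a - real n * ramp t a) / real n\<bar>"
        using n0 by (simp add: abs_minus_commute diff_divide_distrib)
      also have "\<dots> \<le> 2 * t / real n"
        using K_two_point_pmf_approx[OF n0 t, of a] by (simp add: divide_right_mono)
      finally show ?thesis using ne by linarith
    qed
    obtain X where X: "has_law M X ?p" using ex_has_law[OF na finite_two_point_pmf] by blast
    show "\<exists>X\<in>Linfty M. \<exists>c. \<forall>a. \<bar>ramp t a - c * K_stat M a X\<bar> \<le> e"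
      using ap X by (intro bexI[of _ X] exI[of _ "1 / real n"]) (auto simp: K_stat_has_law[OF M X] has_law_def)
    have "finite (set_pmf (map_pmf uminus ?p))" by (simp add: finite_two_point_pmf)
    then obtain Y where Y: "has_law M Y (map_pmf uminus ?p)" using ex_has_law[OF na] by blast
    have "\<bar>ramp t (- a) - (- 1 / real n) * K_stat M a Y\<bar> \<le> e" for a
      using ap[of "- a"] by (simp add: K_stat_has_law[OF M Y] K_pmf_uminus finite_two_point_pmf)
    then show "\<exists>X\<in>Linfty M. \<exists>c. \<forall>a. \<bar>ramp t (- a) - c * K_stat M a X\<bar> \<le> e"
      using Y by (intro bexI[of _ Y] exI[of _ "- 1 / real n"]) (auto simp: has_law_def)
  qed
  have p: "prob_space \<mu>" "prob_space \<nu>" and sets: "sets \<mu> = sets borel" "sets \<nu> = sets borel"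
    using \<mu> \<nu> by (auto simp: borel_prob_measure_def)
  interpret mu: prob_space \<mu> by (rule p)
  interpret nu: prob_space \<nu> by (rule p)
  have tail: "measure \<mu> {a. 1 / (1 + t) \<le> squash a} = measure \<nu> {a. 1 / (1 + t) \<le> squash a}"
      "measure \<mu> {a. 1 / (1 + t) \<le> squash (- a)} = measure \<nu> {a. 1 / (1 + t) \<le> squash (- a)}" if t: "t > 0" for t
  proof -
    have "(\<integral>a. ramp s a \<partial>\<mu>) = (\<integral>a. ramp s a \<partial>\<nu>)" if "s > 0" for s
      by (rule representing_integral_eq[OF M \<mu> \<nu> measurable_ramp appr(1)[OF that]])
    then have eq: "(\<integral>a. ramp s a \<partial>\<mu>) = (\<integral>a. ramp s a \<partial>\<nu>)" if "s \<in> {t} \<union> (\<lambda>k. t + 1 / real (Suc k)) ` UNIV" for s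
      using that t by (auto simp: add_pos_pos simp del: of_nat_Suc)
    show "measure \<mu> {a. 1 / (1 + t) \<le> squash a} = measure \<nu> {a. 1 / (1 + t) \<le> squash a}"
      using squash_tail_tendsto[OF p(1) sets(1) t, of "\<lambda>a. a"] squash_tail_tendsto[OF p(2) sets(2) t, of "\<lambda>a. a"]
      by (simp add: eq del: of_nat_Suc) (rule LIMSEQ_unique)
    have "(\<integral>a. ramp s (- a) \<partial>\<mu>) = (\<integral>a. ramp s (- a) \<partial>\<nu>)" if "s > 0" for s
      by (rule representing_integral_eq[OF M \<mu> \<nu> _ appr(2)[OF that]]) measurable
    then have eq: "(\<integral>a. ramp s (- a) \<partial>\<mu>) = (\<integral>a. ramp s (- a) \<partial>\<nu>)" if "s \<in> {t} \<union> (\<lambda>k. t + 1 / real (Suc k)) ` UNIV" for s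
      using that t by (auto simp: add_pos_pos simp del: of_nat_Suc)
    show "measure \<mu> {a. 1 / (1 + t) \<le> squash (- a)} = measure \<nu> {a. 1 / (1 + t) \<le> squash (- a)}"
      using squash_tail_tendsto[OF p(1) sets(1) t, of "\<lambda>a. - a"] squash_tail_tendsto[OF p(2) sets(2) t, of "\<lambda>a. - a"]
      by (simp add: eq del: of_nat_Suc) (rule LIMSEQ_unique)
  qed
  let ?d = "\<lambda>\<kappa>. distr \<kappa> borel squash"
  have sm: "squash \<in> \<mu> \<rightarrow>\<^sub>M borel" "squash \<in> \<nu> \<rightarrow>\<^sub>M borel"
    using measurable_squash measurable_cong_sets[OF sets(1) refl] measurable_cong_sets[OF sets(2) refl] by blast+
  have sp: "space \<mu> = UNIV" "space \<nu> = UNIV" using sets_eq_imp_space_eq[OF sets(1)] sets_eq_imp_space_eq[OF sets(2)] by simp_all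
  interpret dm: prob_space "?d \<mu>" by (rule mu.prob_space_distr[OF sm(1)])
  interpret dn: prob_space "?d \<nu>" by (rule nu.prob_space_distr[OF sm(2)])
  have md: "measure (?d \<mu>) A = measure \<mu> {a. squash a \<in> A}" "measure (?d \<nu>) A = measure \<nu> {a. squash a \<in> A}"
    if "A \<in> sets borel" for A
    using that sm sp by (simp_all add: measure_distr vimage_def)
  have ge: "measure (?d \<mu>) {y..} = measure (?d \<nu>) {y..}" if y: "0 < y" "y < 1" for y
  proof -
    have "1 / (1 + (1 / y - 1)) = y" "1 / y - 1 > 0" using y by simp_all
    then show ?thesis using tail(1)[of "1 / y - 1"] by (simp add: md)
  qed
  have le: "measure (?d \<mu>) {..y} = measure (?d \<nu>) {..y}" if y: "-1 < y" "y < 0" for y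
  proof -
    have "1 / (1 + (1 / (- y) - 1)) = - y" "1 / (- y) - 1 > 0" using y by (simp_all add: field_simps)
    then have "measure \<mu> {a. - y \<le> squash (- a)} = measure \<nu> {a. - y \<le> squash (- a)}"
      using tail(2)[of "1 / (- y) - 1"] by (simp only:)
    then show ?thesis by (simp add: md squash_uminus)
  qed
  have lim: "measure (?d \<mu>) {x<..} = measure (?d \<nu>) {x<..}"
    if A: "\<And>n. A n \<in> sets borel" "incseq A" "(\<Union>n. A n) = {x<..}" and eq: "\<And>n. measure (?d \<mu>) (A n) = measure (?d \<nu>) (A n)"
    for A :: "nat \<Rightarrow> real set" and x
  proof (rule LIMSEQ_unique)
    show "(\<lambda>n. measure (?d \<mu>) (A n)) \<longlonglongrightarrow> measure (?d \<mu>) {x<..}"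
      using dm.finite_Lim_measure_incseq[of A] A by auto
    show "(\<lambda>n. measure (?d \<mu>) (A n)) \<longlonglongrightarrow> measure (?d \<nu>) {x<..}"
      unfolding eq using dn.finite_Lim_measure_incseq[of A] A by auto
  qed
  \<comment> \<open>The denominators start at 2, so that already the first term lies strictly below
    \<open>x + e\<close>.\<close>
  have approx: "\<exists>y :: nat \<Rightarrow> real. (\<forall>n. x < y n \<and> y n < x + e) \<and> decseq y \<and> y \<longlonglongrightarrow> x" if "e > 0" for x e
  proof (intro exI[of _ "\<lambda>n. x + e / real (Suc (Suc n))"] conjI allI)
    show "decseq (\<lambda>n. x + e / real (Suc (Suc n)))"
      using that by (intro decseq_SucI add_left_mono divide_left_mono) auto
    have "(\<lambda>n. x + e / real (Suc (Suc n))) \<longlonglongrightarrow> x + 0"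
      by (intro tendsto_intros LIMSEQ_Suc[where f="\<lambda>n. e / real (Suc n)"] LIMSEQ_Suc[where f="\<lambda>n. e / real n"] lim_const_over_n)
    then show "(\<lambda>n. x + e / real (Suc (Suc n))) \<longlonglongrightarrow> x" by simp
  qed (use that in \<open>auto simp: divide_less_eq\<close>)
  \<comment> \<open>Thresholds between -1 and 0 come from mirrored tails by complementation. The
    threshold -1 and those in \<open>{0..<1}\<close> are reached from above by continuity along
    increasing sets; outside, the half lines have mass 0 or 1.\<close>
  have main: "measure (?d \<mu>) {x<..} = measure (?d \<nu>) {x<..}" for x
  proof -
    have neg: "measure (?d \<mu>) {x<..} = measure (?d \<nu>) {x<..}" if x: "-1 < x" "x < 0" for x :: real
    proof -
      have "{x<..} = UNIV - {..x}" by auto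
      then show "measure (?d \<mu>) {x<..} = measure (?d \<nu>) {x<..}"
        using dm.prob_compl[of "{..x}"] dn.prob_compl[of "{..x}"] le[OF x] by simp
    qed
    consider "x \<ge> 1" | "0 \<le> x" "x < 1" | "-1 < x" "x < 0" | "x = -1" | "x < -1" by linarith
    then show ?thesis
    proof cases
      case 1
      then have "{a. squash a \<in> {x<..}} = {}" using squash_bounds by (auto simp: abs_le_iff not_less intro: order_trans)
      then show ?thesis by (simp only: md[OF greaterThan_borel]) simp
    next
      case 5
      have "squash a \<in> {x<..}" for a using squash_bounds[of a] 5 by (simp add: abs_le_iff)
      then show ?thesis using mu.prob_space nu.prob_space sp by (simp add: md)
    next
      case 3 then show ?thesis by (rule neg)
    next
      case 4
      obtain y where y: "\<And>n. x < y n \<and> y n < x + 1" "decseq y" "y \<longlonglongrightarrow> x"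
        using approx[OF zero_less_one] by blast
      show ?thesis
      proof (rule lim)
        show "incseq (\<lambda>n. {y n<..})" using y(2) by (force simp: incseq_def decseq_def intro: le_less_trans)
        show "(\<Union>n. {y n<..}) = {x<..}"
        proof (intro set_eqI iffI)
          fix z assume "z \<in> {x<..}"
          then have "\<forall>\<^sub>F n in sequentially. y n < z" using y(3) by (intro order_tendstoD) auto
          then show "z \<in> (\<Union>n. {y n<..})" by (auto simp: eventually_sequentially)
        qed (use y(1) in \<open>force intro: less_trans\<close>)
        show "measure (?d \<mu>) {y n<..} = measure (?d \<nu>) {y n<..}" for n using y(1)[of n] 4 by (intro neg) auto
      qed auto
    next
      case 2
      obtain y where y: "\<And>n. x < y n \<and> y n < x + (1 - x)" "decseq y" "y \<longlonglongrightarrow> x"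
        using approx[of "1 - x" x] 2 by auto
      show ?thesis
      proof (rule lim)
        show "incseq (\<lambda>n. {y n..})" using y(2) by (force simp: incseq_def decseq_def intro: order_trans)
        show "(\<Union>n. {y n..}) = {x<..}"
        proof (intro set_eqI iffI)
          fix z assume "z \<in> {x<..}"
          then have "\<forall>\<^sub>F n in sequentially. y n < z" using y(3) by (intro order_tendstoD) auto
          then show "z \<in> (\<Union>n. {y n..})" by (auto simp: eventually_sequentially intro: less_imp_le)
        qed (use y(1) in \<open>force intro: less_le_trans\<close>)
        show "measure (?d \<mu>) {y n..} = measure (?d \<nu>) {y n..}" for n using y(1)[of n] 2 by (intro ge) auto
      qed auto
    qed
  qed
  have d: "?d \<mu> = ?d \<nu>"
    by (rule measure_eqI_lessThan) (auto simp: dm.emeasure_eq_measure dn.emeasure_eq_measure main less_top[symmetric])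
  \<comment> \<open>\<open>unsquash\<close> is a measurable left inverse of \<open>squash\<close>,
    so a measure on the extended reals can be read off from its image.\<close>
  have recover: "\<kappa> = distr (?d \<kappa>) borel unsquash" if "sets \<kappa> = sets borel" for \<kappa> :: "ereal measure"
  proof -
    have "squash \<in> \<kappa> \<rightarrow>\<^sub>M borel" using measurable_squash measurable_cong_sets[OF that refl] by blast
    then have "distr (?d \<kappa>) borel unsquash = distr \<kappa> borel (\<lambda>a. a)" by (simp add: distr_distr o_def)
    also have "\<dots> = \<kappa>" using that by (rule distr_id2[OF sym])
    finally show ?thesis by (rule sym)
  qed
  show ?thesis using recover[OF sets(1)] recover[OF sets(2)] d by metis
qed

theorem theorem1:
  fixes M :: "'a measure" and \<Phi> :: "('a \<Rightarrow> real) \<Rightarrow> real"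
  assumes "prob_space M" and "nonatomic M"
  shows "(monotone_additive_statistic M \<Phi> \<longleftrightarrow>
            (\<exists>\<mu>. borel_prob_measure \<mu> \<and> represents M \<mu> \<Phi>)) \<and>
         (monotone_additive_statistic M \<Phi> \<longrightarrow>
            (\<exists>!\<mu>. borel_prob_measure \<mu> \<and> represents M \<mu> \<Phi>))"
proof -
  have ex: "\<exists>\<mu>. borel_prob_measure \<mu> \<and> represents M \<mu> \<Phi>" if "monotone_additive_statistic M \<Phi>"
  proof -
    interpret monotone_additive_functional M \<Phi>
      using assms that by (simp add: monotone_additive_functional_def monotone_additive_functional_axioms_def)
    show ?thesis by (rule ex_representing_measure)
  qed
  then show ?thesis
    using represented_monotone_additive[OF assms(1)] representing_measure_unique[OF assms] by blast
qed

end
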